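(* Let $\eta>0$, $p\ge 2$ and $s<1-\frac p2$. Let $\Phi(\xi)=-|\xi|^p+\Phi_1(\xi)$ be a real valued Fourier symbol with $|\Phi_1(\xi)|\le C(1+|\xi|^q)$ for some constants $C$ and $0\le q<p$, and let $L$ be the linear operator defined by $\widehat{Lf}(\xi)=-\Phi(\xi)\hat f(\xi)$. Then there does not exist any $T>0$ such that the initial value problem $$u_t+u_{xxx}+\eta Lu+(u_x)^2=0,\quad x\in\mathbb{R},\ t\ge 0,\qquad u(x,0)=u_0(x)$$ admits a unique local solution defined in the interval $[0,T]$ such that the flow-map $u_0\mapsto u$ is $C^2$-differentiable at the origin from $H^s(\mathbb{R})$ to $C([0,T];H^s(\mathbb{R}))$.
   Context: $\hat f(\xi)=\int_{\mathbb{R}}e^{-ix\xi}f(x)\,dx$ (the factor $1/\sqrt{2\pi}$ is omitted). $H^s(\mathbb{R})=\{f\in\mathcal{S}'(\mathbb{R}):\|f\|_{H^s}<\infty\}$ with $\|f\|_{H^s}=\big(\int_{\mathbb{R}}(1+|\xi|^2)^s|\hat f(\xi)|^2d\xi\big)^{1/2}$. The initial value problem is understood in its equivalent integral form $u(t)=V(t)u_0-\int_0^tV(t-t')(u_x)^2(t')\,dt'$, where $\widehat{V(t)w_0}(\xi)=e^{it\xi^3+\eta t\Phi(\xi)}\widehat{w_0}(\xi)$. *)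

theory Defs
  imports "HOL-Analysis.Analysis" "HOL-Library.Function_Algebras"
begin

section \<open>Tempered distributions on the real line\<close>

text \<open>
  A distribution is a functional on complex-valued test functions. Since test functions are not a
  separate type, distributions are normalised to be \<open>0\<close> off the Schwartz space, so that equality of
  distributions is equality of HOL functions.
\<close>

type_synonym dist = "(real \<Rightarrow> complex) \<Rightarrow> complex"

definition ddx_fun :: "(real \<Rightarrow> complex) \<Rightarrow> real \<Rightarrow> complex" where
  "ddx_fun \<phi> = (\<lambda>x. vector_derivative \<phi> (at x))"

definition schwartz :: "(real \<Rightarrow> complex) \<Rightarrow> bool" where
  "schwartz \<phi> \<longleftrightarrow>
     (\<forall>n x. (ddx_fun ^^ n) \<phi> differentiable at x) \<and>
     (\<forall>k n. bounded (range (\<lambda>x. x ^ k *\<^sub>R (ddx_fun ^^ n) \<phi> x)))"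

definition schwartz_seminorm :: "nat \<Rightarrow> nat \<Rightarrow> (real \<Rightarrow> complex) \<Rightarrow> real" where
  "schwartz_seminorm k n \<phi> = (SUP x. norm (x ^ k *\<^sub>R (ddx_fun ^^ n) \<phi> x))"

text \<open>Continuity for the Schwartz topology is the usual bound by finitely many seminorms.\<close>

definition tempered :: "dist \<Rightarrow> bool" where
  "tempered f \<longleftrightarrow>
     (\<forall>\<phi>. \<not> schwartz \<phi> \<longrightarrow> f \<phi> = 0) \<and>
     (\<forall>\<phi> \<psi> a b. schwartz \<phi> \<longrightarrow> schwartz \<psi> \<longrightarrow>
        f (\<lambda>x. a * \<phi> x + b * \<psi> x) = a * f \<phi> + b * f \<psi>) \<and>
     (\<exists>K N. \<forall>\<phi>. schwartz \<phi> \<longrightarrow>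
        norm (f \<phi>) \<le> K * (\<Sum>k\<le>N. \<Sum>n\<le>N. schwartz_seminorm k n \<phi>))"

text \<open>
  Regular distributions: those given by a function. Integrability against some
  \<open>(1 + \<bar>x\<bar>)\<^sup>-\<^sup>k\<close> is the standard growth condition under which a function is a tempered
  distribution; it implies Lebesgue measurability.
\<close>

definition tempered_fun :: "(real \<Rightarrow> complex) \<Rightarrow> bool" where
  "tempered_fun g \<longleftrightarrow> (\<exists>k::nat. integrable lebesgue (\<lambda>x. g x /\<^sub>R (1 + \<bar>x\<bar>) ^ k))"

definition dist_of :: "(real \<Rightarrow> complex) \<Rightarrow> dist" where
  "dist_of g = (\<lambda>\<phi>. if schwartz \<phi> then LINT x|lebesgue. g x * \<phi> x else 0)"

definition regular :: "dist \<Rightarrow> bool" where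
  "regular f \<longleftrightarrow> (\<exists>g. tempered_fun g \<and> f = dist_of g)"

text \<open>The function representing a regular distribution; it is determined almost everywhere.\<close>

definition fun_of :: "dist \<Rightarrow> real \<Rightarrow> complex" where
  "fun_of f = (SOME g. tempered_fun g \<and> f = dist_of g)"

definition ddx :: "dist \<Rightarrow> dist" where
  "ddx f = (\<lambda>\<phi>. if schwartz \<phi> then - f (ddx_fun \<phi>) else 0)"

definition fourier_fun :: "(real \<Rightarrow> complex) \<Rightarrow> real \<Rightarrow> complex" where
  "fourier_fun \<phi> = (\<lambda>\<xi>. LINT x|lebesgue. exp (- \<i> * of_real (x * \<xi>)) * \<phi> x)"

definition fourier :: "dist \<Rightarrow> dist" where
  "fourier f = (\<lambda>\<phi>. if schwartz \<phi> then f (fourier_fun \<phi>) else 0)"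

text \<open>The Fourier transform as a function, for distributions whose transform is regular.\<close>

definition fhat :: "dist \<Rightarrow> real \<Rightarrow> complex" where
  "fhat f = fun_of (fourier f)"


section \<open>Normed spaces with explicit carriers\<close>

text \<open>
  The index \<open>s\<close> of the Sobolev space is a real variable, so these spaces cannot be types. A normed
  space is a pair of a carrier (a subspace of an ambient real vector space) and a norm on it.
  Linearity below is over the reals, so differentiability is real Frechet differentiability.
\<close>

instantiation "fun" :: (type, real_vector) real_vector
begin

definition scaleR_fun :: "real \<Rightarrow> ('a \<Rightarrow> 'b) \<Rightarrow> 'a \<Rightarrow> 'b" where
  "scaleR_fun c f = (\<lambda>x. c *\<^sub>R f x)"

instance
  by standard (simp_all add: scaleR_fun_def fun_eq_iff scaleR_add_right scaleR_add_left)

end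

type_synonym 'a nspace = "'a set \<times> ('a \<Rightarrow> real)"

abbreviation pts :: "'a nspace \<Rightarrow> 'a set" where "pts X \<equiv> fst X"
abbreviation nrm :: "'a nspace \<Rightarrow> 'a \<Rightarrow> real" where "nrm X \<equiv> snd X"

text \<open>
  Bounded linear maps from \<open>X\<close> to \<open>Y\<close> with the operator norm, normalised to be \<open>0\<close> off the carrier
  of \<open>X\<close>.
\<close>

definition blin :: "'a::real_vector nspace \<Rightarrow> 'b::real_vector nspace \<Rightarrow> ('a \<Rightarrow> 'b) nspace" where
  "blin X Y =
     ({A. (\<forall>h\<in>pts X. A h \<in> pts Y) \<and> (\<forall>h. h \<notin> pts X \<longrightarrow> A h = 0) \<and>
          (\<forall>h\<in>pts X. \<forall>k\<in>pts X. \<forall>a b. A (a *\<^sub>R h + b *\<^sub>R k) = a *\<^sub>R A h + b *\<^sub>R A k) \<and>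
          (\<exists>K. \<forall>h\<in>pts X. nrm Y (A h) \<le> K * nrm X h)},
      \<lambda>A. SUP h\<in>{h \<in> pts X. nrm X h \<le> 1}. nrm Y (A h))"

definition has_frechet ::
  "'a::real_vector nspace \<Rightarrow> 'b::real_vector nspace \<Rightarrow> ('a \<Rightarrow> 'b) \<Rightarrow> ('a \<Rightarrow> 'b) \<Rightarrow> 'a \<Rightarrow> bool" where
  "has_frechet X Y F A x \<longleftrightarrow> A \<in> pts (blin X Y) \<and>
     (\<forall>\<epsilon>>0. \<exists>\<delta>>0. \<forall>h\<in>pts X. nrm X h < \<delta> \<longrightarrow>
        nrm Y (F (x + h) - F x - A h) \<le> \<epsilon> * nrm X h)"

text \<open>
  Being \<open>C\<^sup>2\<close> at a point: twice Frechet differentiable in a neighbourhood of it, the second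
  derivative being continuous at the point.
\<close>

definition C2_at ::
  "'a::real_vector nspace \<Rightarrow> 'b::real_vector nspace \<Rightarrow> ('a \<Rightarrow> 'b) \<Rightarrow> 'a \<Rightarrow> bool" where
  "C2_at X Y F x \<longleftrightarrow>
     (\<exists>\<rho>>0. \<exists>D1 D2.
        (\<forall>y\<in>pts X. nrm X (y - x) < \<rho> \<longrightarrow>
           F y \<in> pts Y \<and> has_frechet X Y F (D1 y) y \<and>
           has_frechet X (blin X Y) D1 (D2 y) y) \<and>
        (\<forall>\<epsilon>>0. \<exists>\<delta>>0. \<forall>y\<in>pts X. nrm X (y - x) < \<delta> \<longrightarrow>
           nrm (blin X (blin X Y)) (D2 y - D2 x) < \<epsilon>))"


section \<open>Sobolev spaces\<close>

definition Hs :: "real \<Rightarrow> dist nspace" where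
  "Hs s =
     ({f. tempered f \<and> regular (fourier f) \<and>
          integrable lebesgue (\<lambda>\<xi>. (1 + \<xi>\<^sup>2) powr s * (norm (fhat f \<xi>))\<^sup>2)},
      \<lambda>f. sqrt (LINT \<xi>|lebesgue. (1 + \<xi>\<^sup>2) powr s * (norm (fhat f \<xi>))\<^sup>2))"

text \<open>\<open>C([0,T]; H\<^sup>s)\<close>, its elements being normalised to be \<open>0\<close> outside \<open>[0,T]\<close>.\<close>

definition CHs :: "real \<Rightarrow> real \<Rightarrow> (real \<Rightarrow> dist) nspace" where
  "CHs s T =
     ({u. (\<forall>t\<in>{0..T}. u t \<in> pts (Hs s)) \<and> (\<forall>t. t \<notin> {0..T} \<longrightarrow> u t = 0) \<and>
          (\<forall>t\<in>{0..T}. \<forall>\<epsilon>>0. \<exists>\<delta>>0. \<forall>t'\<in>{0..T}.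
             \<bar>t' - t\<bar> < \<delta> \<longrightarrow> nrm (Hs s) (u t' - u t) < \<epsilon>)},
      \<lambda>u. SUP t\<in>{0..T}. nrm (Hs s) (u t))"


section \<open>The initial value problem\<close>

text \<open>
  \<open>V(t) w\<close> for the linear equation \<open>u\<^sub>t + u\<^sub>x\<^sub>x\<^sub>x + \<eta> L u = 0\<close>, where \<open>L\<close> is the Fourier multiplier
  with symbol \<open>- \<Phi>\<close>; meaningful when \<open>t \<ge> 0\<close> and the Fourier transform of \<open>w\<close> is a function.
\<close>

definition propagator :: "real \<Rightarrow> (real \<Rightarrow> real) \<Rightarrow> real \<Rightarrow> dist \<Rightarrow> dist" where
  "propagator \<eta> \<Phi> t w =
     (THE v. tempered v \<and>
        fourier v =
          dist_of (\<lambda>\<xi>. exp (\<i> * of_real (t * \<xi> ^ 3) + of_real (\<eta> * t * \<Phi> \<xi>)) * fhat w \<xi>))"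

text \<open>
  \<open>(f\<^sub>x)\<^sup>2\<close> makes sense when \<open>f\<^sub>x\<close> is a function whose square is a tempered distribution. For the
  propagator to act on the latter, its Fourier transform must be a function as well.
\<close>

definition ux_sq :: "dist \<Rightarrow> dist" where
  "ux_sq f = dist_of (\<lambda>x. (fun_of (ddx f) x)\<^sup>2)"

definition ux_sq_defined :: "dist \<Rightarrow> bool" where
  "ux_sq_defined f \<longleftrightarrow>
     regular (ddx f) \<and> tempered_fun (\<lambda>x. (fun_of (ddx f) x)\<^sup>2) \<and> regular (fourier (ux_sq f))"

text \<open>
  Solutions in \<open>C([0,T]; H\<^sup>s)\<close> of
  \<open>u(t) = V(t) u\<^sub>0 - \<integral>\<^sub>0\<^sup>t V(t - t') (u\<^sub>x)\<^sup>2(t') dt'\<close>. For \<open>s < 1\<close> the nonlinearity is not defined on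
  all of \<open>H\<^sup>s\<close>, so it is part of the notion of solution that it makes sense for almost every time;
  the time integral is the weak integral of a function with values in the tempered distributions.
\<close>

definition solves_ivp ::
  "real \<Rightarrow> real \<Rightarrow> (real \<Rightarrow> real) \<Rightarrow> real \<Rightarrow> dist \<Rightarrow> (real \<Rightarrow> dist) \<Rightarrow> bool" where
  "solves_ivp s \<eta> \<Phi> T u0 u \<longleftrightarrow>
     u \<in> pts (CHs s T) \<and>
     (AE t' in lebesgue. t' \<in> {0..T} \<longrightarrow> ux_sq_defined (u t')) \<and>
     (\<forall>t\<in>{0..T}. \<forall>\<phi>. schwartz \<phi> \<longrightarrow>
        set_integrable lebesgue {0..t} (\<lambda>t'. propagator \<eta> \<Phi> (t - t') (ux_sq (u t')) \<phi>) \<and>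
        u t \<phi> = propagator \<eta> \<Phi> t u0 \<phi> -
          (LINT t':{0..t}|lebesgue. propagator \<eta> \<Phi> (t - t') (ux_sq (u t')) \<phi>))"

end

theory Submission
  imports Defs "HOL-Probability.Characteristic_Functions" "HOL-Probability.Sinc_Integral"
begin

text \<open>
  The obstruction is a high-high-to-low interaction in the second Picard iterate. Take data whose
  Fourier transform is the indicator of \<open>N \<le> \<bar>\<xi>\<bar> \<le> N + 1\<close>; the square of its \<open>H\<^sup>s\<close> norm is at most
  \<open>2 N\<^sup>2\<^sup>s\<close> (\<open>bumps_Hs\<close>). Up to a time \<open>t = \<kappa> N\<^sup>-\<^sup>p\<close> with \<open>\<kappa>\<close> small, the dissipation has not yet damped the
  frequencies of size \<open>N\<close>, and the oscillating factors that produce an output frequency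
  \<open>\<bar>\<xi>\<bar> \<le> 1/4\<close> have a phase of at most 1. Such an output needs two input frequencies of opposite sign, so
  the two derivatives in the nonlinearity contribute a factor of at least \<open>N\<^sup>2\<close> of constant sign and nothing
  cancels: on \<open>\<bar>\<xi>\<bar> \<le> 1/4\<close> the second iterate is at least a constant times \<open>N\<^sup>2 t\<close>, that is \<open>N\<close> to the power
  \<open>2 - p\<close> (\<open>low_frequency_lower_bound\<close>). If the flow map were C2 at the origin, this would be bounded by a
  constant times the square of the norm of the data, hence by \<open>N\<^sup>2\<^sup>s\<close>, for every \<open>N\<close>. As
  \<open>2 s < 2 - p\<close>, this is impossible.

  That the second derivative of the flow map is the second Picard iterate cannot be read off from the
  equation, since \<open>u \<mapsto> (u\<^sub>x)\<^sup>2\<close> is not continuous on \<open>H\<^sup>s\<close>. Instead, for a nice datum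
  \<open>f\<close> and small \<open>\<gamma>\<close> a solution with datum \<open>\<gamma> f\<close> is constructed on the whole interval \<open>[0,T]\<close>; by uniqueness it
  is the value of the flow map. The construction is a Picard iteration for the Fourier transforms, in the class of
  functions bounded by a multiple of \<open>(1 + \<xi>\<^sup>2)\<^sup>-\<^sup>2\<close> (\<open>fixed_point\<close>). It closes because, by \<open>p \<ge> 2\<close>, the
  real part of the symbol is at most \<open>b - c (1 + \<xi>\<^sup>2)\<close>, so that integrating the semigroup in time gains the factor
  \<open>(1 + \<xi>\<^sup>2)\<^sup>-\<^sup>1\<close> which the nonlinearity loses. The remainder after the second iterate is of order
  \<open>\<gamma>\<^sup>3\<close> (\<open>second_order_expansion\<close>). For the flow map, being C2 gives a bound
  of the second difference \<open>S(2h) - 2 S(h) + S(0)\<close> by a multiple of the square of the norm of \<open>h\<close>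
  (\<open>C2_at_second_difference\<close>); dividing by \<open>\<gamma>\<^sup>2\<close>, with \<open>\<gamma>\<close> small, transfers that bound to the second iterate
  (\<open>flow_second_derivative_bound\<close>).

  Passing between distributions and Fourier transforms rests on two facts: Fourier inversion for
  Schwartz functions, which makes the Fourier transform injective on tempered distributions and so
  determines the propagator, and the almost everywhere uniqueness of the function that
  represents a regular distribution, without which neither the Sobolev norm nor \<open>(u\<^sub>x)\<^sup>2\<close> could be computed.
\<close>

section \<open>Schwartz functions\<close>

lemma ddx_fun_eqI: "(\<And>x. (f has_vector_derivative g x) (at x)) \<Longrightarrow> ddx_fun f = g"
  unfolding ddx_fun_def by (rule ext) (rule vector_derivative_at)

text \<open>
  The Schwartz space is the largest class of rapidly decaying functions that is closed under
  differentiation. To show that a function is Schwartz, it therefore suffices to place it in any such class, which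
  avoids formulas for higher derivatives.
\<close>

lemma schwartz_coinduct:
  assumes "P \<phi>"
    and deriv: "\<And>f. P f \<Longrightarrow> \<exists>g. P g \<and> (\<forall>x. (f has_vector_derivative g x) (at x))"
    and decay: "\<And>f k. P f \<Longrightarrow> \<exists>B. \<forall>x. norm (x ^ k *\<^sub>R f x) \<le> B"
  shows "schwartz \<phi>"
proof -
  have P: "P ((ddx_fun ^^ n) \<phi>)" for n
  proof (induction n)
    case (Suc n)
    obtain g where g: "P g" "\<And>x. ((ddx_fun ^^ n) \<phi> has_vector_derivative g x) (at x)"
      using deriv[OF Suc] by blast
    then show ?case by (simp add: ddx_fun_eqI[OF g(2)])
  qed (use assms(1) in simp)
  show ?thesis unfolding schwartz_def
  proof (intro conjI allI)
    show "(ddx_fun ^^ n) \<phi> differentiable at x" for n x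
      using deriv[OF P[of n]] by (meson differentiableI_vector)
    show "bounded (range (\<lambda>x. x ^ k *\<^sub>R (ddx_fun ^^ n) \<phi> x))" for k n
      using decay[OF P[of n], of k] by (auto simp: bounded_iff)
  qed
qed

lemma schwartz_has_deriv:
  assumes "schwartz \<phi>" shows "(\<phi> has_vector_derivative ddx_fun \<phi> x) (at x)"
proof -
  have "(ddx_fun ^^ 0) \<phi> differentiable at x" using assms unfolding schwartz_def by blast
  then show ?thesis by (simp add: ddx_fun_def vector_derivative_works)
qed

lemma schwartz_ddx:
  assumes "schwartz \<phi>" shows "schwartz (ddx_fun \<phi>)"
proof -
  have "(ddx_fun ^^ n) (ddx_fun \<phi>) = (ddx_fun ^^ Suc n) \<phi>" for n
    by (simp add: funpow_swap1)
  then show ?thesis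
    using assms unfolding schwartz_def by presburger
qed

lemma schwartz_ddx_iter: "schwartz \<phi> \<Longrightarrow> schwartz ((ddx_fun ^^ n) \<phi>)"
  by (induction n) (auto simp: schwartz_ddx)

lemma schwartz_bound:
  assumes "schwartz \<phi>" shows "\<exists>B. \<forall>x. norm (x ^ k *\<^sub>R \<phi> x) \<le> B"
proof -
  have "bounded (range (\<lambda>x. x ^ k *\<^sub>R (ddx_fun ^^ 0) \<phi> x))" using assms unfolding schwartz_def by blast
  then show ?thesis by (auto simp: bounded_iff)
qed

lemma schwartz_bound_pow:
  assumes "schwartz \<phi>" shows "\<exists>B. \<forall>x. (1 + \<bar>x\<bar>) ^ k * norm (\<phi> x) \<le> B"
proof -
  obtain B0 where B0: "\<And>x. norm (x ^ 0 *\<^sub>R \<phi> x) \<le> B0" using schwartz_bound[OF assms] by blast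
  obtain B1 where B1: "\<And>x. norm (x ^ k *\<^sub>R \<phi> x) \<le> B1" using schwartz_bound[OF assms] by blast
  have "(1 + \<bar>x\<bar>) ^ k * norm (\<phi> x) \<le> 2 ^ k * (B0 + B1)" for x
  proof -
    have "(1 + \<bar>x\<bar>) ^ k \<le> (2 * max 1 \<bar>x\<bar>) ^ k" by (rule power_mono) auto
    also have "\<dots> = 2 ^ k * (max 1 \<bar>x\<bar>) ^ k" by (simp add: power_mult_distrib)
    also have "\<dots> \<le> 2 ^ k * (1 + \<bar>x\<bar> ^ k)" by (intro mult_left_mono) (auto simp: max_def)
    finally have "(1 + \<bar>x\<bar>) ^ k * norm (\<phi> x) \<le> 2 ^ k * (1 + \<bar>x\<bar> ^ k) * norm (\<phi> x)"
      by (rule mult_right_mono) auto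
    also have "\<dots> = 2 ^ k * (norm (x ^ 0 *\<^sub>R \<phi> x) + norm (x ^ k *\<^sub>R \<phi> x))"
      by (simp add: algebra_simps power_abs)
    also have "\<dots> \<le> 2 ^ k * (B0 + B1)" using B0[of x] B1[of x] by (intro mult_left_mono) auto
    finally show ?thesis .
  qed
  then show ?thesis by blast
qed

lemma schwartz_lincomb:
  assumes "schwartz \<phi>" "schwartz \<psi>" shows "schwartz (\<lambda>x. a * \<phi> x + b * \<psi> x)"
proof -
  define P where "P f \<longleftrightarrow> (\<exists>\<phi> \<psi>. schwartz \<phi> \<and> schwartz \<psi> \<and> f = (\<lambda>x. a * \<phi> x + b * \<psi> x))" for f
  show ?thesis
  proof (rule schwartz_coinduct[of P])
    show "P (\<lambda>x. a * \<phi> x + b * \<psi> x)" using assms unfolding P_def by blast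
    fix f assume "P f"
    then obtain \<phi> \<psi> where s: "schwartz \<phi>" "schwartz \<psi>" and f: "f = (\<lambda>x. a * \<phi> x + b * \<psi> x)"
      unfolding P_def by blast
    have "(f has_vector_derivative (a * ddx_fun \<phi> x + b * ddx_fun \<psi> x)) (at x)" for x
      unfolding f by (intro has_vector_derivative_add has_vector_derivative_mult_right schwartz_has_deriv s)
    then show "\<exists>g. P g \<and> (\<forall>x. (f has_vector_derivative g x) (at x))"
      unfolding P_def using s schwartz_ddx by blast
    fix k
    obtain B0 where B0: "\<And>x. norm (x ^ k *\<^sub>R \<phi> x) \<le> B0" using schwartz_bound[OF s(1)] by blast
    obtain B1 where B1: "\<And>x. norm (x ^ k *\<^sub>R \<psi> x) \<le> B1" using schwartz_bound[OF s(2)] by blast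
    have "norm (x ^ k *\<^sub>R f x) \<le> norm a * B0 + norm b * B1" for x
    proof -
      have "x ^ k *\<^sub>R f x = a * (x ^ k *\<^sub>R \<phi> x) + b * (x ^ k *\<^sub>R \<psi> x)"
        by (simp add: f scaleR_conv_of_real algebra_simps)
      also have "norm \<dots> \<le> norm a * norm (x ^ k *\<^sub>R \<phi> x) + norm b * norm (x ^ k *\<^sub>R \<psi> x)"
        by (metis norm_mult norm_triangle_ineq)
      also have "\<dots> \<le> norm a * B0 + norm b * B1"
        by (intro add_mono mult_left_mono B0 B1) auto
      finally show ?thesis .
    qed
    then show "\<exists>B. \<forall>x. norm (x ^ k *\<^sub>R f x) \<le> B" by blast
  qed
qed

lemma schwartz_cmult: "schwartz \<phi> \<Longrightarrow> schwartz (\<lambda>x. a * \<phi> x)"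
  using schwartz_lincomb[of \<phi> \<phi> a 0] by simp

lemma schwartz_times_x:
  assumes "schwartz \<phi>" shows "schwartz (\<lambda>x. of_real x * \<phi> x)"
proof -
  define P :: "(real \<Rightarrow> complex) \<Rightarrow> bool"
    where "P f \<longleftrightarrow> (\<exists>\<phi> \<psi>. schwartz \<phi> \<and> schwartz \<psi> \<and> f = (\<lambda>x. of_real x * \<phi> x + \<psi> x))" for f
  show ?thesis
  proof (rule schwartz_coinduct[of P])
    show "P (\<lambda>x. of_real x * \<phi> x)"
      unfolding P_def using assms schwartz_cmult[OF assms, of 0] by fastforce
    fix f assume "P f"
    then obtain \<phi> \<psi> where s: "schwartz \<phi>" "schwartz \<psi>" and f: "f = (\<lambda>x. of_real x * \<phi> x + \<psi> x)"
      unfolding P_def by blast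
    have "(f has_vector_derivative (of_real x * ddx_fun \<phi> x + (1 * \<phi> x + 1 * ddx_fun \<psi> x))) (at x)" for x
    proof -
      have "((\<lambda>x. of_real x * \<phi> x) has_vector_derivative (of_real x * ddx_fun \<phi> x + 1 * \<phi> x)) (at x)"
        by (rule has_vector_derivative_mult)
          (use schwartz_has_deriv[OF s(1)] has_vector_derivative_of_real[OF DERIV_ident, where 'a=complex] in auto)
      from has_vector_derivative_add[OF this schwartz_has_deriv[OF s(2)]] show ?thesis
        unfolding f by (simp add: add.assoc)
    qed
    moreover have "schwartz (\<lambda>x. 1 * \<phi> x + 1 * ddx_fun \<psi> x)" by (intro schwartz_lincomb s schwartz_ddx)
    ultimately show "\<exists>g. P g \<and> (\<forall>x. (f has_vector_derivative g x) (at x))"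
      unfolding P_def using s schwartz_ddx by blast
    fix k
    obtain B0 where B0: "\<And>x. norm (x ^ Suc k *\<^sub>R \<phi> x) \<le> B0" using schwartz_bound[OF s(1)] by blast
    obtain B1 where B1: "\<And>x. norm (x ^ k *\<^sub>R \<psi> x) \<le> B1" using schwartz_bound[OF s(2)] by blast
    have "norm (x ^ k *\<^sub>R f x) \<le> B0 + B1" for x
    proof -
      have "x ^ k *\<^sub>R f x = (x ^ Suc k *\<^sub>R \<phi> x) + (x ^ k *\<^sub>R \<psi> x)"
        by (simp add: f scaleR_conv_of_real algebra_simps)
      then show ?thesis using norm_triangle_le[OF add_mono[OF B0 B1]] by metis
    qed
    then show "\<exists>B. \<forall>x. norm (x ^ k *\<^sub>R f x) \<le> B" by blast
  qed
qed

lemma schwartz_reflect: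
  assumes "schwartz \<phi>" shows "schwartz (\<lambda>x. \<phi> (- x))"
proof -
  define P :: "(real \<Rightarrow> complex) \<Rightarrow> bool" where "P f \<longleftrightarrow> (\<exists>\<phi>. schwartz \<phi> \<and> f = (\<lambda>x. \<phi> (- x)))" for f
  show ?thesis
  proof (rule schwartz_coinduct[of P])
    show "P (\<lambda>x. \<phi> (- x))" using assms unfolding P_def by blast
    fix f assume "P f"
    then obtain \<phi> where s: "schwartz \<phi>" and f: "f = (\<lambda>x. \<phi> (- x))" unfolding P_def by blast
    have "(f has_vector_derivative (- 1 * ddx_fun \<phi> (- x))) (at x)" for x
    proof -
      have "((\<phi> \<circ> uminus) has_vector_derivative (- 1 *\<^sub>R ddx_fun \<phi> (- x))) (at x)"
        by (rule vector_diff_chain_at) (auto intro!: derivative_eq_intros schwartz_has_deriv s)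
      then show ?thesis by (simp add: f comp_def)
    qed
    moreover have "P (\<lambda>x. (\<lambda>x. - 1 * ddx_fun \<phi> x) (- x))"
      unfolding P_def using schwartz_cmult[OF schwartz_ddx[OF s], of "- 1"] by blast
    ultimately show "\<exists>g. P g \<and> (\<forall>x. (f has_vector_derivative g x) (at x))" by blast
    fix k
    obtain B where B: "\<And>x. norm (x ^ k *\<^sub>R \<phi> x) \<le> B" using schwartz_bound[OF s] by blast
    have "norm (x ^ k *\<^sub>R f x) \<le> B" for x using B[of "- x"] by (simp add: f power_abs)
    then show "\<exists>B. \<forall>x. norm (x ^ k *\<^sub>R f x) \<le> B" by blast
  qed
qed

text \<open>
  With \<open>u = a (1 + x\<^sup>2)\<close>, a single term of the exponential series gives \<open>u\<^sup>k \<le> k! e\<^sup>u\<close>, and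
  \<open>\<bar>x\<bar> \<le> 1 + x\<^sup>2\<close>.
\<close>

lemma exp_poly_bounded:
  fixes a :: real assumes "a > 0" shows "\<exists>B. \<forall>x::real. \<bar>x\<bar> ^ k * exp (- a * x\<^sup>2) \<le> B"
proof -
  have "(1 + x\<^sup>2) ^ k * exp (- a * (1 + x\<^sup>2)) \<le> fact k / a ^ k" for x :: real
  proof -
    define u where "u = a * (1 + x\<^sup>2)"
    have u: "u \<ge> 0" using assms by (simp add: u_def)
    have "u ^ k / fact k \<le> exp u"
    proof -
      have "u ^ k / fact k = u ^ k /\<^sub>R fact k" by (simp add: field_simps)
      also have "\<dots> \<le> (\<Sum>n<Suc k. u ^ n /\<^sub>R fact n)"
        by (rule member_le_sum) (use u in auto)
      also have "\<dots> \<le> (\<Sum>n. u ^ n /\<^sub>R fact n)"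
        by (rule sum_le_suminf) (use u summable_exp[of u] in auto)
      also have "\<dots> = exp u" by (simp add: exp_def)
      finally show ?thesis .
    qed
    then have "u ^ k * exp (- u) \<le> fact k" by (simp add: exp_minus field_simps)
    moreover have "u ^ k = a ^ k * (1 + x\<^sup>2) ^ k" by (simp add: u_def power_mult_distrib)
    ultimately show ?thesis using assms by (simp add: u_def field_simps)
  qed
  note * = this
  have "\<bar>x\<bar> ^ k * exp (- a * x\<^sup>2) \<le> fact k / a ^ k * exp a" for x :: real
  proof -
    have "\<bar>x\<bar> \<le> 1 + x\<^sup>2"
      using zero_le_power2[of "\<bar>x\<bar> - 1/2"] by (simp add: power2_eq_square algebra_simps)
    then have "\<bar>x\<bar> ^ k \<le> (1 + x\<^sup>2) ^ k" by (rule power_mono) auto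
    then have "\<bar>x\<bar> ^ k * exp (- a * x\<^sup>2) \<le> (1 + x\<^sup>2) ^ k * exp (- a * x\<^sup>2)" by (rule mult_right_mono) auto
    also have "\<dots> = ((1 + x\<^sup>2) ^ k * exp (- a * (1 + x\<^sup>2))) * exp a"
      by (simp add: exp_add[symmetric] algebra_simps)
    also have "\<dots> \<le> fact k / a ^ k * exp a" by (rule mult_right_mono[OF *]) auto
    finally show ?thesis .
  qed
  then show ?thesis by blast
qed

text \<open>
  The class for the coinduction consists of the products of polynomials with the Gaussian.
\<close>

lemma schwartz_gaussian:
  fixes a y :: real assumes a: "a > 0"
  shows "schwartz (\<lambda>x. of_real (exp (- a * (x - y)\<^sup>2)))"
proof -
  define P :: "(real \<Rightarrow> complex) \<Rightarrow> bool"
    where "P f \<longleftrightarrow> (\<exists>p. f = (\<lambda>x. of_real (poly p (x - y) * exp (- a * (x - y)\<^sup>2))))" for f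
  show ?thesis
  proof (rule schwartz_coinduct[of P])
    show "P (\<lambda>x. of_real (exp (- a * (x - y)\<^sup>2)))" unfolding P_def by (rule exI[of _ 1]) simp
    fix f assume "P f"
    then obtain p where f: "f = (\<lambda>x. of_real (poly p (x - y) * exp (- a * (x - y)\<^sup>2)))"
      unfolding P_def by blast
    have "(f has_vector_derivative (of_real (poly (pderiv p + [:0, -2 * a:] * p) (x - y) * exp (- a * (x - y)\<^sup>2)))) (at x)" for x
      unfolding f
      by (rule has_vector_derivative_of_real) (auto intro!: derivative_eq_intros simp: algebra_simps)
    then show "\<exists>g. P g \<and> (\<forall>x. (f has_vector_derivative g x) (at x))" unfolding P_def by blast
    fix k
    define q where "q = [:y, 1:] ^ k * p"
    obtain B where B: "\<And>i z. \<bar>z\<bar> ^ i * exp (- a * z\<^sup>2) \<le> B i" using exp_poly_bounded[OF a] by metis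
    have *: "\<bar>poly q z * exp (- a * z\<^sup>2)\<bar> \<le> (\<Sum>i\<le>degree q. \<bar>coeff q i\<bar> * B i)" for z
    proof -
      have "\<bar>poly q z * exp (- a * z\<^sup>2)\<bar> \<le> (\<Sum>i\<le>degree q. \<bar>coeff q i * z ^ i * exp (- a * z\<^sup>2)\<bar>)"
        by (simp add: poly_altdef sum_distrib_right sum_abs)
      also have "\<dots> = (\<Sum>i\<le>degree q. \<bar>coeff q i\<bar> * (\<bar>z\<bar> ^ i * exp (- a * z\<^sup>2)))"
        by (simp add: abs_mult power_abs mult.assoc)
      also have "\<dots> \<le> (\<Sum>i\<le>degree q. \<bar>coeff q i\<bar> * B i)" by (intro sum_mono mult_left_mono B) auto
      finally show ?thesis .
    qed
    have "x ^ k *\<^sub>R f x = of_real (poly q (x - y) * exp (- a * (x - y)\<^sup>2))" for x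
      by (simp add: f q_def scaleR_conv_of_real poly_power)
    then show "\<exists>B. \<forall>x. norm (x ^ k *\<^sub>R f x) \<le> B" 
      by (intro exI[of _ "\<Sum>i\<le>degree q. \<bar>coeff q i\<bar> * B i"] allI) (simp only: norm_of_real *)
  qed
qed

lemma schwartz_borel: assumes "schwartz \<phi>" shows "\<phi> \<in> borel_measurable borel"
proof -
  have "continuous_on UNIV \<phi>"
    using schwartz_has_deriv[OF assms]
    by (meson continuous_at_imp_continuous_on has_vector_derivative_continuous)
  then show ?thesis by (rule borel_measurable_continuous_onI)
qed

lemma lorentz_integrable: "integrable lborel (\<lambda>x::real. 1 / (1 + x\<^sup>2))"
  and lorentz_integral: "(LBINT x. 1 / (1 + (x::real)\<^sup>2)) = pi"
  using integrable_inverse_1_plus_square LBINT_inverse_1_plus_square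
  by (simp_all add: set_integrable_def interval_lebesgue_integral_def set_lebesgue_integral_def
        einterval_def inverse_eq_divide)

section \<open>The Fourier transform on Schwartz functions\<close>

lemma schwartz_integrable:
  assumes "schwartz \<phi>" shows "integrable lborel \<phi>"
proof -
  obtain B where B: "\<And>x. (1 + \<bar>x\<bar>) ^ 2 * norm (\<phi> x) \<le> B" using schwartz_bound_pow[OF assms] by blast
  have "norm (\<phi> x) \<le> norm (B * (1 / (1 + x\<^sup>2)))" for x
  proof -
    have "(1 + x\<^sup>2) * norm (\<phi> x) \<le> (1 + \<bar>x\<bar>) ^ 2 * norm (\<phi> x)"
      by (rule mult_right_mono) (auto simp: power2_eq_square algebra_simps)
    also note B[of x]
    finally have "norm (\<phi> x) \<le> B / (1 + x\<^sup>2)"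
      by (simp add: pos_le_divide_eq add_pos_nonneg mult.commute)
    also have "\<dots> \<le> \<bar>B\<bar> / (1 + x\<^sup>2)" by (rule divide_right_mono) auto
    finally show ?thesis by simp
  qed
  then show ?thesis
    by (intro Bochner_Integration.integrable_bound[OF integrable_mult_right[OF lorentz_integrable, of B]])
      (use schwartz_borel[OF assms] in auto)
qed

lemma schwartz_bounded: assumes "schwartz \<phi>" shows "\<exists>B. \<forall>x. norm (\<phi> x) \<le> B"
  using schwartz_bound[OF assms, of 0] by simp

lemma norm_iexp [simp]: "norm (exp (\<i> * of_real x)) = 1" "norm (exp (- (\<i> * of_real x))) = 1"
  by (auto simp: norm_exp_eq_Re)

lemma integrable_iexp_mult:
  assumes "integrable lborel f" "g \<in> borel_measurable borel"
  shows "integrable lborel (\<lambda>x. iexp (g x) * f x)" 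
    and "integrable lborel (\<lambda>x. exp (- \<i> * of_real (g x)) * f x)"
proof -
  have [measurable]: "f \<in> borel_measurable borel" "g \<in> borel_measurable borel"
    using assms borel_measurable_integrable by auto
  show "integrable lborel (\<lambda>x. iexp (g x) * f x)" 
    "integrable lborel (\<lambda>x. exp (- \<i> * of_real (g x)) * f x)"
    by (rule Bochner_Integration.integrable_bound[OF assms(1)]; simp add: norm_mult)+
qed

lemma fourier_fun_lborel:
  assumes "schwartz \<phi>"
  shows "fourier_fun \<phi> \<xi> = (LBINT x. exp (- \<i> * of_real (x * \<xi>)) * \<phi> x)"
proof -
  have [measurable]: "\<phi> \<in> borel_measurable borel" by (rule schwartz_borel[OF assms])
  show ?thesis unfolding fourier_fun_def by (rule integral_completion) measurable
qed

lemma fourier_fun_bound: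
  assumes "schwartz \<phi>" shows "norm (fourier_fun \<phi> \<xi>) \<le> (LBINT x. norm (\<phi> x))"
proof -
  have "norm (fourier_fun \<phi> \<xi>) \<le> (LBINT x. norm (exp (- \<i> * of_real (x * \<xi>)) * \<phi> x))"
    unfolding fourier_fun_lborel[OF assms] by (rule integral_norm_bound)
  then show ?thesis by (simp add: norm_mult)
qed

lemma schwartz_tendsto_0:
  assumes "schwartz \<phi>" shows "(\<phi> \<longlongrightarrow> 0) at_infinity"
proof -
  obtain B where B: "\<And>x. (1 + \<bar>x\<bar>) ^ 1 * norm (\<phi> x) \<le> B" using schwartz_bound_pow[OF assms] by blast
  show ?thesis
  proof (rule Lim_null_comparison)
    have "norm (\<phi> x) \<le> B / norm x" if "1 \<le> norm x" for x
    proof -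
      have "norm x * norm (\<phi> x) \<le> (1 + \<bar>x\<bar>) ^ 1 * norm (\<phi> x)" by (simp add: mult_right_mono)
      with B[of x] have "norm x * norm (\<phi> x) \<le> B" by linarith
      then show ?thesis using that by (simp add: pos_le_divide_eq mult.commute)
    qed
    then show "eventually (\<lambda>x. norm (\<phi> x) \<le> B / norm x) at_infinity"
      unfolding eventually_at_infinity by blast
    show "((\<lambda>x::real. B / norm x) \<longlongrightarrow> 0) at_infinity"
      by (rule real_tendsto_divide_at_top[OF tendsto_const filterlim_norm_at_top])
  qed
qed

lemma iexp_deriv:
  "((\<lambda>x. exp (- \<i> * of_real (x * \<xi>))) has_vector_derivative (- \<i> * of_real \<xi> * exp (- \<i> * of_real (x * \<xi>)))) (at x)"
proof -
  have "((\<lambda>z. exp (- \<i> * (z * of_real \<xi>))) has_field_derivative (- \<i> * of_real \<xi> * exp (- \<i> * (of_real x * of_real \<xi>)))) (at (of_real x))"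
    by (auto intro!: derivative_eq_intros)
  from has_vector_derivative_real_field[OF this] show ?thesis by simp
qed

text \<open>
  Integration by parts: the integrand on the left and \<open>- \<i> \<xi>\<close> times that of \<open>fourier_fun \<phi>\<close> add up to the
  derivative of a function that vanishes at infinity.
\<close>

lemma fourier_fun_ddx:
  assumes "schwartz \<phi>"
  shows "fourier_fun (ddx_fun \<phi>) \<xi> = \<i> * of_real \<xi> * fourier_fun \<phi> \<xi>"
proof -
  let ?e = "\<lambda>x. exp (- \<i> * of_real (x * \<xi>))"
  let ?f = "\<lambda>x. ?e x * ddx_fun \<phi> x + (- \<i> * of_real \<xi> * ?e x) * \<phi> x"
  have s': "schwartz (ddx_fun \<phi>)" by (rule schwartz_ddx[OF assms])
  have i1: "integrable lborel (\<lambda>x. ?e x * ddx_fun \<phi> x)"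
    by (rule integrable_iexp_mult(2)[OF schwartz_integrable[OF s']]) simp
  have i0: "integrable lborel (\<lambda>x. ?e x * \<phi> x)"
    by (rule integrable_iexp_mult(2)[OF schwartz_integrable[OF assms]]) simp
  have i2: "integrable lborel (\<lambda>x. (- \<i> * of_real \<xi> * ?e x) * \<phi> x)"
    unfolding mult.assoc by (intro integrable_mult_right) (use i0 in simp)
  have int: "integrable lborel ?f" by (rule Bochner_Integration.integrable_add[OF i1 i2])
  have c: "isCont (\<lambda>x. ?e x) x" "isCont \<phi> x" "isCont (ddx_fun \<phi>) x" for x
    using has_vector_derivative_continuous[OF schwartz_has_deriv[OF assms]]
      has_vector_derivative_continuous[OF schwartz_has_deriv[OF s']] by (auto intro!: continuous_intros)
  have lim: "((\<lambda>x. ?e x * \<phi> x) \<longlongrightarrow> 0) at_infinity"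
    by (rule Lim_null_comparison[OF _ tendsto_norm_zero[OF schwartz_tendsto_0[OF assms]]]) (simp add: norm_mult)
  have "interval_lebesgue_integral lborel (-\<infinity>) \<infinity> ?f = 0 - 0"
  proof (rule interval_integral_FTC_integrable)
    show "((\<lambda>x. ?e x * \<phi> x) has_vector_derivative ?f x) (at x)" for x
      by (rule has_vector_derivative_mult[OF iexp_deriv schwartz_has_deriv[OF assms]])
    show "isCont ?f x" for x by (intro continuous_intros c)
    show "set_integrable lborel (einterval (-\<infinity>) \<infinity>) ?f" using int by (simp add: set_integrable_def einterval_def)
    show "(((\<lambda>x. ?e x * \<phi> x) \<circ> real_of_ereal) \<longlongrightarrow> 0) (at_right (-\<infinity>))"
      unfolding ereal_tendsto_simps using lim at_bot_le_at_infinity tendsto_mono by blast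
    show "(((\<lambda>x. ?e x * \<phi> x) \<circ> real_of_ereal) \<longlongrightarrow> 0) (at_left \<infinity>)"
      unfolding ereal_tendsto_simps using lim at_top_le_at_infinity tendsto_mono by blast
  qed simp
  then have "(LBINT x. ?f x) = 0"
    by (simp add: interval_lebesgue_integral_def set_lebesgue_integral_def einterval_def)
  then have "(LBINT x. ?e x * ddx_fun \<phi> x) = - (LBINT x. (- \<i> * of_real \<xi> * ?e x) * \<phi> x)"
    by (subst (asm) Bochner_Integration.integral_add[OF i1 i2]) (simp add: eq_neg_iff_add_eq_0)
  also have "(LBINT x. (- \<i> * of_real \<xi> * ?e x) * \<phi> x) = - \<i> * of_real \<xi> * (LBINT x. ?e x * \<phi> x)"
  proof -
    have "(\<lambda>x. (- \<i> * of_real \<xi> * ?e x) * \<phi> x) = (\<lambda>x. (- \<i> * of_real \<xi>) * (?e x * \<phi> x))" by (simp add: mult.assoc)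
    then show ?thesis by (simp only: integral_mult_right_zero)
  qed
  finally show ?thesis
    unfolding fourier_fun_lborel[OF assms] fourier_fun_lborel[OF s'] by simp
qed

text \<open>
  A second-order Taylor bound with a uniform constant replaces the interchange of limit and
  integral when the Fourier integral is differentiated.
\<close>

lemma has_vector_derivative_quadratic:
  fixes f :: "real \<Rightarrow> 'a::real_normed_vector"
  assumes "\<And>h. norm (f (x + h) - f x - h *\<^sub>R D) \<le> C * h\<^sup>2"
  shows "(f has_vector_derivative D) (at x)"
  unfolding has_vector_derivative_def has_derivative_at
proof (intro conjI)
  show "bounded_linear (\<lambda>h. h *\<^sub>R D)" by (rule bounded_linear_scaleR_left)
  show "(\<lambda>h. norm (f (x + h) - f x - h *\<^sub>R D) / norm h) \<midarrow>0\<rightarrow> 0"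
  proof (rule Lim_null_comparison)
    have "norm (norm (f (x + h) - f x - h *\<^sub>R D) / norm h) \<le> C * \<bar>h\<bar>" for h
    proof (cases "h = 0")
      case False
      have "norm (f (x + h) - f x - h *\<^sub>R D) / \<bar>h\<bar> \<le> (C * h\<^sup>2) / \<bar>h\<bar>"
        using assms by (rule divide_right_mono) simp
      also have "\<dots> = C * \<bar>h\<bar>" using False by (simp add: power2_eq_square divide_simps)
      finally show ?thesis by simp
    qed simp
    then show "eventually (\<lambda>h. norm (norm (f (x + h) - f x - h *\<^sub>R D) / norm h) \<le> C * \<bar>h\<bar>) (at 0)"
      by simp
    show "((\<lambda>h. C * \<bar>h\<bar>) \<longlongrightarrow> 0) (at 0)" by (auto intro!: tendsto_eq_intros)
  qed
qed

lemma fourier_fun_deriv: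
  assumes "schwartz \<phi>"
  shows "(fourier_fun \<phi> has_vector_derivative fourier_fun (\<lambda>x. - \<i> * (of_real x * \<phi> x)) \<xi>) (at \<xi>)"
proof (rule has_vector_derivative_quadratic)
  fix h
  let ?e = "\<lambda>\<xi> x. exp (- \<i> * of_real (x * \<xi>))"
  have s1: "schwartz (\<lambda>x. of_real x * \<phi> x)" by (rule schwartz_times_x[OF assms])
  have s1': "schwartz (\<lambda>x. - \<i> * (of_real x * \<phi> x))" by (rule schwartz_cmult[OF s1])
  have s2: "schwartz (\<lambda>x. of_real x * (of_real x * \<phi> x))" by (rule schwartz_times_x[OF s1])
  have i0: "integrable lborel (\<lambda>x. ?e \<xi> x * \<phi> x)" for \<xi>
    by (rule integrable_iexp_mult(2)[OF schwartz_integrable[OF assms]]) simp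
  have i1: "integrable lborel (\<lambda>x. ?e \<xi> x * (- \<i> * (of_real x * \<phi> x)))"
    by (rule integrable_iexp_mult(2)[OF schwartz_integrable[OF s1']]) simp
  have i2: "integrable lborel (\<lambda>x. norm (of_real x * (of_real x * \<phi> x)))"
    by (rule integrable_norm[OF schwartz_integrable[OF s2]])
  have eq: "fourier_fun \<phi> (\<xi> + h) - fourier_fun \<phi> \<xi> - h *\<^sub>R fourier_fun (\<lambda>x. - \<i> * (of_real x * \<phi> x)) \<xi>
     = (LBINT x. ?e (\<xi> + h) x * \<phi> x - ?e \<xi> x * \<phi> x - h *\<^sub>R (?e \<xi> x * (- \<i> * (of_real x * \<phi> x))))"
    unfolding fourier_fun_lborel[OF assms] fourier_fun_lborel[OF s1']
    by (simp only: Bochner_Integration.integral_diff i0 i1 integral_scaleR_right integrable_scaleR_right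
        Bochner_Integration.integrable_diff)
  have b: "norm (?e (\<xi> + h) x * \<phi> x - ?e \<xi> x * \<phi> x - h *\<^sub>R (?e \<xi> x * (- \<i> * (of_real x * \<phi> x))))
     \<le> (h\<^sup>2 / 2) * norm (of_real x * (of_real x * \<phi> x))" for x
  proof -
    have "?e (\<xi> + h) x = ?e \<xi> x * iexp (- (x * h))" by (simp add: exp_add[symmetric] algebra_simps)
    then have "?e (\<xi> + h) x * \<phi> x - ?e \<xi> x * \<phi> x - h *\<^sub>R (?e \<xi> x * (- \<i> * (of_real x * \<phi> x)))
        = ?e \<xi> x * \<phi> x * (iexp (- (x * h)) - (\<Sum>k\<le>1. (\<i> * complex_of_real (- (x * h))) ^ k / fact k))"
      by (simp add: scaleR_conv_of_real algebra_simps)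
    also have "norm \<dots> = norm (\<phi> x) * norm (iexp (- (x * h)) - (\<Sum>k\<le>1. (\<i> * complex_of_real (- (x * h))) ^ k / fact k))"
      by (simp only: norm_mult) simp
    also have "\<dots> \<le> norm (\<phi> x) * (\<bar>- (x * h)\<bar> ^ Suc 1 / fact (Suc 1))"
      by (intro mult_left_mono iexp_approx1) simp
    also have "\<dots> = (h\<^sup>2 / 2) * norm (of_real x * (of_real x * \<phi> x))"
    proof -
      have "\<bar>- (x * h)\<bar> ^ Suc 1 = h\<^sup>2 * x\<^sup>2"
        by (simp add: numeral_2_eq_2[symmetric] power_mult_distrib mult.commute del: power_Suc)
      moreover have "norm (of_real x * (of_real x * \<phi> x)) = x\<^sup>2 * norm (\<phi> x)"
        by (simp add: norm_mult power2_eq_square)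
      ultimately show ?thesis by simp
    qed
    finally show ?thesis .
  qed
  show "norm (fourier_fun \<phi> (\<xi> + h) - fourier_fun \<phi> \<xi> - h *\<^sub>R fourier_fun (\<lambda>x. - \<i> * (of_real x * \<phi> x)) \<xi>)
      \<le> (LBINT x. norm (of_real x * (of_real x * \<phi> x))) / 2 * h\<^sup>2"
  proof -
    have "norm (LBINT x. ?e (\<xi> + h) x * \<phi> x - ?e \<xi> x * \<phi> x - h *\<^sub>R (?e \<xi> x * (- \<i> * (of_real x * \<phi> x))))
       \<le> (LBINT x. (h\<^sup>2 / 2) * norm (of_real x * (of_real x * \<phi> x)))"
    proof (rule order_trans[OF integral_norm_bound integral_mono])
      show "integrable lborel (\<lambda>x. norm (?e (\<xi> + h) x * \<phi> x - ?e \<xi> x * \<phi> x - h *\<^sub>R (?e \<xi> x * (- \<i> * (of_real x * \<phi> x)))))"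
        by (intro integrable_norm Bochner_Integration.integrable_diff integrable_scaleR_right i0 i1)
      show "integrable lborel (\<lambda>x. (h\<^sup>2 / 2) * norm (of_real x * (of_real x * \<phi> x)))"
        by (intro integrable_mult_right i2)
    qed (rule b)
    then show ?thesis unfolding eq by (simp add: mult.commute)
  qed
qed

text \<open>
  The Fourier transform exchanges multiplication by the variable and differentiation. Hence the Fourier
  transforms of Schwartz functions form a class as in \<open>schwartz_coinduct\<close>: multiplied by \<open>x\<^sup>k\<close>, such a function
  is up to a factor of modulus 1 the Fourier transform of a \<open>k\<close>-th derivative, which is bounded.
\<close>

lemma schwartz_fourier:
  assumes "schwartz \<phi>" shows "schwartz (fourier_fun \<phi>)"
proof -
  define P where "P f \<longleftrightarrow> (\<exists>\<phi>. schwartz \<phi> \<and> f = fourier_fun \<phi>)" for f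
  show ?thesis
  proof (rule schwartz_coinduct[of P])
    show "P (fourier_fun \<phi>)" using assms unfolding P_def by blast
    fix f assume "P f"
    then obtain \<phi> where s: "schwartz \<phi>" and f: "f = fourier_fun \<phi>" unfolding P_def by blast
    have "schwartz (\<lambda>x. - \<i> * (of_real x * \<phi> x))" by (intro schwartz_cmult schwartz_times_x s)
    then show "\<exists>g. P g \<and> (\<forall>x. (f has_vector_derivative g x) (at x))"
      unfolding P_def f using fourier_fun_deriv[OF s] by blast
    fix k
    have "norm (x ^ k *\<^sub>R fourier_fun \<phi> x) = norm (fourier_fun ((ddx_fun ^^ k) \<phi>) x)" for x
      by (induction k) (simp_all add: fourier_fun_ddx schwartz_ddx_iter s norm_mult abs_mult mult.assoc)
    then show "\<exists>B. \<forall>x. norm (x ^ k *\<^sub>R f x) \<le> B"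
      unfolding f using fourier_fun_bound[OF schwartz_ddx_iter[OF s]] by metis
  qed
qed

section \<open>Fourier inversion\<close>

lemma integrable_pair_kernel:
  fixes f g :: "real \<Rightarrow> complex"
  assumes f: "integrable lborel f" and g: "integrable lborel g"
    and K[measurable]: "(\<lambda>(x, y). K x y) \<in> borel_measurable (borel \<Otimes>\<^sub>M borel)" and B: "\<And>x y. norm (K x y) \<le> B"
  shows "integrable (lborel \<Otimes>\<^sub>M lborel) (\<lambda>(x, y). f x * K x y * g y)"
proof -
  have [measurable]: "f \<in> borel_measurable borel" "g \<in> borel_measurable borel"
    using f g borel_measurable_integrable by auto
  have B0: "0 \<le> B" using B[of 0 0] norm_ge_zero order_trans by blast
  have i1: "integrable (lborel \<Otimes>\<^sub>M lborel) (\<lambda>(x, y). f x * g y)"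
  proof (rule lborel_pair.Fubini_integrable)
    show "(\<lambda>(x, y). f x * g y) \<in> borel_measurable (lborel \<Otimes>\<^sub>M lborel)" by measurable
    show "integrable lborel (\<lambda>x. LBINT y. norm (case (x, y) of (x, y) \<Rightarrow> f x * g y))"
      using f by (simp add: norm_mult)
    show "AE x in lborel. integrable lborel (\<lambda>y. case (x, y) of (x, y) \<Rightarrow> f x * g y)"
      using g by simp
  qed
  show ?thesis
  proof (rule Bochner_Integration.integrable_bound[OF integrable_mult_right[OF i1, of "of_real B"]])
    show "(\<lambda>(x, y). f x * K x y * g y) \<in> borel_measurable (lborel \<Otimes>\<^sub>M lborel)" 
      by measurable
    show "AE p in lborel \<Otimes>\<^sub>M lborel. norm (case p of (x, y) \<Rightarrow> f x * K x y * g y)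
         \<le> norm (of_real B * (case p of (x, y) \<Rightarrow> f x * g y))"
    proof (intro AE_I2)
      fix p
      have "norm (f x * K x y * g y) \<le> norm (of_real B * (f x * g y))" for x y
      proof -
        have "norm (f x * K x y * g y) = norm (K x y) * norm (f x * g y)" by (simp add: norm_mult)
        also have "\<dots> \<le> B * norm (f x * g y)" by (rule mult_right_mono[OF B]) simp
        finally show ?thesis using B0 by (simp add: norm_mult)
      qed
      then show "norm (case p of (x, y) \<Rightarrow> f x * K x y * g y) \<le> norm (of_real B * (case p of (x, y) \<Rightarrow> f x * g y))"
        by (cases p) simp
    qed
  qed
qed

text \<open>
  The form in which Fubini's theorem is used for Fourier integrals, the kernel being an
  exponential or a Gaussian.
\<close>

lemma fubini_kernel:
  fixes f g :: "real \<Rightarrow> complex"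
  assumes f: "integrable lborel f" and g: "integrable lborel g"
    and K: "(\<lambda>(x, y). K x y) \<in> borel_measurable (borel \<Otimes>\<^sub>M borel)" and B: "\<And>x y. norm (K x y) \<le> B"
  shows "(LBINT x. f x * (LBINT y. K x y * g y)) = (LBINT y. (LBINT x. f x * K x y) * g y)"
proof -
  have "(LBINT y. LBINT x. f x * K x y * g y) = (LBINT x. LBINT y. f x * K x y * g y)"
    by (rule lborel_pair.Fubini_integral[OF integrable_pair_kernel[OF assms]])
  moreover have "(LBINT x. f x * K x y * g y) = (LBINT x. f x * K x y) * g y" for y by simp
  moreover have "(LBINT y. f x * K x y * g y) = f x * (LBINT y. K x y * g y)" for x
    by (simp add: mult.assoc)
  ultimately show ?thesis by simp
qed

lemma gaussian_fourier:
  assumes "n > 0"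
  shows "(LBINT x. iexp (u * x) * of_real (exp (- x\<^sup>2 / (2 * n\<^sup>2))))
     = of_real (n * sqrt (2 * pi) * exp (- (u * n)\<^sup>2 / 2))"
proof -
  have "(LBINT x. std_normal_density x *\<^sub>R iexp (u * n * x)) = char std_normal_distribution (u * n)"
    unfolding char_def by (subst integral_density) (auto simp: normal_density_nonneg)
  also have "\<dots> = of_real (exp (- (u * n)\<^sup>2 / 2))" by (simp add: char_std_normal_distribution)
  finally have 1: "(LBINT x. std_normal_density x *\<^sub>R iexp (u * n * x)) = of_real (exp (- (u * n)\<^sup>2 / 2))" .
  have "(LBINT x. iexp (u * x) * of_real (exp (- x\<^sup>2 / (2 * n\<^sup>2)))) =
     \<bar>n\<bar> *\<^sub>R (LBINT x. iexp (u * (0 + n * x)) * of_real (exp (- (0 + n * x)\<^sup>2 / (2 * n\<^sup>2))))"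
    by (rule lborel_integral_real_affine) (use assms in simp)
  also have "\<dots> = n *\<^sub>R (LBINT x. of_real (sqrt (2 * pi)) * (std_normal_density x *\<^sub>R iexp (u * n * x)))"
    using assms by (simp add: std_normal_density_def scaleR_conv_of_real power_mult_distrib mult_ac)
  also have "\<dots> = of_real (n * sqrt (2 * pi) * exp (- (u * n)\<^sup>2 / 2))"
    unfolding integral_mult_right_zero 1 by (simp add: scaleR_conv_of_real)
  finally show ?thesis .
qed

lemma gaussian_integrable:
  assumes "n > 0" shows "integrable lborel (\<lambda>x. of_real (exp (- x\<^sup>2 / (2 * n\<^sup>2))) :: complex)"
  using schwartz_integrable[OF schwartz_gaussian[of "1 / (2 * n\<^sup>2)" 0]] assms by (simp add: field_simps)

text \<open>
  The Gaussian of total mass \<open>2 \<pi>\<close> that concentrates at \<open>x\<close> as \<open>k\<close> grows; up to scaling it is the Fourier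
  transform of a wide Gaussian. The index is shifted so that the width \<open>1 / Suc k\<close> is finite.
\<close>

abbreviation gker :: "nat \<Rightarrow> real \<Rightarrow> real \<Rightarrow> complex" where
  "gker k x y \<equiv> of_real (real (Suc k) * sqrt (2 * pi) * exp (- ((x - y) * real (Suc k))\<^sup>2 / 2))"

text \<open>
  After the substitution \<open>y = x + z / Suc k\<close> the density no longer depends on \<open>k\<close>, so that the limit
  is a matter of dominated convergence.
\<close>

lemma gaussian_mollify_rescale:
  fixes f :: "real \<Rightarrow> complex" and x :: real
  shows "(LBINT y. f y * gker k x y)
     = (LBINT z. f (x + z / Suc k) * of_real (2 * pi * std_normal_density z))"
proof -
  have "(LBINT y. f y * gker k x y)
    = \<bar>1 / Suc k\<bar> *\<^sub>R (LBINT z. f (x + 1 / Suc k * z) * of_real (Suc k * sqrt (2 * pi) * exp (- ((x - (x + 1 / Suc k * z)) * Suc k)\<^sup>2 / 2)))"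
    by (rule lborel_integral_real_affine) simp
  also have "\<dots> = (LBINT z. \<bar>1 / real (Suc k)\<bar> *\<^sub>R (f (x + 1 / Suc k * z) * of_real (Suc k * sqrt (2 * pi) * exp (- ((x - (x + 1 / Suc k * z)) * Suc k)\<^sup>2 / 2))))"
    by (rule integral_scaleR_right[symmetric])
  also have "\<dots> = (LBINT z. f (x + z / Suc k) * of_real (2 * pi * std_normal_density z))"
  proof (rule Bochner_Integration.integral_cong)
    fix z
    have 1: "(x - (x + 1 / Suc k * z)) * Suc k = - z" by (simp add: field_simps del: of_nat_Suc)
    have 2: "\<bar>1 / real (Suc k)\<bar> * (Suc k * sqrt (2 * pi) * w) = sqrt (2 * pi) * w" for w
      by (simp add: field_simps del: of_nat_Suc)
    have 3: "2 * pi * std_normal_density z = sqrt (2 * pi) * exp (- z\<^sup>2 / 2)"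
      unfolding std_normal_density_def using pi_gt_zero by (simp add: field_simps real_sqrt_mult_self)
    show "\<bar>1 / Suc k\<bar> *\<^sub>R (f (x + 1 / Suc k * z) * of_real (Suc k * sqrt (2 * pi) * exp (- ((x - (x + 1 / Suc k * z)) * Suc k)\<^sup>2 / 2)))
      = f (x + z / Suc k) * of_real (2 * pi * std_normal_density z)"
    proof -
      have "a *\<^sub>R (w * complex_of_real b) = w * complex_of_real (a * b)" for a b w
        by (simp add: scaleR_conv_of_real)
      then show ?thesis unfolding 1 3 by (simp only: 2) simp
    qed
  qed simp
  finally show ?thesis .
qed

lemma gaussian_mollify_bound:
  fixes f :: "real \<Rightarrow> complex"
  assumes [measurable]: "f \<in> borel_measurable borel" and bd: "\<And>x. norm (f x) \<le> B"
  shows "norm (LBINT y. f y * gker k x y) \<le> 2 * pi * B"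
proof -
  have le: "norm (f (x + z / Suc k) * of_real (2 * pi * std_normal_density z)) \<le> B * (2 * pi * std_normal_density z)" for z
    by (auto simp: norm_mult abs_mult normal_density_nonneg intro!: mult_right_mono bd)
  have i: "integrable lborel (\<lambda>z. B * (2 * pi * std_normal_density z))"
    by (intro integrable_mult_right integrable_normal_density) simp_all
  have "norm (LBINT z. f (x + z / Suc k) * of_real (2 * pi * std_normal_density z)) \<le> (LBINT z. B * (2 * pi * std_normal_density z))"
  proof (rule order_trans[OF integral_norm_bound integral_mono[OF _ i le]])
    show "integrable lborel (\<lambda>z. norm (f (x + z / Suc k) * of_real (2 * pi * std_normal_density z)))"
    proof (rule integrable_norm, rule Bochner_Integration.integrable_bound[OF i])
      show "(\<lambda>z. f (x + z / Suc k) * of_real (2 * pi * std_normal_density z)) \<in> borel_measurable lborel" by measurable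
      show "AE z in lborel. norm (f (x + z / Suc k) * of_real (2 * pi * std_normal_density z)) \<le> norm (B * (2 * pi * std_normal_density z))"
        using order_trans[OF le abs_ge_self] by simp
    qed
  qed
  also have "\<dots> = 2 * pi * B" using integral_normal_density[of 1 0] by simp
  finally show ?thesis unfolding gaussian_mollify_rescale .
qed

lemma gaussian_mollify:
  fixes f :: "real \<Rightarrow> complex" and x :: real
  assumes [measurable]: "f \<in> borel_measurable borel" and bd: "\<And>x. norm (f x) \<le> B"
    and c: "isCont f x"
  shows "(\<lambda>k. LBINT y. f y * gker k x y) \<longlonglongrightarrow> complex_of_real (2 * pi) * f x"
proof -
  have "(\<lambda>k. LBINT z. f (x + z / Suc k) * of_real (2 * pi * std_normal_density z)) \<longlonglongrightarrow> (LBINT z. f x * of_real (2 * pi * std_normal_density z))"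
  proof (rule integral_dominated_convergence[where w="\<lambda>z. B * (2 * pi * std_normal_density z)"])
    show "integrable lborel (\<lambda>z. B * (2 * pi * std_normal_density z))"
      by (intro integrable_mult_right integrable_normal_density) simp_all
    show "AE z in lborel. (\<lambda>k. f (x + z / Suc k) * of_real (2 * pi * std_normal_density z)) \<longlonglongrightarrow> f x * of_real (2 * pi * std_normal_density z)"
    proof (intro AE_I2 tendsto_mult tendsto_const)
      fix z
      have "(\<lambda>k. z / real (Suc k)) \<longlonglongrightarrow> 0" by (rule LIMSEQ_Suc[OF lim_const_over_n])
      then have "(\<lambda>k. x + z / real (Suc k)) \<longlonglongrightarrow> x" using tendsto_add[OF tendsto_const] by fastforce
      then show "(\<lambda>k. f (x + z / real (Suc k))) \<longlonglongrightarrow> f x" by (rule isCont_tendsto_compose[OF c])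
    qed
    show "AE z in lborel. norm (f (x + z / Suc k) * of_real (2 * pi * std_normal_density z)) \<le> B * (2 * pi * std_normal_density z)" for k
      by (intro AE_I2) (auto simp: norm_mult abs_mult normal_density_nonneg intro!: mult_right_mono bd)
  qed (auto intro!: borel_measurable_times)
  also have "(LBINT z. f x * of_real (2 * pi * std_normal_density z)) = complex_of_real (2 * pi) * f x"
    using integral_normal_density[of 1 0] by simp
  finally show ?thesis unfolding gaussian_mollify_rescale .
qed

text \<open>
  A Gaussian factor makes the double integral absolutely convergent. Exchanging the integrals then shows
  \<open>\<phi>\<close> mollified by a Gaussian, and both sides converge as the factor tends to 1.
\<close>

theorem fourier_inversion:
  assumes "schwartz \<phi>"
  shows "(LBINT \<xi>. iexp (x * \<xi>) * fourier_fun \<phi> \<xi>) = complex_of_real (2 * pi) * \<phi> x"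
proof -
  have i: "integrable lborel \<phi>" "integrable lborel (fourier_fun \<phi>)"
    using assms schwartz_fourier schwartz_integrable by auto
  have [measurable]: "\<phi> \<in> borel_measurable borel" "fourier_fun \<phi> \<in> borel_measurable borel"
    using assms schwartz_fourier schwartz_borel by auto
  obtain B where B: "\<And>x. norm (\<phi> x) \<le> B" using schwartz_bounded[OF assms] by blast
  let ?g = "\<lambda>k \<xi>. of_real (exp (- \<xi>\<^sup>2 / (2 * (real (Suc k))\<^sup>2))) :: complex"
  have "(LBINT \<xi>. (iexp (x * \<xi>) * ?g k \<xi>) * fourier_fun \<phi> \<xi>) =
      (LBINT y. \<phi> y * gker k x y)" for k
  proof -
    have "(LBINT \<xi>. (iexp (x * \<xi>) * ?g k \<xi>) * (LBINT y. exp (- \<i> * of_real (y * \<xi>)) * \<phi> y))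
      = (LBINT y. (LBINT \<xi>. (iexp (x * \<xi>) * ?g k \<xi>) * exp (- \<i> * of_real (y * \<xi>))) * \<phi> y)"
    proof (rule fubini_kernel[where B=1])
      show "integrable lborel (\<lambda>\<xi>. iexp (x * \<xi>) * ?g k \<xi>)"
        by (rule integrable_iexp_mult(1)[OF gaussian_integrable]) auto
    qed (use i in simp_all)
    also have "(\<lambda>y. (LBINT \<xi>. (iexp (x * \<xi>) * ?g k \<xi>) * exp (- \<i> * of_real (y * \<xi>))) * \<phi> y)
       = (\<lambda>y. \<phi> y * gker k x y)"
    proof
      fix y
      have "(LBINT \<xi>. (iexp (x * \<xi>) * ?g k \<xi>) * exp (- \<i> * of_real (y * \<xi>)))
         = (LBINT \<xi>. iexp ((x - y) * \<xi>) * ?g k \<xi>)"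
      proof -
        have "(iexp (x * \<xi>) * ?g k \<xi>) * exp (- \<i> * of_real (y * \<xi>)) = iexp ((x - y) * \<xi>) * ?g k \<xi>" for \<xi>
        proof -
          have "iexp ((x - y) * \<xi>) = iexp (x * \<xi>) * exp (- \<i> * of_real (y * \<xi>))"
            by (simp add: exp_add[symmetric] algebra_simps)
          then show ?thesis by simp
        qed
        then show ?thesis by (rule Bochner_Integration.integral_cong[OF refl])
      qed
      also have "\<dots> = gker k x y"
        by (rule gaussian_fourier) simp
      finally show "(LBINT \<xi>. (iexp (x * \<xi>) * ?g k \<xi>) * exp (- \<i> * of_real (y * \<xi>))) * \<phi> y
         = \<phi> y * gker k x y" by simp
    qed
    finally show ?thesis unfolding fourier_fun_lborel[OF assms] .
  qed
  moreover have "(\<lambda>k. LBINT y. \<phi> y * gker k x y) \<longlonglongrightarrow> complex_of_real (2 * pi) * \<phi> x"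
    by (rule gaussian_mollify[OF schwartz_borel[OF assms] B
          has_vector_derivative_continuous[OF schwartz_has_deriv[OF assms]]])
  ultimately have l1: "(\<lambda>k. LBINT \<xi>. (iexp (x * \<xi>) * ?g k \<xi>) * fourier_fun \<phi> \<xi>) \<longlonglongrightarrow> complex_of_real (2 * pi) * \<phi> x"
    by simp
  have l2: "(\<lambda>k. LBINT \<xi>. (iexp (x * \<xi>) * ?g k \<xi>) * fourier_fun \<phi> \<xi>) \<longlonglongrightarrow> (LBINT \<xi>. iexp (x * \<xi>) * fourier_fun \<phi> \<xi>)"
  proof (rule integral_dominated_convergence[where w="\<lambda>\<xi>. norm (fourier_fun \<phi> \<xi>)"])
    show "integrable lborel (\<lambda>\<xi>. norm (fourier_fun \<phi> \<xi>))" using i by simp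
    show "AE \<xi> in lborel. (\<lambda>k. (iexp (x * \<xi>) * ?g k \<xi>) * fourier_fun \<phi> \<xi>) \<longlonglongrightarrow> iexp (x * \<xi>) * fourier_fun \<phi> \<xi>"
    proof (intro AE_I2)
      fix \<xi>
      have "(\<lambda>k. \<xi> / real (Suc k)) \<longlonglongrightarrow> 0" by (rule LIMSEQ_Suc[OF lim_const_over_n])
      then have "(\<lambda>k. exp (- (\<xi> / real (Suc k))\<^sup>2 / 2)) \<longlonglongrightarrow> exp (- 0\<^sup>2 / 2)" by (intro tendsto_intros) auto
      then have "(\<lambda>k. exp (- \<xi>\<^sup>2 / (2 * (real (Suc k))\<^sup>2))) \<longlonglongrightarrow> 1" by (simp add: power_divide mult.commute)
      then have "(\<lambda>k. ?g k \<xi>) \<longlonglongrightarrow> of_real 1" by (rule tendsto_of_real)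
      then have "(\<lambda>k. (iexp (x * \<xi>) * ?g k \<xi>) * fourier_fun \<phi> \<xi>) \<longlonglongrightarrow> (iexp (x * \<xi>) * of_real 1) * fourier_fun \<phi> \<xi>"
        by (intro tendsto_mult[OF tendsto_mult[OF tendsto_const] tendsto_const])
      then show "(\<lambda>k. (iexp (x * \<xi>) * ?g k \<xi>) * fourier_fun \<phi> \<xi>) \<longlonglongrightarrow> iexp (x * \<xi>) * fourier_fun \<phi> \<xi>"
        by simp
    qed
    show "AE \<xi> in lborel. norm ((iexp (x * \<xi>) * ?g k \<xi>) * fourier_fun \<phi> \<xi>) \<le> norm (fourier_fun \<phi> \<xi>)" for k
      by (intro AE_I2) (auto simp: norm_mult intro!: mult_left_le_one_le)
  qed measurable
  show ?thesis using LIMSEQ_unique[OF l2 l1] .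
qed

text \<open>
  By inversion, \<open>\<psi>\<close> is the Fourier transform of its own reflected Fourier transform divided by \<open>2 \<pi>\<close>.
\<close>

lemma schwartz_fourier_surj:
  assumes "schwartz \<psi>" shows "\<exists>\<phi>. schwartz \<phi> \<and> fourier_fun \<phi> = \<psi>"
proof -
  define \<phi> where "\<phi> = (\<lambda>x. complex_of_real (1 / (2 * pi)) * fourier_fun \<psi> (- x))"
  have s: "schwartz \<phi>" unfolding \<phi>_def by (intro schwartz_cmult schwartz_reflect schwartz_fourier assms)
  have "fourier_fun \<phi> \<xi> = \<psi> \<xi>" for \<xi>
  proof -
    have "fourier_fun \<phi> \<xi> = (LBINT x. exp (- \<i> * of_real (x * \<xi>)) * (complex_of_real (1 / (2 * pi)) * fourier_fun \<psi> (- x)))"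
      unfolding fourier_fun_lborel[OF s] by (simp add: \<phi>_def)
    also have "\<dots> = \<bar>-1\<bar> *\<^sub>R (LBINT x. exp (- \<i> * of_real ((0 + (-1) * x) * \<xi>)) * (complex_of_real (1 / (2 * pi)) * fourier_fun \<psi> (- (0 + (-1) * x))))"
      by (rule lborel_integral_real_affine) simp
    also have "\<dots> = (LBINT x. complex_of_real (1 / (2 * pi)) * (iexp (\<xi> * x) * fourier_fun \<psi> x))"
      by (simp add: mult_ac)
    also have "\<dots> = \<psi> \<xi>"
      unfolding integral_mult_right_zero fourier_inversion[OF assms] by simp
    finally show ?thesis .
  qed
  with s show ?thesis by blast
qed

section \<open>Functions as tempered distributions\<close>

lemma lebesgue_borel_rep:
  fixes g :: "real \<Rightarrow> complex"
  assumes "g \<in> borel_measurable lebesgue"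
  shows "\<exists>g'\<in>borel_measurable borel. AE x in lebesgue. g x = g' x"
proof -
  have "(\<lambda>x. Re (g x)) \<in> borel_measurable lebesgue" "(\<lambda>x. Im (g x)) \<in> borel_measurable lebesgue"
    using assms by measurable
  from this(1)[THEN completion_ex_borel_measurable_real] this(2)[THEN completion_ex_borel_measurable_real]
  obtain a b where [measurable]: "a \<in> borel_measurable borel" "b \<in> borel_measurable borel"
    and "AE x in lborel. Re (g x) = a x" "AE x in lborel. Im (g x) = b x"
    by auto
  then have "AE x in lebesgue. Re (g x) = a x" "AE x in lebesgue. Im (g x) = b x"
    by (auto intro: AE_completion)
  then have "AE x in lebesgue. g x = Complex (a x) (b x)"
    by eventually_elim (simp add: complex_eq_iff)
  moreover have "(\<lambda>x. Complex (a x) (b x)) \<in> borel_measurable borel"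
    unfolding Complex_eq by measurable
  ultimately show ?thesis by (intro bexI[of _ "\<lambda>x. Complex (a x) (b x)"])
qed

lemma tempered_fun_measurable:
  assumes "tempered_fun g" shows "g \<in> borel_measurable lebesgue"
proof -
  obtain k where "integrable lebesgue (\<lambda>x. g x /\<^sub>R (1 + \<bar>x\<bar>) ^ k)" using assms unfolding tempered_fun_def by blast
  then have [measurable]: "(\<lambda>x. g x /\<^sub>R (1 + \<bar>x\<bar>) ^ k) \<in> borel_measurable lebesgue" by (rule borel_measurable_integrable)
  have [measurable]: "(\<lambda>x::real. (1 + \<bar>x\<bar>) ^ k) \<in> borel_measurable lebesgue" 
    by (rule measurable_completion) measurable
  have "(\<lambda>x. (1 + \<bar>x\<bar>) ^ k *\<^sub>R (g x /\<^sub>R (1 + \<bar>x\<bar>) ^ k)) \<in> borel_measurable lebesgue" by measurable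
  moreover have "(1 + \<bar>x\<bar>) ^ k \<noteq> 0" for x :: real by (simp add: add_nonneg_eq_0_iff)
  ultimately show ?thesis by simp
qed

lemma tempered_fun_bound_integrable:
  fixes w :: "real \<Rightarrow> complex"
  assumes g: "tempered_fun g" and [measurable]: "w \<in> borel_measurable lebesgue"
    and B: "\<And>k. \<exists>B. \<forall>x. (1 + \<bar>x\<bar>) ^ k * norm (w x) \<le> B"
  shows "integrable lebesgue (\<lambda>x. g x * w x)"
proof -
  have [measurable]: "g \<in> borel_measurable lebesgue" by (rule tempered_fun_measurable[OF g])
  obtain k where k: "integrable lebesgue (\<lambda>x. g x /\<^sub>R (1 + \<bar>x\<bar>) ^ k)" using g unfolding tempered_fun_def by blast
  obtain B where B: "\<And>x. (1 + \<bar>x\<bar>) ^ k * norm (w x) \<le> B" using B by blast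
  have le: "norm (g x * w x) \<le> norm (B *\<^sub>R (g x /\<^sub>R (1 + \<bar>x\<bar>) ^ k))" for x
  proof -
    have p: "0 < (1 + \<bar>x\<bar>) ^ k" by (rule zero_less_power) simp
    then have "norm (w x) \<le> B / (1 + \<bar>x\<bar>) ^ k" using B[of x] by (simp add: pos_le_divide_eq mult.commute)
    also have "\<dots> \<le> \<bar>B\<bar> / (1 + \<bar>x\<bar>) ^ k" using p by (intro divide_right_mono) auto
    finally have "norm (g x) * norm (w x) \<le> norm (g x) * (\<bar>B\<bar> / (1 + \<bar>x\<bar>) ^ k)" by (rule mult_left_mono) simp
    then show ?thesis using p by (simp add: norm_mult field_simps)
  qed
  show ?thesis
    by (rule Bochner_Integration.integrable_bound[OF integrable_scaleR_right[OF k, of B]]) (use le in auto)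
qed

lemma schwartz_lebesgue_measurable: "schwartz \<phi> \<Longrightarrow> \<phi> \<in> borel_measurable lebesgue"
  by (rule measurable_completion) (simp add: schwartz_borel)

lemma tempered_fun_schwartz_integrable:
  assumes "tempered_fun g" "schwartz \<phi>" shows "integrable lebesgue (\<lambda>x. g x * \<phi> x)"
  by (rule tempered_fun_bound_integrable)
    (use assms schwartz_bound_pow schwartz_lebesgue_measurable in auto)

lemma tempered_fun_lincomb:
  assumes "tempered_fun f" "tempered_fun g" shows "tempered_fun (\<lambda>x. a * f x + b * g x)"
proof -
  have [measurable]: "f \<in> borel_measurable lebesgue" "g \<in> borel_measurable lebesgue"
    using assms tempered_fun_measurable by auto
  have up: "\<exists>k. \<forall>n\<ge>k. integrable lebesgue (\<lambda>x. f x /\<^sub>R (1 + \<bar>x\<bar>) ^ n)" if f: "tempered_fun f" for f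
  proof -
    have [measurable]: "f \<in> borel_measurable lebesgue" by (rule tempered_fun_measurable[OF f])
    obtain k where k: "integrable lebesgue (\<lambda>x. f x /\<^sub>R (1 + \<bar>x\<bar>) ^ k)" using f unfolding tempered_fun_def by blast
    have "integrable lebesgue (\<lambda>x. f x /\<^sub>R (1 + \<bar>x\<bar>) ^ n)" if n: "n \<ge> k" for n
    proof (rule Bochner_Integration.integrable_bound[OF k])
      have [measurable]: "(\<lambda>x::real. (1 + \<bar>x\<bar>) ^ n) \<in> borel_measurable lebesgue" 
        by (rule measurable_completion) measurable
      show "(\<lambda>x. f x /\<^sub>R (1 + \<bar>x\<bar>) ^ n) \<in> borel_measurable lebesgue" by measurable
      have "inverse ((1 + \<bar>x\<bar>) ^ n) \<le> inverse ((1 + \<bar>x\<bar>) ^ k)" for x :: real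
        by (intro le_imp_inverse_le power_increasing n) auto
      then show "AE x in lebesgue. norm (f x /\<^sub>R (1 + \<bar>x\<bar>) ^ n) \<le> norm (f x /\<^sub>R (1 + \<bar>x\<bar>) ^ k)"
        by (auto intro!: mult_right_mono AE_I2)
    qed
    then show ?thesis by blast
  qed
  obtain k1 where k1: "\<And>n. n \<ge> k1 \<Longrightarrow> integrable lebesgue (\<lambda>x. f x /\<^sub>R (1 + \<bar>x\<bar>) ^ n)" using up[OF assms(1)] by blast
  obtain k2 where k2: "\<And>n. n \<ge> k2 \<Longrightarrow> integrable lebesgue (\<lambda>x. g x /\<^sub>R (1 + \<bar>x\<bar>) ^ n)" using up[OF assms(2)] by blast
  have "integrable lebesgue (\<lambda>x. a * (f x /\<^sub>R (1 + \<bar>x\<bar>) ^ max k1 k2) + b * (g x /\<^sub>R (1 + \<bar>x\<bar>) ^ max k1 k2))"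
    by (intro Bochner_Integration.integrable_add integrable_mult_right k1 k2) auto
  then have "integrable lebesgue (\<lambda>x. (a * f x + b * g x) /\<^sub>R (1 + \<bar>x\<bar>) ^ max k1 k2)"
    by (simp add: scaleR_add_right)
  then show ?thesis unfolding tempered_fun_def by blast
qed

lemma tempered_fun_cong_AE:
  assumes "tempered_fun g" "h \<in> borel_measurable lebesgue" "AE x in lebesgue. g x = h x"
  shows "tempered_fun h"
proof -
  have [measurable]: "h \<in> borel_measurable lebesgue" "g \<in> borel_measurable lebesgue" 
    using assms tempered_fun_measurable by auto
  obtain k where k: "integrable lebesgue (\<lambda>x. g x /\<^sub>R (1 + \<bar>x\<bar>) ^ k)" using assms unfolding tempered_fun_def by blast
  have [measurable]: "(\<lambda>x::real. (1 + \<bar>x\<bar>) ^ k) \<in> borel_measurable lebesgue" 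
    by (rule measurable_completion) measurable
  have "integrable lebesgue (\<lambda>x. h x /\<^sub>R (1 + \<bar>x\<bar>) ^ k)"
    by (subst integrable_cong_AE[of _ _ "\<lambda>x. g x /\<^sub>R (1 + \<bar>x\<bar>) ^ k"]) (use assms(3) k in auto)
  then show ?thesis unfolding tempered_fun_def by blast
qed

lemma dist_of_cong_AE:
  assumes "g \<in> borel_measurable lebesgue" "h \<in> borel_measurable lebesgue" "AE x in lebesgue. g x = h x"
  shows "dist_of g = dist_of h"
proof
  fix \<phi>
  show "dist_of g \<phi> = dist_of h \<phi>"
  proof (cases "schwartz \<phi>")
    case True
    then have [measurable]: "\<phi> \<in> borel_measurable lebesgue" by (rule schwartz_lebesgue_measurable)
    have "(LINT x|lebesgue. g x * \<phi> x) = (LINT x|lebesgue. h x * \<phi> x)"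
      by (rule integral_cong_AE) (use assms in auto)
    then show ?thesis by (simp add: dist_of_def)
  qed (simp add: dist_of_def)
qed

text \<open>
  The intervals are a generator of the Borel sets that is stable under intersection, so that the
  integral over every Borel set vanishes.
\<close>

lemma integral_Icc_zero_imp_AE_zero:
  fixes f :: "real \<Rightarrow> complex"
  assumes f: "integrable lborel f" and z: "\<And>a b. (LBINT x. f x * indicator {a..b} x) = 0"
  shows "AE x in lborel. f x = 0"
proof (rule sigma_finite_measure.density_zero[OF lborel.sigma_finite_measure_axioms f])
  have [measurable]: "f \<in> borel_measurable borel" using f borel_measurable_integrable by auto
  have z': "set_lebesgue_integral lborel {a..b} f = 0" for a b
    using z[of a b] by (simp add: set_lebesgue_integral_def scaleR_conv_of_real indicator_eq_0_iff mult.commute of_real_indicator)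
  have si: "set_integrable lborel A f" if "A \<in> sets borel" for A
    unfolding set_integrable_def by (rule integrable_mult_indicator) (use that f in auto)
  have UNIV0: "(LBINT x. f x) = 0"
  proof -
    have "(\<lambda>n. LBINT x. indicator {- real n..real n} x *\<^sub>R f x) \<longlonglongrightarrow> (LBINT x. f x)"
    proof (rule integral_dominated_convergence[where w="\<lambda>x. norm (f x)"])
      show "AE x in lborel. (\<lambda>n. indicator {- real n..real n} x *\<^sub>R f x) \<longlonglongrightarrow> f x"
      proof (intro AE_I2 tendsto_eventually)
        fix x
        obtain N where "\<bar>x\<bar> \<le> real N" using real_arch_simple by blast
        then show "eventually (\<lambda>n. indicator {- real n..real n} x *\<^sub>R f x = f x) sequentially"
          by (intro eventually_sequentiallyI[of N]) (auto simp: indicator_def)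
      qed
      show "AE x in lborel. norm (indicator {- real n..real n} x *\<^sub>R f x) \<le> norm (f x)" for n
        by (intro AE_I2) (auto simp: indicator_def)
    qed (use f in auto)
    then have "(\<lambda>n. 0) \<longlonglongrightarrow> (LBINT x. f x)" using z' unfolding set_lebesgue_integral_def by simp
    then show ?thesis by (simp add: LIMSEQ_const_iff)
  qed
  fix A :: "real set" assume "A \<in> sets lborel"
  then have 3: "A \<in> sigma_sets UNIV (range (\<lambda>(l, u). {l..u::real}))"
    by (simp add: borel_eq_atLeastAtMost)
  have 1: "Int_stable (range (\<lambda>(l, u). {l..u::real}))"
    by (auto simp: Int_stable_def)
  have 2: "range (\<lambda>(l, u). {l..u::real}) \<subseteq> Pow UNIV" by simp
  from 1 2 3 show "set_lebesgue_integral lborel A f = 0"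
  proof (induction rule: sigma_sets_induct_disjoint)
    case (basic A) then show ?case using z' by auto
  next
    case empty then show ?case by (simp add: set_lebesgue_integral_def)
  next
    case (compl A)
    then have A: "A \<in> sets borel" by (simp add: borel_eq_atLeastAtMost)
    have "set_lebesgue_integral lborel (UNIV - A) f = (LBINT x. f x) - set_lebesgue_integral lborel A f"
      using set_integral_Un[of A "UNIV - A" lborel f] si A by (simp add: set_lebesgue_integral_def)
    then show ?case using compl UNIV0 by simp
  next
    case (union A)
    then have A: "\<And>i. A i \<in> sets borel" by (auto simp: borel_eq_atLeastAtMost)
    have "set_lebesgue_integral lborel (\<Union>i. A i) f = (\<Sum>i. set_lebesgue_integral lborel (A i) f)"
      by (rule lebesgue_integral_countable_add) (use A union si in \<open>auto simp: disjoint_family_on_def\<close>)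
    then show ?case using union by simp
  qed
qed

text \<open>
  Gaussians suffice as test functions. The product \<open>F\<close> of \<open>f\<close> with a fixed Gaussian is integrable, and
  since a product of two Gaussians is again a Gaussian, \<open>F\<close> integrates to zero against all of them. The
  mollified indicator functions of intervals are superpositions of Gaussians, and they are bounded, so in the
  limit \<open>F\<close> integrates to zero over every interval.
\<close>

lemma tempered_fun_AE_zero:
  assumes f: "tempered_fun f" and z: "\<And>\<phi>. schwartz \<phi> \<Longrightarrow> (LINT x|lebesgue. f x * \<phi> x) = 0"
  shows "AE x in lebesgue. f x = 0"
proof -
  have [measurable]: "f \<in> borel_measurable lebesgue" by (rule tempered_fun_measurable[OF f])
  define g where "g = (\<lambda>x::real. complex_of_real (exp (- 1 * (x - 0)\<^sup>2)))"
  have sg: "schwartz g" unfolding g_def by (rule schwartz_gaussian) simp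
  have i: "integrable lebesgue (\<lambda>x. f x * g x)" by (rule tempered_fun_schwartz_integrable[OF f sg])
  then obtain F where [measurable]: "F \<in> borel_measurable borel" and F: "AE x in lebesgue. f x * g x = F x"
    using lebesgue_borel_rep[OF borel_measurable_integrable] by blast
  have Fl: "F \<in> borel_measurable lebesgue" by (rule measurable_completion) simp
  have iF: "integrable lborel F"
  proof -
    have "integrable lebesgue F"
      using integrable_cong_AE[OF borel_measurable_integrable[OF i] Fl F] i by blast
    then show ?thesis by (simp add: integrable_completion)
  qed
  have gz: "(LBINT x. F x * of_real (c * exp (- ((x - y) * n)\<^sup>2 / 2))) = 0" if "n > 0" for c y n
  proof -
    \<comment> \<open>Completing the square in \<open>x\<^sup>2 + (x - y)\<^sup>2 n\<^sup>2 / 2\<close> gives the centre \<open>b\<close> and the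
      inverse width \<open>a\<close> of the product Gaussian.\<close>
    define a where "a = n\<^sup>2 / 2 + 1"
    define b where "b = (n\<^sup>2 / 2) * y / a"
    have a: "a > 0" unfolding a_def by (simp add: add_nonneg_pos)
    have e: "exp (- (x)\<^sup>2) * exp (- ((x - y) * n)\<^sup>2 / 2) = exp (a * b\<^sup>2 - (n\<^sup>2 / 2) * y\<^sup>2) * exp (- a * (x - b)\<^sup>2)" for x
    proof -
      have ab: "a * b = (n\<^sup>2 / 2) * y" using a by (simp add: b_def)
      have "a * (x - b)\<^sup>2 = a * x\<^sup>2 - 2 * (a * b) * x + a * b\<^sup>2" by (simp add: power2_eq_square algebra_simps)
      then have "- (x)\<^sup>2 + - ((x - y) * n)\<^sup>2 / 2 = a * b\<^sup>2 - (n\<^sup>2 / 2) * y\<^sup>2 + - a * (x - b)\<^sup>2"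
        unfolding ab by (simp add: a_def power2_eq_square field_simps)
      then show ?thesis by (simp add: exp_add[symmetric])
    qed
    have s: "schwartz (\<lambda>x. of_real (c * exp (a * b\<^sup>2 - (n\<^sup>2 / 2) * y\<^sup>2)) * of_real (exp (- a * (x - b)\<^sup>2)))"
      by (intro schwartz_cmult schwartz_gaussian a)
    have eq: "g x * of_real (c * exp (- ((x - y) * n)\<^sup>2 / 2)) = of_real (c * exp (a * b\<^sup>2 - (n\<^sup>2 / 2) * y\<^sup>2)) * of_real (exp (- a * (x - b)\<^sup>2))" for x
      unfolding g_def of_real_mult[symmetric] using e[of x] by (simp add: mult.assoc mult.left_commute)
    have "(LBINT x. F x * of_real (c * exp (- ((x - y) * n)\<^sup>2 / 2))) = (LINT x|lebesgue. F x * of_real (c * exp (- ((x - y) * n)\<^sup>2 / 2)))"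
      by (rule integral_completion[symmetric]) measurable
    also have "\<dots> = (LINT x|lebesgue. f x * (g x * of_real (c * exp (- ((x - y) * n)\<^sup>2 / 2))))"
    proof (rule integral_cong_AE)
      show "(\<lambda>x. F x * of_real (c * exp (- ((x - y) * n)\<^sup>2 / 2))) \<in> borel_measurable lebesgue"
        by (rule measurable_completion) measurable
      show "(\<lambda>x. f x * (g x * of_real (c * exp (- ((x - y) * n)\<^sup>2 / 2)))) \<in> borel_measurable lebesgue"
        unfolding eq using schwartz_lebesgue_measurable[OF s] by measurable
      show "AE x in lebesgue. F x * of_real (c * exp (- ((x - y) * n)\<^sup>2 / 2)) = f x * (g x * of_real (c * exp (- ((x - y) * n)\<^sup>2 / 2)))"
        using F by eventually_elim (simp flip: mult.assoc)
    qed
    also have "\<dots> = 0" unfolding eq by (rule z[OF s])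
    finally show ?thesis .
  qed
  have "AE x in lborel. F x = 0"
  proof (rule integral_Icc_zero_imp_AE_zero[OF iF])
    fix a b :: real
    let ?I = "indicator {a..b} :: real \<Rightarrow> complex"
    let ?K = "\<lambda>k (x::real) (y::real). gker k x y"
    have I_meas [measurable]: "?I \<in> borel_measurable borel" by (rule borel_measurable_indicator) simp
    have I1: "norm (?I x) \<le> 1" for x by (simp add: indicator_def)
    have "(LBINT x. F x * (LBINT y. ?I y * ?K k x y)) = 0" for k
    proof -
      have iI: "integrable lborel ?I"
      proof -
        have "integrable lborel (indicator {a..b} :: real \<Rightarrow> real)"
          by (rule integrable_real_indicator) (auto simp: emeasure_lborel_Icc_eq)
        then have "integrable lborel (\<lambda>x. complex_of_real (indicator {a..b} x))" by (rule integrable_of_real)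
        then show ?thesis by (simp add: of_real_indicator)
      qed
      have "(LBINT x. F x * (LBINT y. ?K k x y * ?I y)) = (LBINT y. (LBINT x. F x * ?K k x y) * ?I y)"
      proof (rule fubini_kernel[OF iF iI])
        show "(\<lambda>(x, y). ?K k x y) \<in> borel_measurable (borel \<Otimes>\<^sub>M borel)" by measurable
        have "Suc k * sqrt (2 * pi) * exp (- ((x - y) * Suc k)\<^sup>2 / 2) \<le> Suc k * sqrt (2 * pi) * 1" for x y :: real
          by (intro mult_left_mono) auto
        then show "norm (?K k x y) \<le> Suc k * sqrt (2 * pi)" for x y
          unfolding norm_of_real by (simp add: abs_mult)
      qed
      also have "\<dots> = 0" by (subst gz) auto
      finally show ?thesis by (simp add: mult.commute)
    qed
    moreover have "(\<lambda>k. LBINT x. F x * (LBINT y. ?I y * ?K k x y)) \<longlonglongrightarrow> (LBINT x. F x * (complex_of_real (2 * pi) * ?I x))"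
    proof (rule integral_dominated_convergence[where w="\<lambda>x. norm (F x) * (2 * pi * 1)"])
      show "integrable lborel (\<lambda>x. norm (F x) * (2 * pi * 1))" using iF by (intro integrable_mult_left) auto
      \<comment> \<open>The mollified indicator function converges to the indicator function except at the two
        end points, where the latter is not continuous.\<close>
      have "AE x in lborel. x \<notin> {a, b}" 
        by (rule AE_not_in) (simp add: null_sets_def emeasure_lborel_countable)
      then show "AE x in lborel. (\<lambda>k. F x * (LBINT y. ?I y * ?K k x y)) \<longlonglongrightarrow> F x * (complex_of_real (2 * pi) * ?I x)"
      proof eventually_elim
        case (elim x)
        have "isCont ?I x"
        proof -
          have ne: "eventually (\<lambda>y. ?I y = ?I x) (nhds x)"
          proof -
            have "x < a \<or> x \<in> {a<..<b} \<or> x > b" using elim by auto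
            then show ?thesis
            proof (elim disjE)
              assume "x < a"
              then have "eventually (\<lambda>y. y \<in> {..<a}) (nhds x)" by (intro eventually_nhds_in_open) auto
              then show ?thesis by eventually_elim (use \<open>x < a\<close> in auto)
            next
              assume "x \<in> {a<..<b}"
              then have "eventually (\<lambda>y. y \<in> {a<..<b}) (nhds x)" by (intro eventually_nhds_in_open) auto
              then show ?thesis by eventually_elim (use \<open>x \<in> {a<..<b}\<close> in auto)
            next
              assume "x > b"
              then have "eventually (\<lambda>y. y \<in> {b<..}) (nhds x)" by (intro eventually_nhds_in_open) auto
              then show ?thesis by eventually_elim (use \<open>x > b\<close> in auto)
            qed
          qed
          show ?thesis unfolding isCont_def
            by (rule tendsto_eventually) (use ne in \<open>auto simp: eventually_at_filter elim: eventually_mono\<close>)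
        qed
        show ?case by (intro tendsto_mult[OF tendsto_const] gaussian_mollify[OF I_meas I1 \<open>isCont ?I x\<close>])
      qed
      show "AE x in lborel. norm (F x * (LBINT y. ?I y * ?K k x y)) \<le> norm (F x) * (2 * pi * 1)" for k
        unfolding norm_mult
        by (intro AE_I2 mult_left_mono gaussian_mollify_bound[OF I_meas I1]) auto
    qed measurable
    ultimately have "(LBINT x. F x * (complex_of_real (2 * pi) * ?I x)) = 0"
      by (simp add: LIMSEQ_const_iff)
    also have "(LBINT x. F x * (complex_of_real (2 * pi) * ?I x)) = complex_of_real (2 * pi) * (LBINT x. F x * ?I x)"
      by (subst integral_mult_right_zero[symmetric]) (simp add: mult_ac)
    finally show "(LBINT x. F x * ?I x) = 0" by simp
  qed
  then have "AE x in lebesgue. F x = 0" by (rule AE_completion)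
  with F show ?thesis
    by eventually_elim (simp add: g_def)
qed

lemma dist_of_inject_AE:
  assumes "tempered_fun g" "tempered_fun h" "dist_of g = dist_of h"
  shows "AE x in lebesgue. g x = h x"
proof -
  have "AE x in lebesgue. 1 * g x + (-1) * h x = 0"
  proof (rule tempered_fun_AE_zero[OF tempered_fun_lincomb[OF assms(1,2)]])
    fix \<phi> assume s: "schwartz \<phi>"
    have "(LINT x|lebesgue. g x * \<phi> x) = (LINT x|lebesgue. h x * \<phi> x)"
      using fun_cong[OF assms(3), of \<phi>] s by (simp add: dist_of_def)
    then show "(LINT x|lebesgue. (1 * g x + (-1) * h x) * \<phi> x) = 0"
      using tempered_fun_schwartz_integrable[OF assms(1) s] tempered_fun_schwartz_integrable[OF assms(2) s]
      by (simp add: algebra_simps)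
  qed
  then show ?thesis by simp
qed

lemma fun_of_dist_of:
  assumes "tempered_fun g"
  shows "tempered_fun (fun_of (dist_of g))" "dist_of (fun_of (dist_of g)) = dist_of g"
    "AE x in lebesgue. fun_of (dist_of g) x = g x"
proof -
  have "\<exists>h. tempered_fun h \<and> dist_of g = dist_of h" using assms by blast
  from someI_ex[OF this, folded fun_of_def]
  have *: "tempered_fun (fun_of (dist_of g))" "dist_of g = dist_of (fun_of (dist_of g))" by auto
  show "tempered_fun (fun_of (dist_of g))" by (rule *(1))
  show "dist_of (fun_of (dist_of g)) = dist_of g" by (rule *(2)[symmetric])
  show "AE x in lebesgue. fun_of (dist_of g) x = g x"
    using dist_of_inject_AE[OF *(1) assms *(2)[symmetric]] .
qed

lemma integrable_tempered_fun: "integrable lborel g \<Longrightarrow> tempered_fun g"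
  unfolding tempered_fun_def
  by (rule exI[of _ 0]) (use integrable_completion[of g lborel] borel_measurable_integrable[of lborel g] in auto)

lemma bounded_tempered_fun:
  assumes [measurable]: "g \<in> borel_measurable borel" and B: "\<And>x. norm (g x :: complex) \<le> B"
  shows "tempered_fun g"
proof -
  have "integrable lborel (\<lambda>x. g x /\<^sub>R (1 + \<bar>x\<bar>) ^ 2)"
  proof (rule Bochner_Integration.integrable_bound[OF integrable_mult_right[OF lorentz_integrable, of B]])
    show "AE x in lborel. norm (g x /\<^sub>R (1 + \<bar>x\<bar>)\<^sup>2) \<le> norm (B * (1 / (1 + x\<^sup>2)))"
    proof (intro AE_I2)
      fix x :: real
      have "0 < 1 + x\<^sup>2" by (simp add: add_pos_nonneg)
      then have "norm (g x) / (1 + \<bar>x\<bar>)\<^sup>2 \<le> \<bar>B\<bar> / (1 + x\<^sup>2)"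
        by (intro frac_le) (use B[of x] in \<open>auto simp: power2_eq_square algebra_simps\<close>)
      then show "norm (g x /\<^sub>R (1 + \<bar>x\<bar>)\<^sup>2) \<le> norm (B * (1 / (1 + x\<^sup>2)))"
        using \<open>0 < 1 + x\<^sup>2\<close> by (simp add: divide_inverse mult.commute)
    qed
  qed measurable
  then have "integrable lebesgue (\<lambda>x. g x /\<^sub>R (1 + \<bar>x\<bar>) ^ 2)"
    by (subst integrable_completion) auto
  then show ?thesis unfolding tempered_fun_def by blast
qed

lemma schwartz_seminorm_nonneg: "0 \<le> schwartz_seminorm k n \<phi>" if "schwartz \<phi>"
proof -
  have "bdd_above (range (\<lambda>x. norm (x ^ k *\<^sub>R (ddx_fun ^^ n) \<phi> x)))"
    using that unfolding schwartz_def by (auto simp: bounded_iff bdd_above_def)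
  then have "norm (0 ^ k *\<^sub>R (ddx_fun ^^ n) \<phi> 0) \<le> schwartz_seminorm k n \<phi>"
    unfolding schwartz_seminorm_def by (rule cSUP_upper[rotated]) simp
  then show ?thesis using norm_ge_zero order_trans by blast
qed

lemma schwartz_seminorm_upper:
  assumes "schwartz \<phi>" shows "norm (x ^ k *\<^sub>R (ddx_fun ^^ n) \<phi> x) \<le> schwartz_seminorm k n \<phi>"
proof -
  have "bdd_above (range (\<lambda>x. norm (x ^ k *\<^sub>R (ddx_fun ^^ n) \<phi> x)))"
    using assms unfolding schwartz_def by (auto simp: bounded_iff bdd_above_def)
  then show ?thesis
    unfolding schwartz_seminorm_def by (rule cSUP_upper[rotated]) simp
qed

text \<open>
  The factor \<open>1 + x\<^sup>2\<close> is absorbed by the seminorms with indices \<open>(0,0)\<close> and \<open>(2,0)\<close> of the test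
  function, and \<open>1 / (1 + x\<^sup>2)\<close> has integral \<open>\<pi>\<close>.
\<close>

lemma tempered_bounded:
  assumes [measurable]: "g \<in> borel_measurable borel" and B: "\<And>x. norm (g x :: complex) \<le> B"
  shows "tempered (dist_of g)"
  unfolding tempered_def
proof (intro conjI allI impI)
  show "dist_of g \<phi> = 0" if "\<not> schwartz \<phi>" for \<phi> using that by (simp add: dist_of_def)
  have tg: "tempered_fun g" by (rule bounded_tempered_fun[OF assms])
  show "dist_of g (\<lambda>x. a * \<phi> x + b * \<psi> x) = a * dist_of g \<phi> + b * dist_of g \<psi>" if "schwartz \<phi>" "schwartz \<psi>" for \<phi> \<psi> a b
  proof -
    have i: "integrable lebesgue (\<lambda>x. g x * \<phi> x)" "integrable lebesgue (\<lambda>x. g x * \<psi> x)"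
      using tempered_fun_schwartz_integrable[OF tg] that by auto
    have "(LINT x|lebesgue. g x * (a * \<phi> x + b * \<psi> x)) = (LINT x|lebesgue. a * (g x * \<phi> x) + b * (g x * \<psi> x))"
      by (simp add: algebra_simps)
    also have "\<dots> = a * (LINT x|lebesgue. g x * \<phi> x) + b * (LINT x|lebesgue. g x * \<psi> x)"
      using i by simp
    finally show ?thesis using that by (simp add: dist_of_def schwartz_lincomb)
  qed
  have B0: "0 \<le> B" using B[of 0] norm_ge_zero order_trans by blast
  have "norm (dist_of g \<phi>) \<le> (B * pi) * (\<Sum>k\<le>2. \<Sum>n\<le>2. schwartz_seminorm k n \<phi>)" if s: "schwartz \<phi>" for \<phi>
  proof -
    let ?S = "\<Sum>k\<le>2. \<Sum>n\<le>2. schwartz_seminorm k n \<phi>"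
    have [measurable]: "\<phi> \<in> borel_measurable borel" by (rule schwartz_borel[OF s])
    have S: "schwartz_seminorm 0 0 \<phi> + schwartz_seminorm 2 0 \<phi> \<le> ?S"
      using schwartz_seminorm_nonneg[OF s] by (simp add: numeral_2_eq_2 add_nonneg_nonneg)
    have le: "norm (g x * \<phi> x) \<le> (B * ?S) * (1 / (1 + x\<^sup>2))" for x
    proof -
      have "(1 + x\<^sup>2) * norm (\<phi> x) = norm (x ^ 0 *\<^sub>R (ddx_fun ^^ 0) \<phi> x) + norm (x ^ 2 *\<^sub>R (ddx_fun ^^ 0) \<phi> x)"
        by (simp add: algebra_simps)
      also have "\<dots> \<le> ?S"
        using schwartz_seminorm_upper[OF s, of x 0 0] schwartz_seminorm_upper[OF s, of x 2 0] S by linarith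
      finally have "norm (\<phi> x) \<le> ?S * (1 / (1 + x\<^sup>2))"
        by (simp add: pos_le_divide_eq add_pos_nonneg mult.commute)
      then have "norm (g x) * norm (\<phi> x) \<le> B * (?S * (1 / (1 + x\<^sup>2)))"
        by (intro mult_mono B B0) auto
      then show ?thesis by (simp add: norm_mult)
    qed
    have i: "integrable lborel (\<lambda>x. (B * ?S) * (1 / (1 + x\<^sup>2)))" by (rule integrable_mult_right[OF lorentz_integrable])
    have "norm (LBINT x. g x * \<phi> x) \<le> (LBINT x. (B * ?S) * (1 / (1 + x\<^sup>2)))"
    proof (rule order_trans[OF integral_norm_bound integral_mono[OF integrable_norm i le]])
      show "integrable lborel (\<lambda>x. g x * \<phi> x)"
        by (rule Bochner_Integration.integrable_bound[OF i]) (use order_trans[OF le abs_ge_self] in auto)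
    qed
    also have "\<dots> = (B * pi) * ?S" unfolding integral_mult_right_zero lorentz_integral by simp
    also have "(LBINT x. g x * \<phi> x) = dist_of g \<phi>"
      using s by (simp add: dist_of_def integral_completion)
    finally show ?thesis .
  qed
  then show "\<exists>K N. \<forall>\<phi>. schwartz \<phi> \<longrightarrow> norm (dist_of g \<phi>) \<le> K * (\<Sum>k\<le>N. \<Sum>n\<le>N. schwartz_seminorm k n \<phi>)"
    by blast
qed

section \<open>Inverse Fourier transforms of integrable functions\<close>

definition ift :: "(real \<Rightarrow> complex) \<Rightarrow> real \<Rightarrow> complex" where
  "ift h x = of_real (1 / (2 * pi)) * (LBINT \<xi>. iexp (x * \<xi>) * h \<xi>)"

lemma ift_measurable [measurable]:
  assumes "integrable lborel h" shows "ift h \<in> borel_measurable borel"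
proof -
  have [measurable]: "h \<in> borel_measurable borel" using assms borel_measurable_integrable by auto
  show ?thesis unfolding ift_def by measurable
qed

lemma ift_bound:
  assumes "integrable lborel h" shows "norm (ift h x) \<le> 1 / (2 * pi) * (LBINT \<xi>. norm (h \<xi>))"
proof -
  have "norm (LBINT \<xi>. iexp (x * \<xi>) * h \<xi>) \<le> (LBINT \<xi>. norm (iexp (x * \<xi>) * h \<xi>))"
    by (rule integral_norm_bound)
  also have "\<dots> = (LBINT \<xi>. norm (h \<xi>))" by (simp add: norm_mult)
  finally show ?thesis unfolding ift_def norm_mult norm_of_real by (intro mult_mono) auto
qed

lemma ift_schwartz:
  assumes "schwartz \<phi>" shows "ift \<phi> x = of_real (1 / (2 * pi)) * fourier_fun \<phi> (- x)"
  unfolding ift_def fourier_fun_lborel[OF assms] by (simp add: mult.commute)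

lemma ift_fourier_fun:
  assumes "schwartz \<phi>" shows "ift (fourier_fun \<phi>) x = \<phi> x"
  unfolding ift_def fourier_inversion[OF assms] by simp

lemma dist_of_lborel:
  assumes [measurable]: "g \<in> borel_measurable borel" and s: "schwartz \<phi>"
  shows "dist_of g \<phi> = (LBINT x. g x * \<phi> x)"
proof -
  have [measurable]: "\<phi> \<in> borel_measurable borel" by (rule schwartz_borel[OF s])
  have "(LINT x|lebesgue. g x * \<phi> x) = (LBINT x. g x * \<phi> x)" by (rule integral_completion) measurable
  then show ?thesis using s by (simp add: dist_of_def)
qed

text \<open>
  All pairings of solutions with test functions are moved to the Fourier side by this identity, where
  they become absolutely convergent integrals against the bounded function \<open>ift \<phi>\<close>.
\<close>

lemma ift_pairing:
  assumes h: "integrable lborel h" and s: "schwartz \<phi>"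
  shows "dist_of (ift h) \<phi> = (LBINT \<xi>. h \<xi> * ift \<phi> \<xi>)"
proof -
  let ?c = "complex_of_real (1 / (2 * pi))"
  have "dist_of (ift h) \<phi> = (LBINT x. ift h x * \<phi> x)"
    by (rule dist_of_lborel[OF ift_measurable[OF h] s])
  also have "\<dots> = ?c * (LBINT x. \<phi> x * (LBINT \<xi>. iexp (x * \<xi>) * h \<xi>))"
    unfolding ift_def by (subst integral_mult_right_zero[symmetric]) (simp add: mult_ac)
  also have "(LBINT x. \<phi> x * (LBINT \<xi>. iexp (x * \<xi>) * h \<xi>)) = (LBINT \<xi>. (LBINT x. \<phi> x * iexp (x * \<xi>)) * h \<xi>)"
  proof (rule fubini_kernel[OF schwartz_integrable[OF s] h])
    show "(\<lambda>(x, \<xi>). iexp (x * \<xi>)) \<in> borel_measurable (borel \<Otimes>\<^sub>M borel)" by measurable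
    show "norm (iexp (x * \<xi>)) \<le> 1" for x \<xi> by simp
  qed
  also have "?c * \<dots> = (LBINT \<xi>. h \<xi> * ift \<phi> \<xi>)"
    unfolding ift_def by (subst integral_mult_right_zero[symmetric]) (simp add: mult_ac)
  finally show ?thesis .
qed

lemma tempered_fun_ift: "integrable lborel h \<Longrightarrow> tempered_fun (ift h)"
  by (rule bounded_tempered_fun[OF ift_measurable ift_bound])

lemma tempered_ift: "integrable lborel h \<Longrightarrow> tempered (dist_of (ift h))"
  by (rule tempered_bounded[OF ift_measurable ift_bound])

lemma fourier_ift:
  assumes h: "integrable lborel h" shows "fourier (dist_of (ift h)) = dist_of h"
proof
  fix \<phi>
  have [measurable]: "h \<in> borel_measurable borel" using h borel_measurable_integrable by auto
  show "fourier (dist_of (ift h)) \<phi> = dist_of h \<phi>"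
  proof (cases "schwartz \<phi>")
    case True
    then show ?thesis
      by (simp add: fourier_def ift_pairing[OF h schwartz_fourier] ift_fourier_fun dist_of_lborel)
  qed (simp add: fourier_def dist_of_def)
qed

text \<open>
  Every Schwartz function is the Fourier transform of a test function.
\<close>

lemma fourier_inject:
  assumes "tempered u" "tempered v" "fourier u = fourier v" shows "u = v"
proof
  fix \<psi>
  show "u \<psi> = v \<psi>"
  proof (cases "schwartz \<psi>")
    case True
    then obtain \<phi> where "schwartz \<phi>" "fourier_fun \<phi> = \<psi>" using schwartz_fourier_surj by blast
    then show ?thesis using fun_cong[OF assms(3), of \<phi>] by (simp add: fourier_def)
  next
    case False then show ?thesis using assms unfolding tempered_def by auto
  qed
qed

lemma fhat_ift:
  assumes "integrable lborel h"
  shows "AE \<xi> in lebesgue. fhat (dist_of (ift h)) \<xi> = h \<xi>"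
    "fhat (dist_of (ift h)) \<in> borel_measurable lebesgue"
  unfolding fhat_def fourier_ift[OF assms]
  using fun_of_dist_of[OF integrable_tempered_fun[OF assms]] tempered_fun_measurable by auto

text \<open>
  The Fourier transform of the derivative.
\<close>

abbreviation dsym :: "(real \<Rightarrow> complex) \<Rightarrow> real \<Rightarrow> complex" where
  "dsym h \<equiv> \<lambda>\<xi>. \<i> * of_real \<xi> * h \<xi>"

lemma ddx_ift:
  assumes h: "integrable lborel h" and h': "integrable lborel (dsym h)"
  shows "ddx (dist_of (ift h)) = dist_of (ift (dsym h))"
proof
  fix \<phi>
  show "ddx (dist_of (ift h)) \<phi> = dist_of (ift (dsym h)) \<phi>"
  proof (cases "schwartz \<phi>")
    case True
    have "h \<xi> * ift (ddx_fun \<phi>) \<xi> = - (\<i> * of_real \<xi> * h \<xi> * ift \<phi> \<xi>)" for \<xi>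
      by (simp add: ift_schwartz True schwartz_ddx fourier_fun_ddx)
    then show ?thesis
      by (simp add: ddx_def True ift_pairing[OF h schwartz_ddx[OF True]] ift_pairing[OF h' True])
  qed (simp add: ddx_def dist_of_def)
qed

definition conv :: "(real \<Rightarrow> complex) \<Rightarrow> (real \<Rightarrow> complex) \<Rightarrow> real \<Rightarrow> complex" where
  "conv h k \<xi> = (LBINT \<eta>. h \<eta> * k (\<xi> - \<eta>))"

lemma integrable_shift_reflect:
  fixes k :: "real \<Rightarrow> 'a::{banach, second_countable_topology}"
  assumes "integrable lborel k" shows "integrable lborel (\<lambda>\<xi>. k (\<xi> - a))" "(LBINT \<xi>. k (\<xi> - a)) = (LBINT \<xi>. k \<xi>)"
proof -
  show "integrable lborel (\<lambda>\<xi>. k (\<xi> - a))"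
    using lborel_integrable_real_affine[OF assms, of 1 "- a"] by simp
  show "(LBINT \<xi>. k (\<xi> - a)) = (LBINT \<xi>. k \<xi>)"
    using lborel_integral_real_affine[of 1 k "- a"] by simp
qed

lemma conv_pair_integrable:
  fixes K :: "real \<Rightarrow> complex"
  assumes h: "integrable lborel h" and k: "integrable lborel k"
    and K[measurable]: "K \<in> borel_measurable borel" and K1: "\<And>x. norm (K x) \<le> 1"
  shows "integrable (lborel \<Otimes>\<^sub>M lborel) (\<lambda>(\<eta>, \<xi>). K \<xi> * (h \<eta> * k (\<xi> - \<eta>)))"
proof -
  have [measurable]: "h \<in> borel_measurable borel" "k \<in> borel_measurable borel"
    using h k borel_measurable_integrable by auto
  have 1: "integrable (lborel \<Otimes>\<^sub>M lborel) (\<lambda>(\<eta>, \<xi>). h \<eta> * k (\<xi> - \<eta>))"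
  proof (rule lborel_pair.Fubini_integrable)
    show "(\<lambda>(\<eta>, \<xi>). h \<eta> * k (\<xi> - \<eta>)) \<in> borel_measurable (lborel \<Otimes>\<^sub>M lborel)" by measurable
    show "integrable lborel (\<lambda>\<eta>. LBINT \<xi>. norm (case (\<eta>, \<xi>) of (\<eta>, \<xi>) \<Rightarrow> h \<eta> * k (\<xi> - \<eta>)))"
      using h integrable_shift_reflect(2)[OF integrable_norm[OF k]] by (simp add: norm_mult)
    show "AE \<eta> in lborel. integrable lborel (\<lambda>\<xi>. case (\<eta>, \<xi>) of (\<eta>, \<xi>) \<Rightarrow> h \<eta> * k (\<xi> - \<eta>))"
      using integrable_shift_reflect(1)[OF k] by (intro AE_I2) simp
  qed
  show ?thesis
  proof (rule Bochner_Integration.integrable_bound[OF 1])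
    show "AE p in lborel \<Otimes>\<^sub>M lborel. norm (case p of (\<eta>, \<xi>) \<Rightarrow> K \<xi> * (h \<eta> * k (\<xi> - \<eta>))) \<le> norm (case p of (\<eta>, \<xi>) \<Rightarrow> h \<eta> * k (\<xi> - \<eta>))"
      by (intro AE_I2) (auto simp: norm_mult split: prod.split intro!: mult_left_le_one_le K1)
  qed measurable
qed

lemma conv_integrable:
  assumes "integrable lborel h" "integrable lborel k" shows "integrable lborel (conv h k)"
  unfolding conv_def
  using lborel_pair.integrable_snd[OF conv_pair_integrable[OF assms, of "\<lambda>_. 1"]] by simp

lemma ift_mult:
  assumes h: "integrable lborel h" and k: "integrable lborel k"
  shows "ift h x * ift k x = ift (\<lambda>\<xi>. of_real (1 / (2 * pi)) * conv h k \<xi>) x"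
proof -
  let ?c = "complex_of_real (1 / (2 * pi))" and ?e = "\<lambda>\<xi>. iexp (x * \<xi>)"
  have "(LBINT \<xi>. ?e \<xi> * conv h k \<xi>) = (LBINT \<xi>. LBINT \<eta>. ?e \<xi> * (h \<eta> * k (\<xi> - \<eta>)))"
    unfolding conv_def by simp
  also have "\<dots> = (LBINT \<eta>. LBINT \<xi>. ?e \<xi> * (h \<eta> * k (\<xi> - \<eta>)))"
    by (rule lborel_pair.Fubini_integral[OF conv_pair_integrable[OF h k]]) auto
  also have "\<dots> = (LBINT \<eta>. ?e \<eta> * h \<eta> * (LBINT \<xi>. ?e \<xi> * k \<xi>))"
  proof (rule Bochner_Integration.integral_cong[OF refl])
    fix \<eta>
    have "?e \<xi> * (h \<eta> * k (\<xi> - \<eta>)) = ?e \<eta> * h \<eta> * (?e (\<xi> - \<eta>) * k (\<xi> - \<eta>))" for \<xi>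
    proof -
      have "?e \<xi> = ?e \<eta> * ?e (\<xi> - \<eta>)" by (simp add: exp_add[symmetric] algebra_simps)
      then show ?thesis by simp
    qed
    then have "(LBINT \<xi>. ?e \<xi> * (h \<eta> * k (\<xi> - \<eta>))) = ?e \<eta> * h \<eta> * (LBINT \<xi>. ?e (\<xi> - \<eta>) * k (\<xi> - \<eta>))"
      by (simp only: integral_mult_right_zero)
    also have "(LBINT \<xi>. ?e (\<xi> - \<eta>) * k (\<xi> - \<eta>)) = (LBINT \<xi>. ?e \<xi> * k \<xi>)"
      by (rule integrable_shift_reflect(2)[OF integrable_iexp_mult(1)[OF k]]) simp
    finally show "(LBINT \<xi>. ?e \<xi> * (h \<eta> * k (\<xi> - \<eta>))) = ?e \<eta> * h \<eta> * (LBINT \<xi>. ?e \<xi> * k \<xi>)" .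
  qed
  also have "\<dots> = (LBINT \<xi>. ?e \<xi> * h \<xi>) * (LBINT \<xi>. ?e \<xi> * k \<xi>)" by (rule integral_mult_left_zero)
  finally have "(LBINT \<xi>. ?e \<xi> * conv h k \<xi>) = (LBINT \<xi>. ?e \<xi> * h \<xi>) * (LBINT \<xi>. ?e \<xi> * k \<xi>)" .
  moreover have "(LBINT \<xi>. ?e \<xi> * (?c * conv h k \<xi>)) = ?c * (LBINT \<xi>. ?e \<xi> * conv h k \<xi>)"
    by (subst integral_mult_right_zero[symmetric]) (simp add: mult_ac)
  ultimately show ?thesis unfolding ift_def by (simp add: mult_ac)
qed

text \<open>
  Here \<open>ift h\<close> has the continuous derivative \<open>ift (dsym h)\<close>, whose square has the Fourier transform \<open>k\<close>. The
  function \<open>fun_of (ddx \<dots>)\<close> in the definition of \<open>ux_sq\<close> is a chosen representative and agrees with this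
  derivative only almost everywhere.
\<close>

lemma ux_sq_ift:
  assumes h: "integrable lborel h" and h': "integrable lborel (dsym h)"
  defines "k \<equiv> \<lambda>\<xi>. of_real (1 / (2 * pi)) * conv (dsym h) (dsym h) \<xi>"
  shows "ux_sq (dist_of (ift h)) = dist_of (ift k)" "ux_sq_defined (dist_of (ift h))" "integrable lborel k"
proof -
  let ?v = "\<lambda>\<xi>. \<i> * of_real \<xi> * h \<xi>"
  show ik: "integrable lborel k" unfolding k_def by (intro integrable_mult_right conv_integrable h')
  have d: "ddx (dist_of (ift h)) = dist_of (ift ?v)" by (rule ddx_ift[OF h h'])
  have tv: "tempered_fun (ift ?v)" by (rule tempered_fun_ift[OF h'])
  define g where "g = fun_of (ddx (dist_of (ift h)))"
  have g: "tempered_fun g" "AE x in lebesgue. g x = ift ?v x"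
    unfolding g_def d using fun_of_dist_of[OF tv] by auto
  have [measurable]: "g \<in> borel_measurable lebesgue" by (rule tempered_fun_measurable[OF g(1)])
  have sq: "ift ?v x * ift ?v x = ift k x" for x unfolding k_def by (rule ift_mult[OF h' h'])
  have ae: "AE x in lebesgue. ift k x = (g x)\<^sup>2"
    using g(2) by eventually_elim (simp add: sq[symmetric] power2_eq_square)
  have tk: "tempered_fun (ift k)" by (rule tempered_fun_ift[OF ik])
  have mk: "ift k \<in> borel_measurable lebesgue" by (rule tempered_fun_measurable[OF tk])
  have tg: "tempered_fun (\<lambda>x. (g x)\<^sup>2)" by (rule tempered_fun_cong_AE[OF tk _ ae]) measurable
  show eq: "ux_sq (dist_of (ift h)) = dist_of (ift k)"
    unfolding ux_sq_def g_def[symmetric]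
    by (rule dist_of_cong_AE[OF _ mk]) (use ae in \<open>auto elim: eventually_mono\<close>)
  show "ux_sq_defined (dist_of (ift h))"
    unfolding ux_sq_defined_def eq fourier_ift[OF ik] g_def[symmetric]
    using tg d tv integrable_tempered_fun[OF ik] unfolding regular_def by auto
qed

text \<open>
  Uniqueness in the definite description is the injectivity of the Fourier transform. The equation
  between \<open>h\<close> and the propagated \<open>k\<close> is required only almost everywhere, because \<open>\<Phi>\<close> is merely Lebesgue
  measurable and is replaced below by a Borel function.
\<close>

lemma propagator_ift:
  assumes k: "integrable lborel k" and h: "integrable lborel h"
    and [measurable]: "\<Phi> \<in> borel_measurable lebesgue"
    and ae: "AE \<xi> in lebesgue. exp (\<i> * of_real (t * \<xi> ^ 3) + of_real (\<eta> * t * \<Phi> \<xi>)) * k \<xi> = h \<xi>"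
  shows "propagator \<eta> \<Phi> t (dist_of (ift k)) = dist_of (ift h)"
  unfolding propagator_def
proof (rule the_equality)
  have [measurable]: "fhat (dist_of (ift k)) \<in> borel_measurable lebesgue" by (rule fhat_ift(2)[OF k])
  have [measurable]: "(\<lambda>\<xi>::real. \<i> * of_real (t * \<xi> ^ 3)) \<in> borel_measurable lebesgue" 
    by (rule measurable_completion) measurable
  have hm: "h \<in> borel_measurable lebesgue" by (rule tempered_fun_measurable[OF integrable_tempered_fun[OF h]])
  have "dist_of h = dist_of (\<lambda>\<xi>. exp (\<i> * of_real (t * \<xi> ^ 3) + of_real (\<eta> * t * \<Phi> \<xi>)) * fhat (dist_of (ift k)) \<xi>)"
  proof (rule dist_of_cong_AE[OF hm])
    show "AE \<xi> in lebesgue. h \<xi> = exp (\<i> * of_real (t * \<xi> ^ 3) + of_real (\<eta> * t * \<Phi> \<xi>)) * fhat (dist_of (ift k)) \<xi>"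
      using ae fhat_ift(1)[OF k] by eventually_elim simp
  qed measurable
  then show *: "tempered (dist_of (ift h)) \<and> fourier (dist_of (ift h)) =
      dist_of (\<lambda>\<xi>. exp (\<i> * of_real (t * \<xi> ^ 3) + of_real (\<eta> * t * \<Phi> \<xi>)) * fhat (dist_of (ift k)) \<xi>)"
    using tempered_ift[OF h] fourier_ift[OF h] by simp
  show "v = dist_of (ift h)" if "tempered v \<and> fourier v =
      dist_of (\<lambda>\<xi>. exp (\<i> * of_real (t * \<xi> ^ 3) + of_real (\<eta> * t * \<Phi> \<xi>)) * fhat (dist_of (ift k)) \<xi>)" for v
    using that * fourier_inject by metis
qed

lemma ift_lincomb:
  assumes h: "integrable lborel h" and k: "integrable lborel k"
  shows "a *\<^sub>R dist_of (ift h) + b *\<^sub>R dist_of (ift k) = dist_of (ift (\<lambda>\<xi>. a *\<^sub>R h \<xi> + b *\<^sub>R k \<xi>))"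
proof
  fix \<phi>
  have i: "integrable lborel (\<lambda>\<xi>. a *\<^sub>R h \<xi> + b *\<^sub>R k \<xi>)" using h k by simp
  show "(a *\<^sub>R dist_of (ift h) + b *\<^sub>R dist_of (ift k)) \<phi> = dist_of (ift (\<lambda>\<xi>. a *\<^sub>R h \<xi> + b *\<^sub>R k \<xi>)) \<phi>"
  proof (cases "schwartz \<phi>")
    case True
    have [measurable]: "h \<in> borel_measurable borel" "k \<in> borel_measurable borel" "ift \<phi> \<in> borel_measurable borel"
      using h k borel_measurable_integrable ift_measurable[OF schwartz_integrable[OF True]] by auto
    have ip: "integrable lborel (\<lambda>\<xi>. f \<xi> * ift \<phi> \<xi>)" if f: "integrable lborel f" for f
    proof (rule Bochner_Integration.integrable_bound[OF integrable_mult_left[OF f, of "of_real (1 / (2 * pi) * (LBINT \<xi>. norm (\<phi> \<xi>)))"]])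
      have [measurable]: "f \<in> borel_measurable borel" using f borel_measurable_integrable by auto
      show "(\<lambda>\<xi>. f \<xi> * ift \<phi> \<xi>) \<in> borel_measurable lborel" by measurable
      show "AE \<xi> in lborel. norm (f \<xi> * ift \<phi> \<xi>) \<le> norm (f \<xi> * complex_of_real (1 / (2 * pi) * (LBINT \<xi>. norm (\<phi> \<xi>))))"
        unfolding norm_mult norm_of_real
        by (intro AE_I2 mult_left_mono order_trans[OF ift_bound[OF schwartz_integrable[OF True]] abs_ge_self]) auto
    qed
    have "(LBINT \<xi>. (a *\<^sub>R h \<xi> + b *\<^sub>R k \<xi>) * ift \<phi> \<xi>) = (LBINT \<xi>. a *\<^sub>R (h \<xi> * ift \<phi> \<xi>) + b *\<^sub>R (k \<xi> * ift \<phi> \<xi>))"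
      by (simp add: distrib_right)
    also have "\<dots> = a *\<^sub>R (LBINT \<xi>. h \<xi> * ift \<phi> \<xi>) + b *\<^sub>R (LBINT \<xi>. k \<xi> * ift \<phi> \<xi>)"
      using ip[OF h] ip[OF k] by simp
    finally show ?thesis
      by (simp add: plus_fun_def scaleR_fun_def ift_pairing[OF h True] ift_pairing[OF k True] ift_pairing[OF i True])
  qed (simp add: plus_fun_def scaleR_fun_def dist_of_def)
qed

section \<open>Second differences of C2 maps\<close>

text \<open>
  A single axiom for linear combinations, so that membership and the norm bound of each instance come from
  one estimate.
\<close>

definition seminormed :: "'a::real_vector nspace \<Rightarrow> bool" where
  "seminormed X \<longleftrightarrow> 0 \<in> pts X \<and> (\<forall>x\<in>pts X. 0 \<le> nrm X x) \<and>
     (\<forall>x\<in>pts X. \<forall>y\<in>pts X. \<forall>a b. a *\<^sub>R x + b *\<^sub>R y \<in> pts X \<and>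
        nrm X (a *\<^sub>R x + b *\<^sub>R y) \<le> \<bar>a\<bar> * nrm X x + \<bar>b\<bar> * nrm X y)"

lemma seminormedD:
  assumes "seminormed X"
  shows "0 \<in> pts X" and "x \<in> pts X \<Longrightarrow> 0 \<le> nrm X x"
    and "x \<in> pts X \<Longrightarrow> y \<in> pts X \<Longrightarrow> x + y \<in> pts X"
    and "x \<in> pts X \<Longrightarrow> y \<in> pts X \<Longrightarrow> nrm X (x + y) \<le> nrm X x + nrm X y"
    and "x \<in> pts X \<Longrightarrow> a *\<^sub>R x \<in> pts X"
    and "x \<in> pts X \<Longrightarrow> nrm X (a *\<^sub>R x) \<le> \<bar>a\<bar> * nrm X x"
    and "x \<in> pts X \<Longrightarrow> y \<in> pts X \<Longrightarrow> x - y \<in> pts X"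
    and "x \<in> pts X \<Longrightarrow> y \<in> pts X \<Longrightarrow> nrm X (x - y) \<le> nrm X x + nrm X y"
    and "nrm X 0 = 0"
    and "x \<in> pts X \<Longrightarrow> y \<in> pts X \<Longrightarrow> nrm X (a *\<^sub>R x + b *\<^sub>R y) \<le> \<bar>a\<bar> * nrm X x + \<bar>b\<bar> * nrm X y"
    and "x \<in> pts X \<Longrightarrow> y \<in> pts X \<Longrightarrow> a *\<^sub>R x + b *\<^sub>R y \<in> pts X"
proof -
  have d: "a *\<^sub>R x + b *\<^sub>R y \<in> pts X" "nrm X (a *\<^sub>R x + b *\<^sub>R y) \<le> \<bar>a\<bar> * nrm X x + \<bar>b\<bar> * nrm X y"
    if "x \<in> pts X" "y \<in> pts X" for x y a b
    using assms that unfolding seminormed_def by blast+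
  show z: "0 \<in> pts X" "x \<in> pts X \<Longrightarrow> 0 \<le> nrm X x" for x using assms unfolding seminormed_def by blast+
  show "a *\<^sub>R x + b *\<^sub>R y \<in> pts X" "nrm X (a *\<^sub>R x + b *\<^sub>R y) \<le> \<bar>a\<bar> * nrm X x + \<bar>b\<bar> * nrm X y"
    "x + y \<in> pts X" "nrm X (x + y) \<le> nrm X x + nrm X y" "x - y \<in> pts X" "nrm X (x - y) \<le> nrm X x + nrm X y"
    if "x \<in> pts X" "y \<in> pts X"
    using d[OF that, of a b] d[OF that, of 1 1] d[OF that, of 1 "-1"] by simp_all
  show "a *\<^sub>R x \<in> pts X" "nrm X (a *\<^sub>R x) \<le> \<bar>a\<bar> * nrm X x" if "x \<in> pts X"
    using d[OF that that, of a 0] by simp_all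
  show "nrm X 0 = 0" using d(2)[OF z(1) z(1), of 0 0] z(2)[OF z(1)] by simp
qed

lemma blin_bdd:
  assumes X: "seminormed X" and A: "A \<in> pts (blin X Y)"
  shows "bdd_above ((\<lambda>h. nrm Y (A h)) ` {h \<in> pts X. nrm X h \<le> 1})"
proof -
  obtain K where K: "\<forall>h\<in>pts X. nrm Y (A h) \<le> K * nrm X h" using A unfolding blin_def by auto
  have "nrm Y (A h) \<le> \<bar>K\<bar>" if h: "h \<in> pts X" "nrm X h \<le> 1" for h
  proof -
    have 0: "0 \<le> nrm X h" using seminormedD(2)[OF X h(1)] .
    have "nrm Y (A h) \<le> K * nrm X h" using K h by blast
    also have "\<dots> \<le> \<bar>K\<bar> * 1" using 0 h by (intro mult_mono) auto
    finally show ?thesis by simp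
  qed
  then show ?thesis by (auto simp: bdd_above_def)
qed

lemma blinD:
  assumes "A \<in> pts (blin X Y)"
  shows "h \<in> pts X \<Longrightarrow> A h \<in> pts Y" "h \<notin> pts X \<Longrightarrow> A h = 0"
    "h \<in> pts X \<Longrightarrow> k \<in> pts X \<Longrightarrow> A (a *\<^sub>R h + b *\<^sub>R k) = a *\<^sub>R A h + b *\<^sub>R A k"
    "\<exists>K. \<forall>h\<in>pts X. nrm Y (A h) \<le> K * nrm X h"
    "h \<in> pts X \<Longrightarrow> A (a *\<^sub>R h) = a *\<^sub>R A h"
proof -
  note d = assms[unfolded blin_def fst_conv mem_Collect_eq]
  show "h \<in> pts X \<Longrightarrow> A h \<in> pts Y" "h \<notin> pts X \<Longrightarrow> A h = 0"
    "h \<in> pts X \<Longrightarrow> k \<in> pts X \<Longrightarrow> A (a *\<^sub>R h + b *\<^sub>R k) = a *\<^sub>R A h + b *\<^sub>R A k"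
    "\<exists>K. \<forall>h\<in>pts X. nrm Y (A h) \<le> K * nrm X h" using d by blast+
  show "A (a *\<^sub>R h) = a *\<^sub>R A h" if "h \<in> pts X"
  proof -
    have "A (a *\<^sub>R h + 0 *\<^sub>R h) = a *\<^sub>R A h + 0 *\<^sub>R A h" using d that by blast
    then show ?thesis by simp
  qed
qed

lemma blin_upper:
  assumes X: "seminormed X" and A: "A \<in> pts (blin X Y)" and h: "h \<in> pts X" "nrm X h \<le> 1"
  shows "nrm Y (A h) \<le> nrm (blin X Y) A"
proof -
  have "nrm Y (A h) \<le> (SUP h\<in>{h \<in> pts X. nrm X h \<le> 1}. nrm Y (A h))"
    by (rule cSUP_upper[OF _ blin_bdd[OF X A]]) (use h in simp)
  then show ?thesis by (simp add: blin_def)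
qed

lemma blin_least:
  assumes X: "seminormed X" and "\<And>h. h \<in> pts X \<Longrightarrow> nrm X h \<le> 1 \<Longrightarrow> nrm Y (A h) \<le> C"
  shows "nrm (blin X Y) A \<le> C"
proof -
  have "(SUP h\<in>{h \<in> pts X. nrm X h \<le> 1}. nrm Y (A h)) \<le> C"
    by (rule cSUP_least) (use assms seminormedD(1,9)[OF X] in \<open>auto intro: exI[of _ 0]\<close>)
  then show ?thesis by (simp add: blin_def)
qed

text \<open>
  A vector of seminorm zero cannot be normalised; for it the claim follows from any operator bound.
\<close>

lemma blin_apply:
  assumes X: "seminormed X" and Y: "seminormed Y" and A: "A \<in> pts (blin X Y)" and h: "h \<in> pts X"
  shows "nrm Y (A h) \<le> nrm (blin X Y) A * nrm X h"
proof (cases "nrm X h = 0")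
  case True
  obtain K where K: "\<forall>h\<in>pts X. nrm Y (A h) \<le> K * nrm X h" using blinD(4)[OF A] by blast
  then show ?thesis using True h by fastforce
next
  case False
  define n where "n = nrm X h"
  have n: "n > 0" using False seminormedD(2)[OF X h] by (simp add: n_def)
  let ?k = "(1 / n) *\<^sub>R h"
  have k: "?k \<in> pts X" using seminormedD(5)[OF X h] .
  have "nrm X ?k \<le> 1" using seminormedD(6)[OF X h, of "1 / n"] n by (simp add: n_def)
  then have 1: "nrm Y (A ?k) \<le> nrm (blin X Y) A" by (rule blin_upper[OF X A k])
  have "A h = n *\<^sub>R A ?k" using blinD(5)[OF A k, of n] n by simp
  then have "nrm Y (A h) \<le> \<bar>n\<bar> * nrm Y (A ?k)" using seminormedD(6)[OF Y blinD(1)[OF A k]] by simp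
  also have "\<dots> \<le> n * nrm (blin X Y) A" using n 1 by (simp add: mult_left_mono)
  finally show ?thesis by (simp add: n_def mult.commute)
qed

lemma seminormed_blin:
  assumes X: "seminormed X" and Y: "seminormed Y" shows "seminormed (blin X Y)"
  unfolding seminormed_def
proof (intro conjI ballI allI)
  note XD = seminormedD[OF X] and YD = seminormedD[OF Y]
  show "0 \<in> pts (blin X Y)"
    using YD(1,9) by (auto simp: blin_def intro!: exI[of _ 0])
  fix A assume A: "A \<in> pts (blin X Y)"
  show "0 \<le> nrm (blin X Y) A"
    using blin_upper[OF X A XD(1)] XD(9) YD(2)[OF blinD(1)[OF A XD(1)]] by simp
  fix B and a b :: real assume B: "B \<in> pts (blin X Y)"
  have app: "(a *\<^sub>R A + b *\<^sub>R B) h = a *\<^sub>R A h + b *\<^sub>R B h" for h by (simp add: plus_fun_def scaleR_fun_def)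
  have le: "nrm Y ((a *\<^sub>R A + b *\<^sub>R B) h) \<le> \<bar>a\<bar> * nrm Y (A h) + \<bar>b\<bar> * nrm Y (B h)" if "h \<in> pts X" for h
    unfolding app by (rule YD(10)[OF blinD(1)[OF A that] blinD(1)[OF B that]])
  obtain K where K: "\<forall>h\<in>pts X. nrm Y (A h) \<le> K * nrm X h" using blinD(4)[OF A] by blast
  obtain K' where K': "\<forall>h\<in>pts X. nrm Y (B h) \<le> K' * nrm X h" using blinD(4)[OF B] by blast
  have "nrm Y ((a *\<^sub>R A + b *\<^sub>R B) h) \<le> (\<bar>a\<bar> * K + \<bar>b\<bar> * K') * nrm X h" if h: "h \<in> pts X" for h
    using le[OF h] add_mono[OF mult_left_mono[OF K[rule_format, OF h], of "\<bar>a\<bar>"] mult_left_mono[OF K'[rule_format, OF h], of "\<bar>b\<bar>"]]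
    by (simp add: distrib_right mult.assoc)
  then have "\<exists>K. \<forall>h\<in>pts X. nrm Y (a *\<^sub>R A h + b *\<^sub>R B h) \<le> K * nrm X h" unfolding app by blast
  then show "a *\<^sub>R A + b *\<^sub>R B \<in> pts (blin X Y)"
    using blinD(1,2,3)[OF A] blinD(1,2,3)[OF B] YD(11)
    unfolding blin_def fst_conv mem_Collect_eq app by (simp add: scaleR_add_right add_ac mult.commute)
  show "nrm (blin X Y) (a *\<^sub>R A + b *\<^sub>R B) \<le> \<bar>a\<bar> * nrm (blin X Y) A + \<bar>b\<bar> * nrm (blin X Y) B"
  proof (rule blin_least[OF X])
    fix h assume h: "h \<in> pts X" "nrm X h \<le> 1"
    show "nrm Y ((a *\<^sub>R A + b *\<^sub>R B) h) \<le> \<bar>a\<bar> * nrm (blin X Y) A + \<bar>b\<bar> * nrm (blin X Y) B"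
      by (rule order_trans[OF le[OF h(1)]]) (intro add_mono mult_left_mono blin_upper[OF X _ h] A B abs_ge_zero)
  qed
qed

text \<open>
  The derivative \<open>D1\<close> is differentiable at 0 and hence Lipschitz there: \<open>D1 h - D1 0\<close> is of order
  the norm of \<open>h\<close>. The second difference is \<open>G 1 - G 0\<close> for \<open>G t = F (h + t h) - F (t h)\<close>, and the derivative of
  \<open>G\<close> is \<open>(D1 (h + t h) - D1 (t h)) h\<close>, of the order of the square of that norm. The mean value inequality for
  \<open>G\<close> is proved by bisection, which works for values in a seminormed space without completeness or
  duality.
\<close>

theorem C2_at_second_difference:
  assumes X: "seminormed X" and Y: "seminormed Y" and C2: "C2_at X Y F 0"
  shows "\<exists>K. \<exists>\<delta>>0. \<forall>h\<in>pts X. nrm X h < \<delta> \<longrightarrow>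
           F (2 *\<^sub>R h) \<in> pts Y \<and> F h \<in> pts Y \<and> F 0 \<in> pts Y \<and>
           nrm Y (F (2 *\<^sub>R h) - F h - (F h - F 0)) \<le> K * (nrm X h)\<^sup>2"
proof -
  note XD = seminormedD[OF X] and YD = seminormedD[OF Y]
  note L = seminormed_blin[OF X Y]
  note LD = seminormedD[OF L]
  obtain \<rho> D1 D2 where \<rho>: "\<rho> > 0" and all: "\<forall>y\<in>pts X. nrm X (y - 0) < \<rho> \<longrightarrow>
           F y \<in> pts Y \<and> has_frechet X Y F (D1 y) y \<and> has_frechet X (blin X Y) D1 (D2 y) y"
    using C2 unfolding C2_at_def by blast
  have F: "F y \<in> pts Y" "has_frechet X Y F (D1 y) y" "has_frechet X (blin X Y) D1 (D2 y) y"
    if "y \<in> pts X" "nrm X y < \<rho>" for y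
    using all that by auto
  have D1: "D1 y \<in> pts (blin X Y)" if "y \<in> pts X" "nrm X y < \<rho>" for y
    using F(2)[OF that] unfolding has_frechet_def by blast
  have 0: "0 \<in> pts X" "nrm X 0 < \<rho>" using XD(1,9) \<rho> by auto
  have D2: "D2 0 \<in> pts (blin X (blin X Y))" using F(3)[OF 0] unfolding has_frechet_def by blast
  obtain \<delta>1 where \<delta>1: "\<delta>1 > 0" and d1: "\<And>h. h \<in> pts X \<Longrightarrow> nrm X h < \<delta>1 \<Longrightarrow>
      nrm (blin X Y) (D1 (0 + h) - D1 0 - D2 0 h) \<le> 1 * nrm X h"
    using F(3)[OF 0] unfolding has_frechet_def by (meson zero_less_one)
  define M where "M = 1 + nrm (blin X (blin X Y)) (D2 0)"
  have M0: "0 \<le> M" using seminormedD(2)[OF seminormed_blin[OF X L] D2] by (simp add: M_def)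
  have lip: "nrm (blin X Y) (D1 h - D1 0) \<le> M * nrm X h" if h: "h \<in> pts X" "nrm X h < \<delta>1" "nrm X h < \<rho>" for h
  proof -
    have m: "D1 h - D1 0 - D2 0 h \<in> pts (blin X Y)" "D2 0 h \<in> pts (blin X Y)"
      using LD(7) D1 h 0 blinD(1)[OF D2 h(1)] by blast+
    have "nrm (blin X Y) ((D1 h - D1 0 - D2 0 h) + D2 0 h) \<le> nrm (blin X Y) (D1 h - D1 0 - D2 0 h) + nrm (blin X Y) (D2 0 h)"
      by (rule LD(4)[OF m])
    also have "\<dots> \<le> nrm X h + nrm (blin X (blin X Y)) (D2 0) * nrm X h"
      using d1[OF h(1,2)] blin_apply[OF X L D2 h(1)] by simp
    finally show ?thesis by (simp add: M_def algebra_simps)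
  qed
  define \<delta> where "\<delta> = min \<rho> \<delta>1 / 2"
  have \<delta>: "\<delta> > 0" using \<rho> \<delta>1 by (simp add: \<delta>_def)
  have main: "F (2 *\<^sub>R h) \<in> pts Y \<and> F h \<in> pts Y \<and> F 0 \<in> pts Y \<and>
           nrm Y (F (2 *\<^sub>R h) - F h - (F h - F 0)) \<le> (3 * M + 2) * (nrm X h)\<^sup>2"
    if h: "h \<in> pts X" "nrm X h < \<delta>" for h
  proof -
    define n where "n = nrm X h"
    have n0: "0 \<le> n" using XD(2)[OF h(1)] by (simp add: n_def)
    have th: "t *\<^sub>R h \<in> pts X" "nrm X (t *\<^sub>R h) \<le> \<bar>t\<bar> * n" for t
      using XD(5,6)[OF h(1)] by (auto simp: n_def)
    have small: "nrm X (t *\<^sub>R h) < \<rho>" "nrm X (t *\<^sub>R h) < \<delta>1" if "0 \<le> t" "t \<le> 2" for t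
    proof -
      have "nrm X (t *\<^sub>R h) \<le> t * n" using th(2)[of t] that by simp
      also have "\<dots> \<le> 2 * n" using that n0 by (intro mult_right_mono)
      also have "\<dots> < 2 * \<delta>" using h(2) by (simp add: n_def)
      finally show "nrm X (t *\<^sub>R h) < \<rho>" "nrm X (t *\<^sub>R h) < \<delta>1" by (auto simp: \<delta>_def)
    qed
    have FY: "F (t *\<^sub>R h) \<in> pts Y" and D1Y: "D1 (t *\<^sub>R h) \<in> pts (blin X Y)" if "0 \<le> t" "t \<le> 2" for t
      using F(1) D1 th(1) small(1)[OF that] by auto
    have dir: "\<exists>d>0. \<forall>s. \<bar>s\<bar> < d \<longrightarrow> nrm Y (F ((t + s) *\<^sub>R h) - F (t *\<^sub>R h) - s *\<^sub>R D1 (t *\<^sub>R h) h) \<le> e * n * \<bar>s\<bar>"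
      if t: "0 \<le> t" "t \<le> 2" and e: "e > 0" for t e
    proof -
      obtain d where d: "d > 0" "\<And>k. k \<in> pts X \<Longrightarrow> nrm X k < d \<Longrightarrow>
          nrm Y (F (t *\<^sub>R h + k) - F (t *\<^sub>R h) - D1 (t *\<^sub>R h) k) \<le> e * nrm X k"
        using F(2)[OF th(1) small(1)[OF t]] e unfolding has_frechet_def by blast
      have "nrm Y (F ((t + s) *\<^sub>R h) - F (t *\<^sub>R h) - s *\<^sub>R D1 (t *\<^sub>R h) h) \<le> e * n * \<bar>s\<bar>"
        if s: "\<bar>s\<bar> < d / (n + 1)" for s
      proof -
        have "\<bar>s\<bar> * n \<le> \<bar>s\<bar> * (n + 1)" using n0 by (intro mult_left_mono) auto
        also have "\<dots> < d" using s n0 by (simp add: pos_less_divide_eq)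
        finally have "nrm X (s *\<^sub>R h) < d" using th(2)[of s] by linarith
        from d(2)[OF th(1) this]
        have "nrm Y (F ((t + s) *\<^sub>R h) - F (t *\<^sub>R h) - s *\<^sub>R D1 (t *\<^sub>R h) h) \<le> e * nrm X (s *\<^sub>R h)"
          using blinD(5)[OF D1Y[OF t] h(1)] by (simp add: scaleR_add_left)
        also have "\<dots> \<le> e * (\<bar>s\<bar> * n)" using th(2)[of s] e by (intro mult_left_mono) auto
        finally show ?thesis by (simp add: mult_ac)
      qed
      moreover have "d / (n + 1) > 0" using d n0 by simp
      ultimately show ?thesis by blast
    qed
    \<comment> \<open>The tolerance for the first-order expansions of \<open>F\<close>. It has to be positive, and is chosen with
      \<open>e * n = n\<^sup>2\<close> in both cases, so that the errors have the size of the claimed bound.\<close>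
    define e where "e = (if n = 0 then 1 else n)"
    have e: "e > 0" "e * n = n\<^sup>2" using n0 by (auto simp: e_def power2_eq_square)
    define G where "G t = F ((1 + t) *\<^sub>R h) - F (t *\<^sub>R h)" for t
    have GY: "G t \<in> pts Y" if "0 \<le> t" "t \<le> 1" for t unfolding G_def using that by (intro YD(7) FY) auto
    define C where "C = (3 * M + 2) * n\<^sup>2"
    have step: "\<exists>d>0. \<forall>s. \<bar>s\<bar> < d \<longrightarrow> 0 \<le> t + s \<longrightarrow> t + s \<le> 1 \<longrightarrow> nrm Y (G (t + s) - G t) \<le> C * \<bar>s\<bar>"
      if t: "0 \<le> t" "t \<le> 1" for t
    proof -
      have t': "0 \<le> 1 + t" "1 + t \<le> 2" "t \<le> 2" using t by auto
      obtain da where da: "da > 0" "\<And>s. \<bar>s\<bar> < da \<Longrightarrow> nrm Y (F ((t + s) *\<^sub>R h) - F (t *\<^sub>R h) - s *\<^sub>R D1 (t *\<^sub>R h) h) \<le> e * n * \<bar>s\<bar>"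
        using dir[OF t(1) t'(3) e(1)] by blast
      obtain db where db: "db > 0" "\<And>s. \<bar>s\<bar> < db \<Longrightarrow> nrm Y (F ((1 + t + s) *\<^sub>R h) - F ((1 + t) *\<^sub>R h) - s *\<^sub>R D1 ((1 + t) *\<^sub>R h) h) \<le> e * n * \<bar>s\<bar>"
        using dir[OF t'(1,2) e(1)] by blast
      have "nrm Y (G (t + s) - G t) \<le> C * \<bar>s\<bar>" if s: "\<bar>s\<bar> < da" "\<bar>s\<bar> < db" "0 \<le> t + s" "t + s \<le> 1" for s
      proof -
        let ?A = "D1 ((1 + t) *\<^sub>R h)" and ?B = "D1 (t *\<^sub>R h)"
        let ?ra = "F ((t + s) *\<^sub>R h) - F (t *\<^sub>R h) - s *\<^sub>R ?B h"
        let ?rb = "F ((1 + t + s) *\<^sub>R h) - F ((1 + t) *\<^sub>R h) - s *\<^sub>R ?A h"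
        have AB: "?A \<in> pts (blin X Y)" "?B \<in> pts (blin X Y)" "D1 0 \<in> pts (blin X Y)" using D1Y t t' D1[OF 0] by auto
        have ABh: "?A h \<in> pts Y" "?B h \<in> pts Y" using blinD(1) AB h by blast+
        have rY: "?ra \<in> pts Y" "?rb \<in> pts Y" using FY t t' s ABh by (auto intro!: YD(7) YD(5))
        have "nrm (blin X Y) (?A - ?B) = nrm (blin X Y) ((?A - D1 0) - (?B - D1 0))" by simp
        also have "\<dots> \<le> nrm (blin X Y) (?A - D1 0) + nrm (blin X Y) (?B - D1 0)"
          by (intro LD(8) LD(7) AB)
        also have "\<dots> \<le> M * nrm X ((1 + t) *\<^sub>R h) + M * nrm X (t *\<^sub>R h)"
          using t t' by (intro add_mono lip small th) auto
        also have "\<dots> \<le> M * (2 * n) + M * n"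
        proof (intro add_mono mult_left_mono M0)
          show "nrm X ((1 + t) *\<^sub>R h) \<le> 2 * n" using th(2)[of "1 + t"] t mult_right_mono[of "1 + t" 2 n] n0 by simp
          show "nrm X (t *\<^sub>R h) \<le> n" using th(2)[of t] t mult_right_mono[of t 1 n] n0 by simp
        qed
        finally have AB3: "nrm (blin X Y) (?A - ?B) \<le> 3 * M * n" by simp
        have "nrm Y ((?A - ?B) h) \<le> nrm (blin X Y) (?A - ?B) * n"
          unfolding n_def by (rule blin_apply[OF X Y LD(7)[OF AB(1,2)] h(1)])
        also have "\<dots> \<le> 3 * M * n * n" by (rule mult_right_mono[OF AB3 n0])
        finally have d: "nrm Y (?A h - ?B h) \<le> 3 * M * n\<^sup>2" by (simp add: power2_eq_square mult.assoc fun_diff_def)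
        have eq: "G (t + s) - G t = s *\<^sub>R (?A h - ?B h) + (?rb - ?ra)"
          unfolding G_def by (simp add: scaleR_diff_right algebra_simps)
        have "nrm Y (G (t + s) - G t) \<le> nrm Y (s *\<^sub>R (?A h - ?B h)) + nrm Y (?rb - ?ra)"
          unfolding eq by (rule YD(4)) (intro YD(5) YD(7) ABh rY)+
        also have "\<dots> \<le> \<bar>s\<bar> * (3 * M * n\<^sup>2) + (n\<^sup>2 * \<bar>s\<bar> + n\<^sup>2 * \<bar>s\<bar>)"
        proof (rule add_mono)
          show "nrm Y (s *\<^sub>R (?A h - ?B h)) \<le> \<bar>s\<bar> * (3 * M * n\<^sup>2)"
            using YD(6)[OF YD(7)[OF ABh], of s] mult_left_mono[OF d, of "\<bar>s\<bar>"] by simp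
          have "nrm Y (?rb - ?ra) \<le> nrm Y ?rb + nrm Y ?ra" by (rule YD(8)[OF rY(2,1)])
          also have "\<dots> \<le> n\<^sup>2 * \<bar>s\<bar> + n\<^sup>2 * \<bar>s\<bar>"
            using da(2)[OF s(1)] db(2)[OF s(2)] unfolding e(2) by (rule add_mono[rotated])
          finally show "nrm Y (?rb - ?ra) \<le> n\<^sup>2 * \<bar>s\<bar> + n\<^sup>2 * \<bar>s\<bar>" .
        qed
        also have "\<dots> = C * \<bar>s\<bar>" by (simp add: C_def algebra_simps)
        finally show ?thesis .
      qed
      then show ?thesis using da(1) db(1) by (intro exI[of _ "min da db"]) auto
    qed
    have "0 \<le> (0::real) \<and> (1::real) \<le> 1 \<longrightarrow> nrm Y (G 1 - G 0) \<le> C * (1 - 0)"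
    proof (rule Bolzano[where P="\<lambda>a b. 0 \<le> a \<and> b \<le> 1 \<longrightarrow> nrm Y (G b - G a) \<le> C * (b - a)"])
      show "(0::real) \<le> 1" by simp
      fix a b c :: real
      assume 1: "0 \<le> a \<and> b \<le> 1 \<longrightarrow> nrm Y (G b - G a) \<le> C * (b - a)"
        and 2: "0 \<le> b \<and> c \<le> 1 \<longrightarrow> nrm Y (G c - G b) \<le> C * (c - b)" and 3: "a \<le> b" "b \<le> c"
      show "0 \<le> a \<and> c \<le> 1 \<longrightarrow> nrm Y (G c - G a) \<le> C * (c - a)"
      proof
        assume ac: "0 \<le> a \<and> c \<le> 1"
        have "nrm Y ((G c - G b) + (G b - G a)) \<le> nrm Y (G c - G b) + nrm Y (G b - G a)"
          using ac 3 by (intro YD(4) YD(7) GY) auto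
        also have "\<dots> \<le> C * (c - b) + C * (b - a)" using 1 2 3 ac by auto
        finally show "nrm Y (G c - G a) \<le> C * (c - a)" by (simp add: algebra_simps)
      qed
    next
      fix t :: real assume t: "0 \<le> t" "t \<le> 1"
      obtain d where d: "d > 0" "\<And>s. \<bar>s\<bar> < d \<Longrightarrow> 0 \<le> t + s \<Longrightarrow> t + s \<le> 1 \<Longrightarrow> nrm Y (G (t + s) - G t) \<le> C * \<bar>s\<bar>"
        using step[OF t] by blast
      have "nrm Y (G b - G a) \<le> C * (b - a)" if ab: "a \<le> t \<and> t \<le> b \<and> b - a < d" "0 \<le> a \<and> b \<le> 1" for a b
      proof -
        have "nrm Y ((G b - G t) - (G a - G t)) \<le> nrm Y (G b - G t) + nrm Y (G a - G t)"
          using ab t by (intro YD(8) YD(7) GY) auto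
        also have "\<dots> \<le> C * (b - t) + C * (t - a)"
          using d(2)[of "b - t"] d(2)[of "a - t"] ab by (intro add_mono) auto
        finally show ?thesis by (simp add: algebra_simps)
      qed
      then show "\<exists>d>0. \<forall>a b. a \<le> t \<and> t \<le> b \<and> b - a < d \<longrightarrow> (0 \<le> a \<and> b \<le> 1 \<longrightarrow> nrm Y (G b - G a) \<le> C * (b - a))"
        using d(1) by blast
    qed
    then have "nrm Y (G 1 - G 0) \<le> C" by simp
    then show ?thesis
      using FY[of 2] FY[of 1] FY[of 0] by (simp add: G_def C_def n_def)
  qed
  then show ?thesis using \<delta> by blast
qed

section \<open>Sobolev spaces are seminormed spaces\<close>

text \<open>
  Minkowski's inequality, from \<open>\<bar>f + g\<bar>\<^sup>2 \<le> (1 + \<tau>) \<bar>f\<bar>\<^sup>2 + (1 + 1 / \<tau>) \<bar>g\<bar>\<^sup>2\<close> with the optimal \<open>\<tau> = B / A\<close>,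
  where \<open>A\<close> and \<open>B\<close> are the two norms. Adding \<open>d\<close> to both keeps \<open>\<tau>\<close> positive and finite when one of them is 0.
\<close>

lemma weighted_L2_triangle:
  fixes f g :: "'a \<Rightarrow> complex" and w :: "'a \<Rightarrow> real"
  assumes [measurable]: "f \<in> borel_measurable M" "g \<in> borel_measurable M" "w \<in> borel_measurable M"
    and w: "\<And>x. 0 \<le> w x"
    and f: "integrable M (\<lambda>x. w x * (norm (f x))\<^sup>2)" and g: "integrable M (\<lambda>x. w x * (norm (g x))\<^sup>2)"
  shows "integrable M (\<lambda>x. w x * (norm (f x + g x))\<^sup>2)"
    and "sqrt (\<integral>x. w x * (norm (f x + g x))\<^sup>2 \<partial>M) \<le> sqrt (\<integral>x. w x * (norm (f x))\<^sup>2 \<partial>M) + sqrt (\<integral>x. w x * (norm (g x))\<^sup>2 \<partial>M)"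
proof -
  have young: "w x * (norm (f x + g x))\<^sup>2 \<le> (1 + \<tau>) * (w x * (norm (f x))\<^sup>2) + (1 + 1 / \<tau>) * (w x * (norm (g x))\<^sup>2)"
    if \<tau>: "\<tau> > 0" for x \<tau>
  proof -
    define a b where "a = norm (f x)" and "b = norm (g x)"
    have "(norm (f x + g x))\<^sup>2 \<le> (a + b)\<^sup>2"
      unfolding a_def b_def by (intro power_mono norm_triangle_ineq) auto
    also have "(a + b)\<^sup>2 \<le> (1 + \<tau>) * a\<^sup>2 + (1 + 1 / \<tau>) * b\<^sup>2"
    proof -
      have "0 \<le> (\<tau> * a - b)\<^sup>2 / \<tau>" using \<tau> by simp
      also have "(\<tau> * a - b)\<^sup>2 / \<tau> = (1 + \<tau>) * a\<^sup>2 + (1 + 1 / \<tau>) * b\<^sup>2 - (a + b)\<^sup>2"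
        using \<tau> by (simp add: power2_eq_square field_simps)
      finally show ?thesis by simp
    qed
    finally have "w x * (norm (f x + g x))\<^sup>2 \<le> w x * ((1 + \<tau>) * a\<^sup>2 + (1 + 1 / \<tau>) * b\<^sup>2)"
      by (rule mult_left_mono) (rule w)
    then show ?thesis by (simp add: a_def b_def algebra_simps)
  qed
  have bnd: "integrable M (\<lambda>x. (1 + \<tau>) * (w x * (norm (f x))\<^sup>2) + (1 + 1 / \<tau>) * (w x * (norm (g x))\<^sup>2))" for \<tau>
    by (intro Bochner_Integration.integrable_add integrable_mult_right f g)
  show i: "integrable M (\<lambda>x. w x * (norm (f x + g x))\<^sup>2)"
    by (rule Bochner_Integration.integrable_bound[OF bnd[of 1]])
      (use order_trans[OF young[of 1] abs_ge_self] w in auto)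
  define A B where "A = sqrt (\<integral>x. w x * (norm (f x))\<^sup>2 \<partial>M)" and "B = sqrt (\<integral>x. w x * (norm (g x))\<^sup>2 \<partial>M)"
  have A: "0 \<le> A" "(\<integral>x. w x * (norm (f x))\<^sup>2 \<partial>M) = A\<^sup>2" and B: "0 \<le> B" "(\<integral>x. w x * (norm (g x))\<^sup>2 \<partial>M) = B\<^sup>2"
    unfolding A_def B_def using w by (auto intro!: Bochner_Integration.integral_nonneg)
  have "sqrt (\<integral>x. w x * (norm (f x + g x))\<^sup>2 \<partial>M) \<le> A + B + 2 * d" if d: "d > 0" for d
  proof -
    define \<tau> where "\<tau> = (B + d) / (A + d)"
    have \<tau>: "\<tau> > 0" using A B d by (simp add: \<tau>_def add_nonneg_pos)
    have "(\<integral>x. w x * (norm (f x + g x))\<^sup>2 \<partial>M) \<le> (\<integral>x. (1 + \<tau>) * (w x * (norm (f x))\<^sup>2) + (1 + 1 / \<tau>) * (w x * (norm (g x))\<^sup>2) \<partial>M)"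
      by (rule integral_mono[OF i bnd young[OF \<tau>]])
    also have "\<dots> = (1 + \<tau>) * A\<^sup>2 + (1 + 1 / \<tau>) * B\<^sup>2"
      using f g by (simp add: A B)
    also have "(1 + \<tau>) * A\<^sup>2 \<le> (A + B + 2 * d) * A"
    proof -
      have "1 + \<tau> = (A + B + 2 * d) / (A + d)" using A d by (simp add: \<tau>_def field_simps)
      moreover have "A\<^sup>2 / (A + d) \<le> A" using A d by (simp add: pos_divide_le_eq power2_eq_square algebra_simps)
      ultimately show ?thesis using A B d mult_left_mono[of "A\<^sup>2 / (A + d)" A "A + B + 2 * d"] by simp
    qed
    also have "(1 + 1 / \<tau>) * B\<^sup>2 \<le> (A + B + 2 * d) * B"
    proof -
      have "1 + 1 / \<tau> = (A + B + 2 * d) / (B + d)" using A B d by (simp add: \<tau>_def field_simps)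
      moreover have "B\<^sup>2 / (B + d) \<le> B" using B d by (simp add: pos_divide_le_eq power2_eq_square algebra_simps)
      ultimately show ?thesis using A B d mult_left_mono[of "B\<^sup>2 / (B + d)" B "A + B + 2 * d"] by simp
    qed
    also have "(A + B + 2 * d) * A + (A + B + 2 * d) * B \<le> (A + B + 2 * d)\<^sup>2"
    proof -
      have "(A + B + 2 * d) * A + (A + B + 2 * d) * B = (A + B + 2 * d) * (A + B)" by (simp add: algebra_simps)
      also have "\<dots> \<le> (A + B + 2 * d) * (A + B + 2 * d)" using A B d by (intro mult_left_mono) auto
      finally show ?thesis by (simp add: power2_eq_square)
    qed
    finally have "(\<integral>x. w x * (norm (f x + g x))\<^sup>2 \<partial>M) \<le> (A + B + 2 * d)\<^sup>2" by simp
    then show ?thesis using A B d by (intro real_le_lsqrt) auto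
  qed
  from this[of "e / 2" for e] have "sqrt (\<integral>x. w x * (norm (f x + g x))\<^sup>2 \<partial>M) \<le> A + B + e" if "e > 0" for e
    using that by simp
  then show "sqrt (\<integral>x. w x * (norm (f x + g x))\<^sup>2 \<partial>M) \<le> sqrt (\<integral>x. w x * (norm (f x))\<^sup>2 \<partial>M) + sqrt (\<integral>x. w x * (norm (g x))\<^sup>2 \<partial>M)"
    unfolding A_def B_def by (rule field_le_epsilon)
qed

abbreviation wsq :: "real \<Rightarrow> real \<Rightarrow> complex \<Rightarrow> real" where
  "wsq s \<xi> z \<equiv> (1 + \<xi>\<^sup>2) powr s * (norm z)\<^sup>2"

lemma weight_measurable: "(\<lambda>\<xi>::real. (1 + \<xi>\<^sup>2) powr s) \<in> borel_measurable lebesgue"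
  by (rule measurable_completion) measurable

lemma tempered_lincomb:
  assumes "tempered f" "tempered g" shows "tempered (a *\<^sub>R f + b *\<^sub>R g)"
  unfolding tempered_def
proof (intro conjI allI impI)
  note d = assms[unfolded tempered_def]
  have app: "(a *\<^sub>R f + b *\<^sub>R g) \<phi> = a *\<^sub>R f \<phi> + b *\<^sub>R g \<phi>" for \<phi> by (simp add: plus_fun_def scaleR_fun_def)
  show "(a *\<^sub>R f + b *\<^sub>R g) \<phi> = 0" if "\<not> schwartz \<phi>" for \<phi> unfolding app using d that by simp
  show "(a *\<^sub>R f + b *\<^sub>R g) (\<lambda>x. c * \<phi> x + c' * \<psi> x) = c * (a *\<^sub>R f + b *\<^sub>R g) \<phi> + c' * (a *\<^sub>R f + b *\<^sub>R g) \<psi>"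
    if "schwartz \<phi>" "schwartz \<psi>" for \<phi> \<psi> c c'
    unfolding app using d that by (simp add: scaleR_conv_of_real algebra_simps)
  let ?S = "\<lambda>N \<phi>. \<Sum>k\<le>N. \<Sum>n\<le>N. schwartz_seminorm k n \<phi>"
  obtain K N where K: "\<And>\<phi>. schwartz \<phi> \<Longrightarrow> norm (f \<phi>) \<le> K * ?S N \<phi>" using d by blast
  obtain K' N' where K': "\<And>\<phi>. schwartz \<phi> \<Longrightarrow> norm (g \<phi>) \<le> K' * ?S N' \<phi>" using d by blast
  have up: "K * ?S N \<phi> \<le> \<bar>K\<bar> * ?S N' \<phi>" if s: "schwartz \<phi>" and N: "N \<le> N'" for \<phi> K N N'
  proof -
    note nn = schwartz_seminorm_nonneg[OF s]
    have "K * ?S N \<phi> \<le> \<bar>K\<bar> * ?S N \<phi>" by (intro mult_right_mono sum_nonneg nn) auto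
    also have "?S N \<phi> \<le> (\<Sum>k\<le>N'. \<Sum>n\<le>N. schwartz_seminorm k n \<phi>)"
      using N by (intro sum_mono2 sum_nonneg nn) auto
    also have "\<dots> \<le> ?S N' \<phi>" using N by (intro sum_mono sum_mono2 nn) auto
    finally show ?thesis by (simp add: mult_left_mono)
  qed
  have "norm ((a *\<^sub>R f + b *\<^sub>R g) \<phi>) \<le> (\<bar>a\<bar> * \<bar>K\<bar> + \<bar>b\<bar> * \<bar>K'\<bar>) * ?S (max N N') \<phi>" if s: "schwartz \<phi>" for \<phi>
  proof -
    have "norm ((a *\<^sub>R f + b *\<^sub>R g) \<phi>) \<le> \<bar>a\<bar> * norm (f \<phi>) + \<bar>b\<bar> * norm (g \<phi>)"
      unfolding app by (rule norm_triangle_le) simp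
    also have "\<dots> \<le> \<bar>a\<bar> * (\<bar>K\<bar> * ?S (max N N') \<phi>) + \<bar>b\<bar> * (\<bar>K'\<bar> * ?S (max N N') \<phi>)"
      by (intro add_mono mult_left_mono order_trans[OF K[OF s] up[OF s]] order_trans[OF K'[OF s] up[OF s]]) auto
    finally show ?thesis by (simp add: distrib_right mult.assoc)
  qed
  then show "\<exists>K N. \<forall>\<phi>. schwartz \<phi> \<longrightarrow> norm ((a *\<^sub>R f + b *\<^sub>R g) \<phi>) \<le> K * ?S N \<phi>" by blast
qed

lemma regular_fhat:
  assumes "regular (fourier f)"
  shows "tempered_fun (fhat f)" "fourier f = dist_of (fhat f)"
proof -
  obtain g where g: "tempered_fun g" "fourier f = dist_of g" using assms unfolding regular_def by blast
  show "tempered_fun (fhat f)" "fourier f = dist_of (fhat f)"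
    unfolding fhat_def g(2) using fun_of_dist_of[OF g(1)] by auto
qed

text \<open>
  The function \<open>fhat\<close> is a chosen representative, so it is linear only almost everywhere.
\<close>

lemma fhat_lincomb:
  assumes "regular (fourier f)" "regular (fourier g)"
  shows "regular (fourier (a *\<^sub>R f + b *\<^sub>R g))"
    "AE \<xi> in lebesgue. fhat (a *\<^sub>R f + b *\<^sub>R g) \<xi> = of_real a * fhat f \<xi> + of_real b * fhat g \<xi>"
proof -
  note f = regular_fhat[OF assms(1)] and g = regular_fhat[OF assms(2)]
  let ?h = "\<lambda>\<xi>. of_real a * fhat f \<xi> + of_real b * fhat g \<xi>"
  have t: "tempered_fun ?h" by (rule tempered_fun_lincomb[OF f(1) g(1)])
  have eq: "fourier (a *\<^sub>R f + b *\<^sub>R g) = dist_of ?h"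
  proof
    fix \<phi>
    show "fourier (a *\<^sub>R f + b *\<^sub>R g) \<phi> = dist_of ?h \<phi>"
    proof (cases "schwartz \<phi>")
      case True
      have i: "integrable lebesgue (\<lambda>x. fhat f x * \<phi> x)" "integrable lebesgue (\<lambda>x. fhat g x * \<phi> x)"
        using tempered_fun_schwartz_integrable f g True by auto
      have "dist_of ?h \<phi> = (LINT x|lebesgue. of_real a * (fhat f x * \<phi> x) + of_real b * (fhat g x * \<phi> x))"
        using True by (simp add: dist_of_def algebra_simps)
      also have "\<dots> = of_real a * dist_of (fhat f) \<phi> + of_real b * dist_of (fhat g) \<phi>"
        using i True by (simp add: dist_of_def)
      also have "\<dots> = of_real a * fourier f \<phi> + of_real b * fourier g \<phi>" using f(2) g(2) by simp
      finally show ?thesis using True by (simp add: fourier_def plus_fun_def scaleR_fun_def scaleR_conv_of_real)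
    qed (simp add: fourier_def dist_of_def)
  qed
  show "regular (fourier (a *\<^sub>R f + b *\<^sub>R g))" unfolding eq regular_def using t by blast
  show "AE \<xi> in lebesgue. fhat (a *\<^sub>R f + b *\<^sub>R g) \<xi> = ?h \<xi>"
    unfolding fhat_def[of "a *\<^sub>R f + b *\<^sub>R g"] eq using fun_of_dist_of[OF t] by auto
qed

lemma nrm_Hs_cong:
  assumes "AE \<xi> in lebesgue. fhat f \<xi> = h \<xi>" "fhat f \<in> borel_measurable lebesgue" "h \<in> borel_measurable lebesgue"
  shows "integrable lebesgue (\<lambda>\<xi>. wsq s \<xi> (fhat f \<xi>)) \<longleftrightarrow> integrable lebesgue (\<lambda>\<xi>. wsq s \<xi> (h \<xi>))"
    "nrm (Hs s) f = sqrt (LINT \<xi>|lebesgue. wsq s \<xi> (h \<xi>))"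
proof -
  note [measurable] = assms(2,3) weight_measurable
  have ae: "AE \<xi> in lebesgue. wsq s \<xi> (fhat f \<xi>) = wsq s \<xi> (h \<xi>)"
    using assms(1) by eventually_elim simp
  show "integrable lebesgue (\<lambda>\<xi>. wsq s \<xi> (fhat f \<xi>)) \<longleftrightarrow> integrable lebesgue (\<lambda>\<xi>. wsq s \<xi> (h \<xi>))"
    by (rule integrable_cong_AE[OF _ _ ae]) measurable
  have "(LINT \<xi>|lebesgue. wsq s \<xi> (fhat f \<xi>)) = (LINT \<xi>|lebesgue. wsq s \<xi> (h \<xi>))"
    by (rule integral_cong_AE[OF _ _ ae]) measurable
  then show "nrm (Hs s) f = sqrt (LINT \<xi>|lebesgue. wsq s \<xi> (h \<xi>))"
    by (simp add: Hs_def)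
qed

theorem seminormed_Hs: "seminormed (Hs s)"
  unfolding seminormed_def
proof (intro conjI ballI allI)
  have i: "integrable lborel (\<lambda>_::real. 0 :: complex)" by simp
  have "dist_of (ift (\<lambda>_. 0)) \<in> pts (Hs s)"
    using nrm_Hs_cong(1)[OF fhat_ift(1)[OF i] fhat_ift(2)[OF i], of s] tempered_ift[OF i] fourier_ift[OF i]
      integrable_tempered_fun[OF i] unfolding Hs_def by (auto simp: regular_def)
  moreover have "dist_of (ift (\<lambda>_. 0)) = 0"
    by (rule ext) (simp add: dist_of_def ift_def)
  ultimately show "0 \<in> pts (Hs s)" by simp
  fix f assume f: "f \<in> pts (Hs s)"
  show "0 \<le> nrm (Hs s) f" by (simp add: Hs_def)
  fix g and a b :: real assume g: "g \<in> pts (Hs s)"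
  note d = f[unfolded Hs_def fst_conv mem_Collect_eq] g[unfolded Hs_def fst_conv mem_Collect_eq]
  have r: "regular (fourier f)" "regular (fourier g)" using d by auto
  note lc = fhat_lincomb[OF r, of a b]
  have [measurable]: "fhat f \<in> borel_measurable lebesgue" "fhat g \<in> borel_measurable lebesgue"
      "fhat (a *\<^sub>R f + b *\<^sub>R g) \<in> borel_measurable lebesgue"
    using regular_fhat r lc(1) tempered_fun_measurable by auto
  have sc: "wsq s \<xi> (of_real a * z) = a\<^sup>2 * wsq s \<xi> z" for a \<xi> z by (simp add: norm_mult power_mult_distrib)
  have n: "sqrt (LINT \<xi>|lebesgue. wsq s \<xi> (of_real a * fhat f \<xi>)) = \<bar>a\<bar> * nrm (Hs s) f" for a f
    unfolding sc by (simp add: Hs_def real_sqrt_mult)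
  have ii: "integrable lebesgue (\<lambda>\<xi>. wsq s \<xi> (of_real a * fhat f \<xi>))" "integrable lebesgue (\<lambda>\<xi>. wsq s \<xi> (of_real b * fhat g \<xi>))"
    unfolding sc using d by auto
  note tri = weighted_L2_triangle[OF _ _ weight_measurable _ ii]
  note c = nrm_Hs_cong[OF lc(2), of s]
  show "a *\<^sub>R f + b *\<^sub>R g \<in> pts (Hs s)"
    using d lc(1) c(1) tri(1) by (simp add: Hs_def tempered_lincomb)
  show "nrm (Hs s) (a *\<^sub>R f + b *\<^sub>R g) \<le> \<bar>a\<bar> * nrm (Hs s) f + \<bar>b\<bar> * nrm (Hs s) g"
    using c(2) tri(2) unfolding n by simp
qed

text \<open>
  The norm is continuous along \<open>u\<close> on a compact interval. This boundedness is what makes the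
  supremum in the norm of \<open>CHs\<close> an upper bound.
\<close>

lemma CHs_bdd:
  assumes "u \<in> pts (CHs s T)" shows "bdd_above ((\<lambda>t. nrm (Hs s) (u t)) ` {0..T})"
proof -
  note D = seminormedD[OF seminormed_Hs[of s]]
  have u: "u t \<in> pts (Hs s)" if "t \<in> {0..T}" for t using assms that by (auto simp: CHs_def)
  have "continuous_on {0..T} (\<lambda>t. nrm (Hs s) (u t))"
    unfolding continuous_on_iff
  proof (intro ballI allI impI)
    fix t and e :: real assume t: "t \<in> {0..T}" and e: "e > 0"
    obtain d where d: "d > 0" "\<forall>t'\<in>{0..T}. \<bar>t' - t\<bar> < d \<longrightarrow> nrm (Hs s) (u t' - u t) < e"
    proof -
      have "\<forall>t\<in>{0..T}. \<forall>\<epsilon>>0. \<exists>\<delta>>0. \<forall>t'\<in>{0..T}. \<bar>t' - t\<bar> < \<delta> \<longrightarrow> nrm (Hs s) (u t' - u t) < \<epsilon>"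
        using assms unfolding CHs_def by simp
      then show ?thesis using t e that by blast
    qed
    have "dist (nrm (Hs s) (u t')) (nrm (Hs s) (u t)) < e" if t': "t' \<in> {0..T}" "dist t' t < d" for t'
    proof -
      have lt: "nrm (Hs s) (u t' - u t) < e" using d t' by (auto simp: dist_real_def)
      have "nrm (Hs s) ((u t' - u t) + u t) \<le> nrm (Hs s) (u t' - u t) + nrm (Hs s) (u t)"
        by (intro D(4) D(7) u t t')
      moreover have "nrm (Hs s) (u t' - (u t' - u t)) \<le> nrm (Hs s) (u t') + nrm (Hs s) (u t' - u t)"
        by (intro D(8) D(7) u t t')
      ultimately show ?thesis using lt by (simp add: dist_real_def abs_less_iff)
    qed
    then show "\<exists>d>0. \<forall>x'\<in>{0..T}. dist x' t < d \<longrightarrow> dist (nrm (Hs s) (u x')) (nrm (Hs s) (u t)) < e"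
      using d(1) by blast
  qed
  then have "bounded ((\<lambda>t. nrm (Hs s) (u t)) ` {0..T})"
    by (intro compact_imp_bounded compact_continuous_image) auto
  then show ?thesis by (rule bounded_imp_bdd_above)
qed

lemma CHs_upper:
  assumes "u \<in> pts (CHs s T)" "t \<in> {0..T}" shows "nrm (Hs s) (u t) \<le> nrm (CHs s T) u"
  using cSUP_upper[OF assms(2) CHs_bdd[OF assms(1)]] by (simp add: CHs_def)

lemma CHs_least:
  assumes "0 \<le> T" "\<And>t. t \<in> {0..T} \<Longrightarrow> nrm (Hs s) (u t) \<le> C" shows "nrm (CHs s T) u \<le> C"
  unfolding CHs_def snd_conv by (rule cSUP_least) (use assms in auto)

theorem seminormed_CHs:
  assumes T: "0 \<le> T" shows "seminormed (CHs s T)"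
  unfolding seminormed_def
proof (intro conjI ballI allI)
  note D = seminormedD[OF seminormed_Hs[of s]]
  have mem: "u t \<in> pts (Hs s)" "t \<notin> {0..T} \<Longrightarrow> u t = 0"
    "e > 0 \<Longrightarrow> \<exists>d>0. \<forall>t'\<in>{0..T}. \<bar>t' - t\<bar> < d \<longrightarrow> nrm (Hs s) (u t' - u t) < e"
    if "u \<in> pts (CHs s T)" "t \<in> {0..T}" for u t e
    using that by (auto simp: CHs_def)
  show "0 \<in> pts (CHs s T)"
    using D(1,9) by (auto simp: CHs_def zero_fun_def[symmetric] intro: exI[of _ 1])
  fix u assume u: "u \<in> pts (CHs s T)"
  show "0 \<le> nrm (CHs s T) u" using CHs_upper[OF u, of 0] D(2)[OF mem(1)[OF u], of 0] T by force
  fix v and a b :: real assume v: "v \<in> pts (CHs s T)"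
  have app: "(a *\<^sub>R u + b *\<^sub>R v) t = a *\<^sub>R u t + b *\<^sub>R v t" for t
    by (simp add: plus_fun_def[of "a *\<^sub>R u"] scaleR_fun_def[of a u] scaleR_fun_def[of b v])
  show "a *\<^sub>R u + b *\<^sub>R v \<in> pts (CHs s T)"
    unfolding CHs_def fst_conv mem_Collect_eq
  proof (intro conjI ballI allI impI)
    show "(a *\<^sub>R u + b *\<^sub>R v) t \<in> pts (Hs s)" if "t \<in> {0..T}" for t
      unfolding app by (intro D(11) mem(1) u v that)
    show "(a *\<^sub>R u + b *\<^sub>R v) t = 0" if "t \<notin> {0..T}" for t
      using u v that unfolding app by (auto simp: CHs_def)
    fix t and e :: real assume t: "t \<in> {0..T}" and e: "0 < e"
    define c where "c = \<bar>a\<bar> + \<bar>b\<bar> + 1"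
    have c: "c > 0" "e / c > 0" using e by (auto simp: c_def)
    obtain d where d: "d > 0" "\<And>t'. t' \<in> {0..T} \<Longrightarrow> \<bar>t' - t\<bar> < d \<Longrightarrow> nrm (Hs s) (u t' - u t) < e / c"
      using mem(3)[OF u t c(2)] by blast
    obtain d' where d': "d' > 0" "\<And>t'. t' \<in> {0..T} \<Longrightarrow> \<bar>t' - t\<bar> < d' \<Longrightarrow> nrm (Hs s) (v t' - v t) < e / c"
      using mem(3)[OF v t c(2)] by blast
    have "nrm (Hs s) ((a *\<^sub>R u + b *\<^sub>R v) t' - (a *\<^sub>R u + b *\<^sub>R v) t) < e" if t': "t' \<in> {0..T}" "\<bar>t' - t\<bar> < min d d'" for t'
    proof -
      have "(a *\<^sub>R u + b *\<^sub>R v) t' - (a *\<^sub>R u + b *\<^sub>R v) t = a *\<^sub>R (u t' - u t) + b *\<^sub>R (v t' - v t)"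
        unfolding app by (simp add: scaleR_diff_right)
      then have "nrm (Hs s) ((a *\<^sub>R u + b *\<^sub>R v) t' - (a *\<^sub>R u + b *\<^sub>R v) t)
          \<le> \<bar>a\<bar> * nrm (Hs s) (u t' - u t) + \<bar>b\<bar> * nrm (Hs s) (v t' - v t)"
        using D(10)[OF D(7)[OF mem(1)[OF u t'(1)] mem(1)[OF u t]] D(7)[OF mem(1)[OF v t'(1)] mem(1)[OF v t]]] by metis
      also have "\<dots> \<le> \<bar>a\<bar> * (e / c) + \<bar>b\<bar> * (e / c)"
        using d(2)[OF t'(1)] d'(2)[OF t'(1)] t'(2) by (intro add_mono mult_left_mono) auto
      also have "\<dots> < (\<bar>a\<bar> + \<bar>b\<bar> + 1) * (e / c)" using c(2) by (simp only: distrib_right)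
      also have "\<dots> = e" unfolding c_def[symmetric] using c by simp
      finally show ?thesis .
    qed
    then show "\<exists>d>0. \<forall>t'\<in>{0..T}. \<bar>t' - t\<bar> < d \<longrightarrow> nrm (Hs s) ((a *\<^sub>R u + b *\<^sub>R v) t' - (a *\<^sub>R u + b *\<^sub>R v) t) < e"
      using d(1) d'(1) by (intro exI[of _ "min d d'"]) auto
  qed
  show "nrm (CHs s T) (a *\<^sub>R u + b *\<^sub>R v) \<le> \<bar>a\<bar> * nrm (CHs s T) u + \<bar>b\<bar> * nrm (CHs s T) v"
  proof (rule CHs_least[OF T])
    fix t assume t: "t \<in> {0..T}"
    show "nrm (Hs s) ((a *\<^sub>R u + b *\<^sub>R v) t) \<le> \<bar>a\<bar> * nrm (CHs s T) u + \<bar>b\<bar> * nrm (CHs s T) v"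
      unfolding app
      by (rule order_trans[OF D(10)[OF mem(1)[OF u t] mem(1)[OF v t]]])
        (intro add_mono mult_left_mono CHs_upper[OF u t] CHs_upper[OF v t] abs_ge_zero)
  qed
qed

section \<open>The integral equation on the Fourier side\<close>

definition lor :: "real \<Rightarrow> real" where "lor \<xi> = 1 / (1 + \<xi>\<^sup>2)"

lemma lor_pos: "0 < lor \<xi>" and lor_le_1: "lor \<xi> \<le> 1" and abs_lor2_le: "\<bar>\<xi>\<bar> * (lor \<xi>)\<^sup>2 \<le> lor \<xi>"
proof -
  have p: "0 < 1 + \<xi>\<^sup>2" by (simp add: add_pos_nonneg)
  show 1: "0 < lor \<xi>" using p by (simp add: lor_def)
  show "lor \<xi> \<le> 1" using p by (simp add: lor_def)
  have "\<bar>\<xi>\<bar> \<le> 1 + \<xi>\<^sup>2"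
    using zero_le_power2[of "\<bar>\<xi>\<bar> - 1/2"] by (simp add: power2_eq_square algebra_simps)
  then have "\<bar>\<xi>\<bar> * lor \<xi> \<le> 1" using p by (simp add: lor_def)
  then have "(\<bar>\<xi>\<bar> * lor \<xi>) * lor \<xi> \<le> 1 * lor \<xi>" using 1 by (intro mult_right_mono) auto
  then show "\<bar>\<xi>\<bar> * (lor \<xi>)\<^sup>2 \<le> lor \<xi>" by (simp add: power2_eq_square mult.assoc)
qed

lemma lor_measurable [measurable]: "lor \<in> borel_measurable borel"
  unfolding lor_def by measurable

lemma lor_integrable: "integrable lborel lor" and lor_integral: "(LBINT \<xi>. lor \<xi>) = pi"
  unfolding lor_def using lorentz_integrable lorentz_integral by auto

lemma lor2_le_lor: "(lor \<xi>)\<^sup>2 \<le> lor \<xi>"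
  using lor_pos[of \<xi>] lor_le_1[of \<xi>] by (simp add: power2_eq_square mult_left_le)

lemma lor_reflect_integrable: "integrable lborel (\<lambda>\<eta>. lor (\<xi> - \<eta>))" and lor_reflect_integral: "(LBINT \<eta>. lor (\<xi> - \<eta>)) = pi"
  using lborel_integrable_real_affine[OF lor_integrable, of "-1" \<xi>]
    lborel_integral_real_affine[of "-1" lor \<xi>] lor_integral by auto

text \<open>
  One of \<open>\<eta>\<close> and \<open>\<xi> - \<eta>\<close> is at least half as large as \<open>\<xi>\<close>. In integrated form, the class of functions
  bounded by a multiple of \<open>lor\<close> is closed under convolution.
\<close>

lemma lor_mult_le: "lor \<eta> * lor (\<xi> - \<eta>) \<le> 2 * lor \<xi> * (lor \<eta> + lor (\<xi> - \<eta>))"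
proof -
  define a b d where "a = 1 + \<eta>\<^sup>2" and "b = 1 + (\<xi> - \<eta>)\<^sup>2" and "d = 1 + \<xi>\<^sup>2"
  have p: "0 < a" "0 < b" "0 < d" by (auto simp: a_def b_def d_def add_pos_nonneg)
  have "0 \<le> (\<eta> - (\<xi> - \<eta>))\<^sup>2" by simp
  then have "\<xi>\<^sup>2 \<le> 2 * \<eta>\<^sup>2 + 2 * (\<xi> - \<eta>)\<^sup>2" by (simp add: power2_eq_square algebra_simps)
  then have "d \<le> 2 * (a + b)" by (simp add: a_def b_def d_def)
  then have "1 / a * (1 / b) \<le> 2 * (1 / d) * (1 / a + 1 / b)"
    using p by (simp add: field_simps)
  then show ?thesis by (simp add: lor_def a_def b_def d_def)
qed

text \<open>
  The Fourier transform of the product of the derivatives of \<open>ift h\<close> and \<open>ift k\<close>.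
\<close>

definition nl :: "(real \<Rightarrow> complex) \<Rightarrow> (real \<Rightarrow> complex) \<Rightarrow> real \<Rightarrow> complex" where
  "nl h k \<xi> = of_real (1 / (2 * pi)) * conv (dsym h) (dsym k) \<xi>"

abbreviation nlint :: "(real \<Rightarrow> complex) \<Rightarrow> (real \<Rightarrow> complex) \<Rightarrow> real \<Rightarrow> real \<Rightarrow> complex" where
  "nlint h k \<xi> \<eta> \<equiv> (\<i> * of_real \<eta> * h \<eta>) * (\<i> * of_real (\<xi> - \<eta>) * k (\<xi> - \<eta>))"

text \<open>
  The crude bound \<open>\<bar>\<xi>\<bar> \<le> 1 + \<xi>\<^sup>2\<close> for the derivative costs a full factor \<open>lor\<close>, which is still what the
  Duhamel integral regains.
\<close>

lemma deriv_symbol_bound: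
  assumes "norm (h \<xi>) \<le> H * (lor \<xi>)\<^sup>2" "0 \<le> H" shows "norm (\<i> * of_real \<xi> * h \<xi>) \<le> H * lor \<xi>"
proof -
  have "norm (\<i> * of_real \<xi> * h \<xi>) = \<bar>\<xi>\<bar> * norm (h \<xi>)" by (simp add: norm_mult)
  also have "\<dots> \<le> \<bar>\<xi>\<bar> * (H * (lor \<xi>)\<^sup>2)" by (rule mult_left_mono[OF assms(1)]) simp
  also have "\<dots> \<le> H * lor \<xi>" using mult_left_mono[OF abs_lor2_le[of \<xi>] assms(2)] by (simp add: mult_ac)
  finally show ?thesis .
qed

lemma
  assumes [measurable]: "h \<in> borel_measurable borel" "k \<in> borel_measurable borel"
    and h: "\<And>\<xi>. norm (h \<xi>) \<le> H * (lor \<xi>)\<^sup>2" and k: "\<And>\<xi>. norm (k \<xi>) \<le> K * (lor \<xi>)\<^sup>2" and HK: "0 \<le> H" "0 \<le> K"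
  shows nl_integrand: "integrable lborel (\<lambda>\<eta>. nlint h k \<xi> \<eta>)"
    and nl_bound: "norm (nl h k \<xi>) \<le> 2 * H * K * lor \<xi>"
proof -
  let ?f = "\<lambda>\<eta>. nlint h k \<xi> \<eta>"
  let ?g = "\<lambda>\<eta>. (2 * H * K * lor \<xi>) * (lor \<eta> + lor (\<xi> - \<eta>))"
  have le: "norm (?f \<eta>) \<le> ?g \<eta>" for \<eta>
  proof -
    have "norm (?f \<eta>) \<le> (H * lor \<eta>) * (K * lor (\<xi> - \<eta>))"
      unfolding norm_mult[of "\<i> * of_real \<eta> * h \<eta>"]
      using HK lor_pos by (intro mult_mono deriv_symbol_bound h k) (auto intro: mult_nonneg_nonneg less_imp_le)
    also have "\<dots> = (H * K) * (lor \<eta> * lor (\<xi> - \<eta>))" by simp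
    also have "\<dots> \<le> (H * K) * (2 * lor \<xi> * (lor \<eta> + lor (\<xi> - \<eta>)))" using HK by (intro mult_left_mono lor_mult_le) auto
    finally show ?thesis by (simp add: mult_ac)
  qed
  have ig: "integrable lborel ?g"
    by (intro integrable_mult_right Bochner_Integration.integrable_add lor_integrable lor_reflect_integrable)
  show i: "integrable lborel ?f"
    by (rule Bochner_Integration.integrable_bound[OF ig]) (use order_trans[OF le abs_ge_self] in auto)
  have "norm (LBINT \<eta>. ?f \<eta>) \<le> (LBINT \<eta>. ?g \<eta>)"
    by (rule order_trans[OF integral_norm_bound integral_mono[OF integrable_norm[OF i] ig le]])
  also have "\<dots> = (2 * H * K * lor \<xi>) * (2 * pi)"
    by (simp only: integral_mult_right_zero Bochner_Integration.integral_add[OF lor_integrable lor_reflect_integrable] lor_integral lor_reflect_integral) simp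
  finally have "norm (conv (dsym h) (dsym k) \<xi>) \<le> (2 * H * K * lor \<xi>) * (2 * pi)"
    unfolding conv_def .
  then have "1 / (2 * pi) * norm (conv (dsym h) (dsym k) \<xi>) \<le> 1 / (2 * pi) * ((2 * H * K * lor \<xi>) * (2 * pi))"
    by (intro mult_left_mono) auto
  then show "norm (nl h k \<xi>) \<le> 2 * H * K * lor \<xi>"
    unfolding nl_def norm_mult norm_of_real by simp
qed

lemma measurable_uncurry:
  fixes w :: "real \<Rightarrow> real \<Rightarrow> complex"
  assumes "(\<lambda>(t, \<xi>). w t \<xi>) \<in> borel_measurable (borel \<Otimes>\<^sub>M borel)" "g \<in> borel_measurable M" "h \<in> borel_measurable M"
  shows "(\<lambda>x. w (g x) (h x)) \<in> borel_measurable M"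
  using measurable_compose[OF measurable_Pair[OF assms(2,3)] assms(1)] by simp

lemma nl_measurable:
  fixes w z :: "real \<Rightarrow> real \<Rightarrow> complex"
  assumes w: "(\<lambda>(t, \<xi>). w t \<xi>) \<in> borel_measurable (borel \<Otimes>\<^sub>M borel)"
    and z: "(\<lambda>(t, \<xi>). z t \<xi>) \<in> borel_measurable (borel \<Otimes>\<^sub>M borel)"
  shows "(\<lambda>(t, \<xi>). nl (w t) (z t) \<xi>) \<in> borel_measurable (borel \<Otimes>\<^sub>M borel)"
proof -
  note [measurable (raw)] = measurable_uncurry[OF w] measurable_uncurry[OF z]
  show ?thesis unfolding nl_def conv_def by measurable
qed

text \<open>
  The multiplier of the linear equation is \<open>exp (t m)\<close>. The bound on its real part contains all the
  dissipation that the construction of solutions uses.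
\<close>

locale duhamel =
  fixes m :: "real \<Rightarrow> complex" and T b c :: real
  assumes m_measurable [measurable]: "m \<in> borel_measurable borel"
    and m_bound: "\<And>\<xi>. Re (m \<xi>) \<le> b - c * (1 + \<xi>\<^sup>2)"
    and params: "0 < c" "0 \<le> b" "0 < T"
begin

text \<open>
  The balls of the iteration space: functions of time and frequency dominated by \<open>K (1 + \<xi>\<^sup>2)\<^sup>-\<^sup>2\<close> on the
  time interval.
\<close>

definition adm :: "real \<Rightarrow> (real \<Rightarrow> real \<Rightarrow> complex) \<Rightarrow> bool" where
  "adm K w \<longleftrightarrow> (\<lambda>(t, \<xi>). w t \<xi>) \<in> borel_measurable (borel \<Otimes>\<^sub>M borel) \<and> 0 \<le> K \<and>
     (\<forall>t\<in>{0..T}. \<forall>\<xi>. norm (w t \<xi>) \<le> K * (lor \<xi>)\<^sup>2)"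

abbreviation dint :: "(real \<Rightarrow> real \<Rightarrow> complex) \<Rightarrow> (real \<Rightarrow> real \<Rightarrow> complex) \<Rightarrow> real \<Rightarrow> real \<Rightarrow> real \<Rightarrow> complex" where
  "dint w z t \<xi> t' \<equiv> indicator {0..t} t' *\<^sub>R (exp (of_real (t - t') * m \<xi>) * nl (w t') (z t') \<xi>)"

text \<open>
  The bilinear Duhamel term. It is subtracted in the integral equation.
\<close>

definition duh :: "(real \<Rightarrow> real \<Rightarrow> complex) \<Rightarrow> (real \<Rightarrow> real \<Rightarrow> complex) \<Rightarrow> real \<Rightarrow> real \<Rightarrow> complex" where
  "duh w z t \<xi> = (LBINT t'. dint w z t \<xi> t')"

text \<open>
  A bound for the bilinear map \<open>duh\<close> on the spaces \<open>adm\<close>: the factor 2 comes from the convolution, the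
  rest from \<open>duh_bound\<close>.
\<close>

definition M :: real where "M = 2 * exp (b * T) / c"

lemma M_pos: "0 < M" using params by (simp add: M_def)

lemma norm_exp_m: "norm (exp (of_real t * m \<xi>)) \<le> exp (b * T) * exp (- (c * (1 + \<xi>\<^sup>2) * t))" if "t \<in> {0..T}"
proof -
  have "t * Re (m \<xi>) \<le> t * (b - c * (1 + \<xi>\<^sup>2))" using that by (intro mult_left_mono m_bound) auto
  also have "\<dots> \<le> b * T - c * (1 + \<xi>\<^sup>2) * t"
    using that params mult_left_mono[of t T b] by (simp add: algebra_simps)
  finally show ?thesis by (simp add: norm_exp_eq_Re exp_add[symmetric])
qed

lemma norm_exp_m': "norm (exp (of_real t * m \<xi>)) \<le> exp (b * T)" if "t \<in> {0..T}"
proof -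
  have "exp (- (c * (1 + \<xi>\<^sup>2) * t)) \<le> 1" using that params by simp
  then have "exp (b * T) * exp (- (c * (1 + \<xi>\<^sup>2) * t)) \<le> exp (b * T) * 1" by (intro mult_left_mono) auto
  then show ?thesis using norm_exp_m[OF that, of \<xi>] by linarith
qed

lemma adm_measurable: "adm K w \<Longrightarrow> (\<lambda>(t, \<xi>). w t \<xi>) \<in> borel_measurable (borel \<Otimes>\<^sub>M borel)"
  by (simp add: adm_def)

lemma admD:
  assumes "adm K w"
  shows "0 \<le> K" "w t \<in> borel_measurable borel" "t \<in> {0..T} \<Longrightarrow> norm (w t \<xi>) \<le> K * (lor \<xi>)\<^sup>2"
proof -
  show "0 \<le> K" using assms unfolding adm_def by blast
  show "norm (w t \<xi>) \<le> K * (lor \<xi>)\<^sup>2" if "t \<in> {0..T}" using assms that unfolding adm_def by blast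
  show "w t \<in> borel_measurable borel"
    by (rule measurable_uncurry[OF adm_measurable[OF assms] measurable_const measurable_ident_sets]) auto
qed

lemma adm_integrable:
  assumes "adm K w" "t \<in> {0..T}"
  shows "integrable lborel (w t)" "integrable lborel (dsym (w t))"
proof -
  note [measurable] = admD(2)[OF assms(1), of t]
  note D = admD[OF assms(1)]
  have "norm (w t \<xi>) \<le> norm (K * lor \<xi>)" for \<xi>
    using D(1) D(3)[OF assms(2), of \<xi>] mult_left_mono[OF lor2_le_lor D(1), of \<xi>] abs_ge_self[of "K * lor \<xi>"] by simp
  then show "integrable lborel (w t)"
    by (intro Bochner_Integration.integrable_bound[OF integrable_mult_right[OF lor_integrable, of K]]) auto
  have "norm (\<i> * of_real \<xi> * w t \<xi>) \<le> norm (K * lor \<xi>)" for \<xi>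
    using deriv_symbol_bound[where h="w t", OF D(3)[OF assms(2), of \<xi>] D(1)] abs_ge_self[of "K * lor \<xi>"] by simp
  then show "integrable lborel (dsym (w t))"
    by (intro Bochner_Integration.integrable_bound[OF integrable_mult_right[OF lor_integrable, of K]]) auto
qed

lemma adm_lincomb:
  assumes w: "adm H w" and z: "adm K z"
  shows "adm (\<bar>\<alpha>\<bar> * H + \<bar>\<beta>\<bar> * K) (\<lambda>t \<xi>. of_real \<alpha> * w t \<xi> + of_real \<beta> * z t \<xi>)"
proof -
  note [measurable (raw)] = measurable_uncurry[OF adm_measurable[OF w]] measurable_uncurry[OF adm_measurable[OF z]]
  have "norm (of_real \<alpha> * w t \<xi> + of_real \<beta> * z t \<xi>) \<le> (\<bar>\<alpha>\<bar> * H + \<bar>\<beta>\<bar> * K) * (lor \<xi>)\<^sup>2" if t: "t \<in> {0..T}" for t \<xi>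
  proof -
    have "norm (of_real \<alpha> * w t \<xi> + of_real \<beta> * z t \<xi>) \<le> \<bar>\<alpha>\<bar> * norm (w t \<xi>) + \<bar>\<beta>\<bar> * norm (z t \<xi>)"
      by (rule norm_triangle_le) (simp add: norm_mult)
    also have "\<dots> \<le> \<bar>\<alpha>\<bar> * (H * (lor \<xi>)\<^sup>2) + \<bar>\<beta>\<bar> * (K * (lor \<xi>)\<^sup>2)"
      by (intro add_mono mult_left_mono admD(3)[OF w t] admD(3)[OF z t]) auto
    finally show ?thesis by (simp add: algebra_simps)
  qed
  moreover have "(\<lambda>(t, \<xi>). of_real \<alpha> * w t \<xi> + of_real \<beta> * z t \<xi>) \<in> borel_measurable (borel \<Otimes>\<^sub>M borel)"
    by measurable
  ultimately show ?thesis using admD(1)[OF w] admD(1)[OF z] by (simp add: adm_def)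
qed

lemma duh_kernel_measurable:
  assumes w: "adm H w" and z: "adm K z"
  shows "(\<lambda>p. indicator {0..fst (fst p)} (snd p) *\<^sub>R
      (exp (of_real (fst (fst p) - snd p) * m (snd (fst p))) * nl (w (snd p)) (z (snd p)) (snd (fst p))))
    \<in> borel_measurable ((borel \<Otimes>\<^sub>M borel) \<Otimes>\<^sub>M borel)"
proof -
  note [measurable (raw)] = measurable_uncurry[OF nl_measurable[OF adm_measurable[OF w] adm_measurable[OF z]]]
  have "(\<lambda>p. (if 0 \<le> snd p \<and> snd p \<le> fst (fst p) then
      exp (of_real (fst (fst p) - snd p) * m (snd (fst p))) * nl (w (snd p)) (z (snd p)) (snd (fst p)) else 0))
    \<in> borel_measurable ((borel \<Otimes>\<^sub>M borel) \<Otimes>\<^sub>M borel)"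
    by measurable
  moreover have "indicator {0..t} t' *\<^sub>R y = (if 0 \<le> t' \<and> t' \<le> t then y else 0)" for t t' :: real and y :: complex
    by (simp add: indicator_def)
  ultimately show ?thesis by (simp only:)
qed

lemma nl_adm_bound:
  assumes w: "adm H w" and z: "adm K z" and t: "t \<in> {0..T}"
  shows "norm (nl (w t) (z t) \<xi>) \<le> 2 * H * K * lor \<xi>"
  by (rule nl_bound) (use admD[OF w] admD[OF z] t in auto)

lemma duh_integrand:
  assumes w: "adm H w" and z: "adm K z" and t: "t \<in> {0..T}"
  shows "norm (dint w z t \<xi> t')
           \<le> indicator {0..t} t' *\<^sub>R (2 * H * K * lor \<xi> * exp (b * T) * exp (- (c * (1 + \<xi>\<^sup>2) * (t - t'))))"
    and "integrable lborel (\<lambda>t'. dint w z t \<xi> t')"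
proof -
  have HK: "0 \<le> H" "0 \<le> K" using admD(1) w z by auto
  show le: "norm (dint w z t \<xi> t')
           \<le> indicator {0..t} t' *\<^sub>R (2 * H * K * lor \<xi> * exp (b * T) * exp (- (c * (1 + \<xi>\<^sup>2) * (t - t'))))" for t'
  proof (cases "t' \<in> {0..t}")
    case True
    then have "t - t' \<in> {0..T}" "t' \<in> {0..T}" using t by auto
    then have "norm (exp (of_real (t - t') * m \<xi>)) * norm (nl (w t') (z t') \<xi>) \<le> (exp (b * T) * exp (- (c * (1 + \<xi>\<^sup>2) * (t - t')))) * (2 * H * K * lor \<xi>)"
      by (intro mult_mono norm_exp_m nl_adm_bound[OF w z]) auto
    then show ?thesis using True by (simp add: norm_mult mult_ac)
  qed simp
  have "continuous_on {0..t} (\<lambda>t'. 2 * H * K * lor \<xi> * exp (b * T) * exp (- (c * (1 + \<xi>\<^sup>2) * (t - t'))))"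
    by (intro continuous_intros)
  from borel_integrable_atLeastAtMost'[OF this]
  have "integrable lborel (\<lambda>t'. indicator {0..t} t' *\<^sub>R (2 * H * K * lor \<xi> * exp (b * T) * exp (- (c * (1 + \<xi>\<^sup>2) * (t - t')))))"
    by (simp add: set_integrable_def)
  then show "integrable lborel (\<lambda>t'. dint w z t \<xi> t')"
  proof (rule Bochner_Integration.integrable_bound)
    have "(\<lambda>t'. ((t, \<xi>), t')) \<in> borel \<rightarrow>\<^sub>M (borel \<Otimes>\<^sub>M borel) \<Otimes>\<^sub>M borel" by measurable
    from measurable_compose[OF this duh_kernel_measurable[OF w z]]
    show "(\<lambda>t'. dint w z t \<xi> t') \<in> borel_measurable lborel" by simp
  qed (use order_trans[OF le abs_ge_self] in auto)
qed

text \<open>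
  Integrating \<open>exp (- c (1 + \<xi>\<^sup>2) (t - t'))\<close> over \<open>t'\<close> gives at most \<open>lor \<xi> / c\<close>. With the factor \<open>lor \<xi>\<close> of
  the nonlinearity this restores the weight \<open>(lor \<xi>)\<^sup>2\<close>.
\<close>

lemma duh_bound:
  assumes w: "adm H w" and z: "adm K z" and t: "t \<in> {0..T}"
  shows "norm (duh w z t \<xi>) \<le> M * H * K * (lor \<xi>)\<^sup>2"
proof -
  let ?a = "c * (1 + \<xi>\<^sup>2)" and ?C = "2 * H * K * lor \<xi> * exp (b * T)"
  have HK: "0 \<le> H" "0 \<le> K" using admD(1) w z by auto
  have a: "0 < ?a" using params by (simp add: add_pos_nonneg)
  have C: "0 \<le> ?C" using HK lor_pos[of \<xi>] by simp
  have ii: "integrable lborel (\<lambda>t'. indicator {0..t} t' *\<^sub>R (?C * exp (- (?a * (t - t')))))"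
    using borel_integrable_atLeastAtMost'[of 0 t "\<lambda>t'. ?C * exp (- (?a * (t - t')))"]
    by (simp add: set_integrable_def continuous_intros)
  have "norm (duh w z t \<xi>) \<le> (LBINT t'. indicator {0..t} t' *\<^sub>R (?C * exp (- (?a * (t - t')))))"
    unfolding duh_def
    by (rule order_trans[OF integral_norm_bound integral_mono[OF integrable_norm[OF duh_integrand(2)[OF w z t]] ii duh_integrand(1)[OF w z t]]])
  also have "\<dots> = ?C / ?a * exp (- (?a * (t - t))) - ?C / ?a * exp (- (?a * (t - 0)))"
  proof (rule integral_FTC_Icc)
    show "0 \<le> t" using t by simp
    show "((\<lambda>t'. ?C / ?a * exp (- (?a * (t - t')))) has_vector_derivative ?C * exp (- (?a * (t - x)))) (at x within {0..t})" for x
      using a by (auto intro!: derivative_eq_intros simp: has_real_derivative_iff_has_vector_derivative[symmetric])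
    show "continuous_on {0..t} (\<lambda>t'. ?C * exp (- (?a * (t - t'))))" by (intro continuous_intros)
  qed
  also have "\<dots> \<le> ?C / ?a" using C a by simp
  also have "\<dots> = M * H * K * (lor \<xi>)\<^sup>2"
    by (simp add: M_def lor_def power2_eq_square divide_simps)
  finally show ?thesis .
qed

lemma adm_duh:
  assumes w: "adm H w" and z: "adm K z" shows "adm (M * H * K) (duh w z)"
proof -
  have "(\<lambda>p. LBINT t'. (\<lambda>p. indicator {0..fst (fst p)} (snd p) *\<^sub>R
      (exp (of_real (fst (fst p) - snd p) * m (snd (fst p))) * nl (w (snd p)) (z (snd p)) (snd (fst p)))) (p, t'))
    \<in> borel_measurable (borel \<Otimes>\<^sub>M borel)"
    by (rule lborel.borel_measurable_lebesgue_integral)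
      (use duh_kernel_measurable[OF w z] in \<open>simp add: case_prod_unfold cong: measurable_cong_sets\<close>)
  then have "(\<lambda>(t, \<xi>). duh w z t \<xi>) \<in> borel_measurable (borel \<Otimes>\<^sub>M borel)"
    by (simp add: duh_def case_prod_unfold)
  then show ?thesis using duh_bound[OF w z] M_pos admD(1)[OF w] admD(1)[OF z] by (simp add: adm_def)
qed

lemma nl_integrand_adm:
  assumes w: "adm H w" and z: "adm K z" and t: "t \<in> {0..T}"
  shows "integrable lborel (\<lambda>\<eta>. nlint (w t) (z t) \<xi> \<eta>)"
  by (rule nl_integrand[OF admD(2)[OF w] admD(2)[OF z] admD(3)[OF w t] admD(3)[OF z t] admD(1)[OF w] admD(1)[OF z]])

lemma nl_lincomb:
  assumes w: "adm H w" "adm H' w'" and z: "adm K z" "t \<in> {0..T}"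
  shows "nl (\<lambda>\<xi>. of_real \<alpha> * w t \<xi> + of_real \<beta> * w' t \<xi>) (z t) \<xi> = of_real \<alpha> * nl (w t) (z t) \<xi> + of_real \<beta> * nl (w' t) (z t) \<xi>"
    "nl (z t) (\<lambda>\<xi>. of_real \<alpha> * w t \<xi> + of_real \<beta> * w' t \<xi>) \<xi> = of_real \<alpha> * nl (z t) (w t) \<xi> + of_real \<beta> * nl (z t) (w' t) \<xi>"
proof -
  have i: "integrable lborel (\<lambda>\<eta>. nlint (w t) (z t) \<xi> \<eta>)"
     "integrable lborel (\<lambda>\<eta>. nlint (w' t) (z t) \<xi> \<eta>)"
     "integrable lborel (\<lambda>\<eta>. nlint (z t) (w t) \<xi> \<eta>)"
     "integrable lborel (\<lambda>\<eta>. nlint (z t) (w' t) \<xi> \<eta>)"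
    by (intro nl_integrand_adm[OF w(1) z(1) z(2)] nl_integrand_adm[OF w(2) z(1) z(2)]
        nl_integrand_adm[OF z(1) w(1) z(2)] nl_integrand_adm[OF z(1) w(2) z(2)])+
  have "(\<lambda>\<eta>. (\<i> * of_real \<eta> * (of_real \<alpha> * w t \<eta> + of_real \<beta> * w' t \<eta>)) * (\<i> * of_real (\<xi> - \<eta>) * z t (\<xi> - \<eta>)))
    = (\<lambda>\<eta>. of_real \<alpha> * (nlint (w t) (z t) \<xi> \<eta>) + of_real \<beta> * (nlint (w' t) (z t) \<xi> \<eta>))"
    by (simp add: algebra_simps)
  then show "nl (\<lambda>\<xi>. of_real \<alpha> * w t \<xi> + of_real \<beta> * w' t \<xi>) (z t) \<xi> = of_real \<alpha> * nl (w t) (z t) \<xi> + of_real \<beta> * nl (w' t) (z t) \<xi>"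
    unfolding nl_def conv_def
    by (simp only: Bochner_Integration.integral_add[OF integrable_mult_right[OF i(1)] integrable_mult_right[OF i(2)]] integral_mult_right_zero)
      (simp add: algebra_simps)
  have "(\<lambda>\<eta>. (\<i> * of_real \<eta> * z t \<eta>) * (\<i> * of_real (\<xi> - \<eta>) * (of_real \<alpha> * w t (\<xi> - \<eta>) + of_real \<beta> * w' t (\<xi> - \<eta>))))
    = (\<lambda>\<eta>. of_real \<alpha> * (nlint (z t) (w t) \<xi> \<eta>) + of_real \<beta> * (nlint (z t) (w' t) \<xi> \<eta>))"
    by (simp add: algebra_simps)
  then show "nl (z t) (\<lambda>\<xi>. of_real \<alpha> * w t \<xi> + of_real \<beta> * w' t \<xi>) \<xi> = of_real \<alpha> * nl (z t) (w t) \<xi> + of_real \<beta> * nl (z t) (w' t) \<xi>"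
    unfolding nl_def conv_def
    by (simp only: Bochner_Integration.integral_add[OF integrable_mult_right[OF i(3)] integrable_mult_right[OF i(4)]] integral_mult_right_zero)
      (simp add: algebra_simps)
qed

text \<open>
  \<open>w\<^sup>2 - z\<^sup>2 = (w - z) w + z (w - z)\<close> for the bilinear term. The difference is written with coefficients
  \<open>1\<close> and \<open>-1\<close> so that \<open>adm_lincomb\<close> applies to it literally.
\<close>

lemma duh_square_diff:
  assumes w: "adm H w" and z: "adm K z" and t: "t \<in> {0..T}"
  defines "d \<equiv> \<lambda>t \<xi>. of_real 1 * w t \<xi> + of_real (-1) * z t \<xi>"
  shows "duh w w t \<xi> - duh z z t \<xi> = duh d w t \<xi> + duh z d t \<xi>"
proof -
  have d: "adm (\<bar>1\<bar> * H + \<bar>-1\<bar> * K) d" unfolding d_def by (rule adm_lincomb[OF w z])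
  have "dint w w t \<xi> t' - dint z z t \<xi> t'
     = dint d w t \<xi> t' + dint z d t \<xi> t'" for t'
  proof (cases "t' \<in> {0..t}")
    case True
    then have t': "t' \<in> {0..T}" using t by auto
    show ?thesis
      unfolding d_def nl_lincomb(1)[OF w z w t'] nl_lincomb(2)[OF w z z t'] by (simp add: algebra_simps)
  qed simp
  then show ?thesis
    unfolding duh_def
      Bochner_Integration.integral_diff[symmetric, OF duh_integrand(2)[OF w w t] duh_integrand(2)[OF z z t]]
      Bochner_Integration.integral_add[symmetric, OF duh_integrand(2)[OF d w t] duh_integrand(2)[OF z d t]]
    by (intro Bochner_Integration.integral_cong refl)
qed

lemma duh_square_diff_bound:
  assumes w: "adm H w" and z: "adm K z" and t: "t \<in> {0..T}"
    and D: "adm D (\<lambda>t \<xi>. of_real 1 * w t \<xi> + of_real (-1) * z t \<xi>)"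
  shows "norm (duh w w t \<xi> - duh z z t \<xi>) \<le> M * D * (H + K) * (lor \<xi>)\<^sup>2"
proof -
  have "norm (duh w w t \<xi> - duh z z t \<xi>) \<le> M * D * H * (lor \<xi>)\<^sup>2 + M * K * D * (lor \<xi>)\<^sup>2"
    unfolding duh_square_diff[OF w z t]
    by (rule norm_triangle_le) (intro add_mono duh_bound w z t D)
  then show ?thesis by (simp add: algebra_simps)
qed

lemma nl_cong_scale:
  "nl (\<lambda>\<xi>. of_real \<alpha> * w \<xi>) (\<lambda>\<xi>. of_real \<alpha> * w \<xi>) \<xi> = of_real (\<alpha>\<^sup>2) * nl w w \<xi>"
proof -
  have "(\<lambda>\<eta>. (\<i> * of_real \<eta> * (of_real \<alpha> * w \<eta>)) * (\<i> * of_real (\<xi> - \<eta>) * (of_real \<alpha> * w (\<xi> - \<eta>))))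
     = (\<lambda>\<eta>. of_real (\<alpha>\<^sup>2) * (nlint w w \<xi> \<eta>))"
    by (simp add: power2_eq_square mult_ac)
  then show ?thesis unfolding nl_def conv_def by (simp only: integral_mult_right_zero) simp
qed

lemma duh_scale:
  "duh (\<lambda>t \<xi>. of_real \<alpha> * w t \<xi>) (\<lambda>t \<xi>. of_real \<alpha> * w t \<xi>) t \<xi> = of_real (\<alpha>\<^sup>2) * duh w w t \<xi>"
proof -
  have "(\<lambda>t'. indicator {0..t} t' *\<^sub>R (exp (of_real (t - t') * m \<xi>) * nl (\<lambda>\<xi>. of_real \<alpha> * w t' \<xi>) (\<lambda>\<xi>. of_real \<alpha> * w t' \<xi>) \<xi>))
     = (\<lambda>t'. of_real (\<alpha>\<^sup>2) * (dint w w t \<xi> t'))"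
    unfolding nl_cong_scale by (simp add: mult_ac scaleR_conv_of_real)
  then show ?thesis unfolding duh_def by (simp only: integral_mult_right_zero)
qed

definition free :: "(real \<Rightarrow> complex) \<Rightarrow> real \<Rightarrow> real \<Rightarrow> complex" where
  "free f t \<xi> = exp (of_real t * m \<xi>) * f \<xi>"

lemma adm_free:
  assumes [measurable]: "f \<in> borel_measurable borel" and f: "\<And>\<xi>. norm (f \<xi>) \<le> F * (lor \<xi>)\<^sup>2"
  shows "adm (exp (b * T) * F) (free f)"
proof -
  have "(\<lambda>(t, \<xi>). free f t \<xi>) \<in> borel_measurable (borel \<Otimes>\<^sub>M borel)" unfolding free_def by measurable
  moreover have "norm (free f t \<xi>) \<le> exp (b * T) * F * (lor \<xi>)\<^sup>2" if "t \<in> {0..T}" for t \<xi>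
    using mult_mono[OF norm_exp_m'[OF that] f[of \<xi>]] by (simp add: free_def norm_mult mult.assoc)
  moreover have "0 \<le> F" 
  proof -
    have "0 \<le> F * (lor 0)\<^sup>2" using f[of 0] norm_ge_zero order_trans by blast
    then show ?thesis by (simp add: lor_def)
  qed
  ultimately show ?thesis by (simp add: adm_def)
qed

primrec picard :: "(real \<Rightarrow> real \<Rightarrow> complex) \<Rightarrow> nat \<Rightarrow> real \<Rightarrow> real \<Rightarrow> complex" where
  "picard e 0 = e"
| "picard e (Suc n) = (\<lambda>t \<xi>. of_real 1 * e t \<xi> + of_real (-1) * duh (picard e n) (picard e n) t \<xi>)"

declare picard.simps(2) [simp del]

lemma adm_mono: "adm K w \<Longrightarrow> K \<le> K' \<Longrightarrow> adm K' w"
  unfolding adm_def using mult_right_mono[of K K' "(lor _)\<^sup>2"] by (meson order_trans zero_le_power2)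

lemma adm_picard:
  assumes e: "adm G e" and G: "4 * M * G \<le> 1" shows "adm (2 * G) (picard e n)"
proof (induction n)
  case 0
  then show ?case using adm_mono[OF e] admD(1)[OF e] by simp
next
  case (Suc n)
  have "adm (\<bar>1\<bar> * G + \<bar>-1\<bar> * (M * (2 * G) * (2 * G))) (picard e (Suc n))"
    unfolding picard.simps by (rule adm_lincomb[OF e adm_duh[OF Suc Suc]])
  moreover have "\<bar>1\<bar> * G + \<bar>-1\<bar> * (M * (2 * G) * (2 * G)) \<le> 2 * G"
    using mult_right_mono[OF G admD(1)[OF e]] by (simp add: mult_ac)
  ultimately show ?case by (rule adm_mono)
qed

lemma picard_step:
  assumes e: "adm G e" and G: "8 * M * G \<le> 1" and t: "t \<in> {0..T}"
  shows "norm (picard e (Suc n) t \<xi> - picard e n t \<xi>) \<le> G * (1 / 2) ^ n * (lor \<xi>)\<^sup>2"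
  using t
proof (induction n arbitrary: t \<xi>)
  case 0
  have "norm (duh e e t \<xi>) \<le> M * G * G * (lor \<xi>)\<^sup>2" by (rule duh_bound[OF e e 0])
  also have "\<dots> \<le> 1 * G * (lor \<xi>)\<^sup>2"
    using G admD(1)[OF e] M_pos by (intro mult_right_mono) auto
  finally show ?case by (simp add: picard.simps(2))
next
  case (Suc n)
  have G0: "0 \<le> G" using admD(1)[OF e] .
  have G4: "4 * M * G \<le> 1" using G mult_nonneg_nonneg[OF less_imp_le[OF M_pos] G0] by simp
  note ap = adm_picard[OF e G4]
  have D: "adm (G * (1 / 2) ^ n) (\<lambda>t \<xi>. of_real 1 * picard e (Suc n) t \<xi> + of_real (-1) * picard e n t \<xi>)"
    using adm_lincomb[OF ap[of "Suc n"] ap[of n], of 1 "-1"] Suc.IH G0 unfolding adm_def by simp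
  have "picard e (Suc (Suc n)) t \<xi> - picard e (Suc n) t \<xi> =
      - (duh (picard e (Suc n)) (picard e (Suc n)) t \<xi> - duh (picard e n) (picard e n) t \<xi>)"
    by (simp add: picard.simps(2))
  then have "norm (picard e (Suc (Suc n)) t \<xi> - picard e (Suc n) t \<xi>) \<le> M * (G * (1 / 2) ^ n) * (2 * G + 2 * G) * (lor \<xi>)\<^sup>2"
    using duh_square_diff_bound[OF ap ap Suc.prems D, of \<xi>] by (metis norm_minus_cancel)
  also have "\<dots> = (4 * M * G) * (G * (1 / 2) ^ n * (lor \<xi>)\<^sup>2)" by (simp add: mult_ac)
  also have "\<dots> \<le> (1 / 2) * (G * (1 / 2) ^ n * (lor \<xi>)\<^sup>2)"
    using G G0 by (intro mult_right_mono) auto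
  finally show ?case by simp
qed

text \<open>
  The map \<open>w \<mapsto> e - duh w w\<close> preserves the ball of radius \<open>2 G\<close> and halves distances there. Completeness is
  replaced by pointwise limits of the iterates, which are measurable and inherit the weighted
  bounds.
\<close>

theorem fixed_point:
  assumes e: "adm G e" and G: "8 * M * G \<le> 1"
  shows "\<exists>w. adm (2 * G) w \<and> (\<forall>t\<in>{0..T}. \<forall>\<xi>. w t \<xi> = e t \<xi> - duh w w t \<xi>)"
proof -
  have G0: "0 \<le> G" using admD(1)[OF e] .
  have G4: "4 * M * G \<le> 1" using G mult_nonneg_nonneg[OF less_imp_le[OF M_pos] G0] by simp
  note ap = adm_picard[OF e G4]
  define w where "w t \<xi> = lim (\<lambda>n. picard e n t \<xi>)" for t \<xi>
  have meas: "(\<lambda>(t, \<xi>). w t \<xi>) \<in> borel_measurable (borel \<Otimes>\<^sub>M borel)"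
  proof -
    have "(\<lambda>p. lim (\<lambda>n. (case p of (t, \<xi>) \<Rightarrow> picard e n t \<xi>))) \<in> borel_measurable (borel \<Otimes>\<^sub>M borel)"
      by (rule borel_measurable_lim_metric) (rule adm_measurable[OF ap])
    then show ?thesis by (simp add: w_def case_prod_unfold)
  qed
  have conv: "norm (w t \<xi> - picard e n t \<xi>) \<le> 2 * G * (1 / 2) ^ n * (lor \<xi>)\<^sup>2" "(\<lambda>n. picard e n t \<xi>) \<longlonglongrightarrow> w t \<xi>"
    if t: "t \<in> {0..T}" for t \<xi> n
  proof -
    let ?d = "\<lambda>n. picard e (Suc n) t \<xi> - picard e n t \<xi>"
    let ?g = "\<lambda>n. G * (1 / 2) ^ n * (lor \<xi>)\<^sup>2 :: real"
    have sg: "?g sums (G * 2 * (lor \<xi>)\<^sup>2)"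
      using sums_mult2[OF sums_mult[OF geometric_sums[of "1/2 :: real"], of G], of "(lor \<xi>)\<^sup>2"] by simp
    have sd: "summable ?d" by (rule summable_comparison_test'[OF sums_summable[OF sg] picard_step[OF e G t]])
    have tel: "(\<Sum>i<n. ?d i) = picard e n t \<xi> - picard e 0 t \<xi>" for n
      by (rule sum_lessThan_telescope)
    have "(\<lambda>n. picard e n t \<xi> - picard e 0 t \<xi>) \<longlonglongrightarrow> suminf ?d"
      using summable_LIMSEQ[OF sd] unfolding tel .
    from tendsto_add[OF this tendsto_const[of "picard e 0 t \<xi>"]]
    have "(\<lambda>n. picard e n t \<xi>) \<longlonglongrightarrow> suminf ?d + picard e 0 t \<xi>" by simp
    then show l: "(\<lambda>n. picard e n t \<xi>) \<longlonglongrightarrow> w t \<xi>" 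
      unfolding w_def using convergentI convergent_LIMSEQ_iff by blast
    have "norm (picard e (n + k) t \<xi> - picard e n t \<xi>) \<le> 2 * G * (1 / 2) ^ n * (lor \<xi>)\<^sup>2" for k
    proof -
      have "norm (picard e (n + k) t \<xi> - picard e n t \<xi>) \<le> (2 * G * (1 / 2) ^ n - 2 * G * (1 / 2) ^ (n + k)) * (lor \<xi>)\<^sup>2"
      proof (induction k)
        case (Suc k)
        have "norm (picard e (n + Suc k) t \<xi> - picard e n t \<xi>) \<le> norm (?d (n + k)) + norm (picard e (n + k) t \<xi> - picard e n t \<xi>)"
          using norm_triangle_ineq[of "?d (n + k)" "picard e (n + k) t \<xi> - picard e n t \<xi>"] by simp
        also have "\<dots> \<le> G * (1 / 2) ^ (n + k) * (lor \<xi>)\<^sup>2 + (2 * G * (1 / 2) ^ n - 2 * G * (1 / 2) ^ (n + k)) * (lor \<xi>)\<^sup>2"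
          by (intro add_mono picard_step[OF e G t] Suc)
        finally show ?case by (simp add: algebra_simps)
      qed simp
      also have "\<dots> \<le> 2 * G * (1 / 2) ^ n * (lor \<xi>)\<^sup>2"
        using G0 by (intro mult_right_mono) auto
      finally show ?thesis .
    qed
    then have ev: "\<And>k. norm (picard e (k + n) t \<xi> - picard e n t \<xi>) \<le> 2 * G * (1 / 2) ^ n * (lor \<xi>)\<^sup>2"
      by (simp add: add.commute)
    have "(\<lambda>k. norm (picard e (k + n) t \<xi> - picard e n t \<xi>)) \<longlonglongrightarrow> norm (w t \<xi> - picard e n t \<xi>)"
      by (intro tendsto_intros LIMSEQ_ignore_initial_segment l)
    then show "norm (w t \<xi> - picard e n t \<xi>) \<le> 2 * G * (1 / 2) ^ n * (lor \<xi>)\<^sup>2"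
      by (rule Lim_bounded[where M=0]) (use ev in auto)
  qed
  have w: "adm (2 * G) w"
  proof -
    have "norm (w t \<xi>) \<le> 2 * G * (lor \<xi>)\<^sup>2" if t: "t \<in> {0..T}" for t \<xi>
      by (rule Lim_bounded[OF tendsto_norm[OF conv(2)[OF t]], where M=0]) (use admD(3)[OF ap t] in auto)
    then show ?thesis using meas G0 by (simp add: adm_def)
  qed
  have "w t \<xi> = e t \<xi> - duh w w t \<xi>" if t: "t \<in> {0..T}" for t \<xi>
  proof -
    have "norm (w t \<xi> - (e t \<xi> - duh w w t \<xi>)) \<le> (2 * G * (1 / 2) ^ Suc n + M * (2 * G * (1 / 2) ^ n) * (2 * G + 2 * G)) * (lor \<xi>)\<^sup>2" for n
    proof -
      have D: "adm (2 * G * (1 / 2) ^ n) (\<lambda>t \<xi>. of_real 1 * w t \<xi> + of_real (-1) * picard e n t \<xi>)"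
        using adm_lincomb[OF w ap[of n], of 1 "-1"] conv(1) G0 unfolding adm_def by simp
      have "w t \<xi> - (e t \<xi> - duh w w t \<xi>) = (w t \<xi> - picard e (Suc n) t \<xi>) + (duh w w t \<xi> - duh (picard e n) (picard e n) t \<xi>)"
        by (simp add: picard.simps(2))
      then have "norm (w t \<xi> - (e t \<xi> - duh w w t \<xi>)) \<le> norm (w t \<xi> - picard e (Suc n) t \<xi>) + norm (duh w w t \<xi> - duh (picard e n) (picard e n) t \<xi>)"
        using norm_triangle_ineq by metis
      also have "\<dots> \<le> 2 * G * (1 / 2) ^ Suc n * (lor \<xi>)\<^sup>2 + M * (2 * G * (1 / 2) ^ n) * (2 * G + 2 * G) * (lor \<xi>)\<^sup>2"
        by (intro add_mono conv(1)[OF t] duh_square_diff_bound[OF w ap t D])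
      finally show ?thesis by (simp add: algebra_simps)
    qed
    moreover have "(\<lambda>n. (2 * G * (1 / 2) ^ Suc n + M * (2 * G * (1 / 2) ^ n) * (2 * G + 2 * G)) * (lor \<xi>)\<^sup>2) \<longlonglongrightarrow> (2 * G * 0 + M * (2 * G * 0) * (2 * G + 2 * G)) * (lor \<xi>)\<^sup>2"
      by (intro tendsto_intros LIMSEQ_Suc LIMSEQ_power_zero) auto
    ultimately have "norm (w t \<xi> - (e t \<xi> - duh w w t \<xi>)) \<le> 0"
      by (intro LIMSEQ_le_const[where X="\<lambda>n. (2 * G * (1 / 2) ^ Suc n + M * (2 * G * (1 / 2) ^ n) * (2 * G + 2 * G)) * (lor \<xi>)\<^sup>2"]) auto
    then show ?thesis by simp
  qed
  with w show ?thesis by blast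
qed

text \<open>
  Since \<open>w - e = - duh w w\<close> is quadratic in \<open>G\<close>, replacing \<open>w\<close> by \<open>e\<close> in the quadratic term makes a
  cubic error.
\<close>

lemma second_order_expansion:
  assumes e: "adm G e" and w: "adm (2 * G) w" and eq: "\<forall>t\<in>{0..T}. \<forall>\<xi>. w t \<xi> = e t \<xi> - duh w w t \<xi>"
    and t: "t \<in> {0..T}"
  shows "norm (w t \<xi> - (e t \<xi> - duh e e t \<xi>)) \<le> 12 * M\<^sup>2 * G ^ 3 * (lor \<xi>)\<^sup>2"
proof -
  have D: "adm (M * (2 * G) * (2 * G)) (\<lambda>t \<xi>. of_real 1 * w t \<xi> + of_real (-1) * e t \<xi>)"
  proof -
    have "norm (w t \<xi> - e t \<xi>) \<le> M * (2 * G) * (2 * G) * (lor \<xi>)\<^sup>2" if "t \<in> {0..T}" for t \<xi>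
    proof -
      have "w t \<xi> - e t \<xi> = - duh w w t \<xi>" using eq that by simp
      then show ?thesis using duh_bound[OF w w that, of \<xi>] by simp
    qed
    then show ?thesis
      using adm_lincomb[OF w e, of 1 "-1"] admD(1)[OF e] M_pos unfolding adm_def by simp
  qed
  have "w t \<xi> - (e t \<xi> - duh e e t \<xi>) = - (duh w w t \<xi> - duh e e t \<xi>)" using eq t by simp
  then have "norm (w t \<xi> - (e t \<xi> - duh e e t \<xi>)) \<le> M * (M * (2 * G) * (2 * G)) * (2 * G + G) * (lor \<xi>)\<^sup>2"
    using duh_square_diff_bound[OF w e t D, of \<xi>] by (metis norm_minus_cancel)
  then show ?thesis by (simp add: power2_eq_square power3_eq_cube algebra_simps)
qed

end

section \<open>Solutions of the initial value problem\<close>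

lemma Hs_ift:
  assumes h: "integrable lborel h"
  shows "nrm (Hs s) (dist_of (ift h)) = sqrt (LBINT \<xi>. wsq s \<xi> (h \<xi>))"
    and "integrable lborel (\<lambda>\<xi>. wsq s \<xi> (h \<xi>)) \<Longrightarrow> dist_of (ift h) \<in> pts (Hs s)"
proof -
  have [measurable]: "h \<in> borel_measurable borel" using h borel_measurable_integrable by auto
  have hl: "h \<in> borel_measurable lebesgue" by (rule measurable_completion) simp
  have m: "(\<lambda>\<xi>. wsq s \<xi> (h \<xi>)) \<in> borel_measurable lborel" by measurable
  note c = nrm_Hs_cong[OF fhat_ift(1)[OF h] fhat_ift(2)[OF h] hl, of s]
  show "nrm (Hs s) (dist_of (ift h)) = sqrt (LBINT \<xi>. wsq s \<xi> (h \<xi>))"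
    unfolding c(2) using integral_completion[OF m] by simp
  assume "integrable lborel (\<lambda>\<xi>. wsq s \<xi> (h \<xi>))"
  then have "integrable lebesgue (\<lambda>\<xi>. wsq s \<xi> (h \<xi>))" using integrable_completion[OF m] by simp
  then show "dist_of (ift h) \<in> pts (Hs s)"
    unfolding Hs_def using c(1) tempered_ift[OF h] fourier_ift[OF h] integrable_tempered_fun[OF h]
    by (auto simp: regular_def)
qed

lemma powr_le_1: "s \<le> 0 \<Longrightarrow> (1 + \<xi>\<^sup>2) powr s \<le> 1" for \<xi> :: real
  using powr_mono[of s 0 "1 + \<xi>\<^sup>2"] sum_power2_gt_zero_iff[of 1 \<xi>] by simp

lemma weight_sq_bound:
  assumes "s \<le> 0" "norm (z :: complex) \<le> K * (lor \<xi>)\<^sup>2"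
  shows "wsq s \<xi> z \<le> K\<^sup>2 * lor \<xi>"
proof -
  have l: "(lor \<xi>)\<^sup>2 \<le> 1" using lor_pos[of \<xi>] lor_le_1[of \<xi>] by (simp add: power_le_one)
  have "(norm z)\<^sup>2 \<le> (K * (lor \<xi>)\<^sup>2)\<^sup>2" by (rule power_mono[OF assms(2)]) simp
  also have "\<dots> = K\<^sup>2 * ((lor \<xi>)\<^sup>2 * (lor \<xi>)\<^sup>2)" by (simp add: power2_eq_square)
  also have "\<dots> \<le> K\<^sup>2 * (1 * lor \<xi>)"
    by (intro mult_left_mono mult_mono l lor2_le_lor) auto
  finally have "wsq s \<xi> z \<le> 1 * (K\<^sup>2 * lor \<xi>)"
    by (intro mult_mono powr_le_1 assms(1)) auto
  then show ?thesis by simp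
qed

lemma weight_sq_integrable:
  assumes "s \<le> 0" and [measurable]: "h \<in> borel_measurable borel" and "\<And>\<xi>. norm (h \<xi> :: complex) \<le> K * (lor \<xi>)\<^sup>2"
  shows "integrable lborel (\<lambda>\<xi>. wsq s \<xi> (h \<xi>))"
proof (rule Bochner_Integration.integrable_bound[OF integrable_mult_right[OF lor_integrable, of "K\<^sup>2"]])
  show "AE \<xi> in lborel. norm (wsq s \<xi> (h \<xi>)) \<le> norm (K\<^sup>2 * lor \<xi>)"
    using order_trans[OF weight_sq_bound[OF assms(1,3)] abs_ge_self] by simp
qed measurable

context duhamel
begin

text \<open>
  The upper end of the integral depends on time as well; the indicator functions converge except at
  \<open>t' = t\<close>.
\<close>

lemma duh_continuous:
  assumes w: "adm K w" and t: "t \<in> {0..T}" and X: "\<And>n. X n \<in> {0..T}" "X \<longlonglongrightarrow> t"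
  shows "(\<lambda>n. duh w w (X n) \<xi>) \<longlonglongrightarrow> duh w w t \<xi>"
  unfolding duh_def
proof (rule integral_dominated_convergence[where w="\<lambda>t'. indicator {0..T} t' *\<^sub>R (exp (b * T) * (2 * K * K * lor \<xi>))"])
  show "(\<lambda>t'. dint w w t \<xi> t') \<in> borel_measurable lborel"
    using duh_integrand(2)[OF w w t] by (rule borel_measurable_integrable)
  show "(\<lambda>t'. dint w w (X n) \<xi> t') \<in> borel_measurable lborel" for n
    using duh_integrand(2)[OF w w X(1)] by (rule borel_measurable_integrable)
  show "integrable lborel (\<lambda>t'. indicator {0..T} t' *\<^sub>R (exp (b * T) * (2 * K * K * lor \<xi>)))"
    using borel_integrable_atLeastAtMost'[of 0 T "\<lambda>_. exp (b * T) * (2 * K * K * lor \<xi>)"]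
    by (simp add: set_integrable_def)
  show "AE t' in lborel. norm (dint w w (X n) \<xi> t')
      \<le> indicator {0..T} t' *\<^sub>R (exp (b * T) * (2 * K * K * lor \<xi>))" for n
  proof (intro AE_I2)
    fix t'
    show "norm (dint w w (X n) \<xi> t')
      \<le> indicator {0..T} t' *\<^sub>R (exp (b * T) * (2 * K * K * lor \<xi>))"
    proof (cases "t' \<in> {0..X n}")
      case True
      then have t': "X n - t' \<in> {0..T}" "t' \<in> {0..T}" using X(1)[of n] by auto
      then show ?thesis
        using mult_mono[OF norm_exp_m'[OF t'(1), of \<xi>] nl_adm_bound[OF w w t'(2), of \<xi>]] True
        by (simp add: norm_mult)
    next
      case False
      then have "indicator {0..X n} t' = (0 :: real)" by (simp add: indicator_def)
      moreover have "0 \<le> indicator {0..T} t' *\<^sub>R (exp (b * T) * (2 * K * K * lor \<xi>))"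
        using admD(1)[OF w] less_imp_le[OF lor_pos[of \<xi>]] by simp
      ultimately show ?thesis by simp
    qed
  qed
  have "AE t' in lborel. t' \<notin> {t}" using AE_lborel_singleton[of t] by simp
  then show "AE t' in lborel. (\<lambda>n. dint w w (X n) \<xi> t')
     \<longlonglongrightarrow> dint w w t \<xi> t'"
  proof eventually_elim
    case (elim t')
    have "eventually (\<lambda>n. indicator {0..X n} t' = (indicator {0..t} t' :: real)) sequentially"
    proof (cases "t' < t")
      case True
      then have "eventually (\<lambda>n. t' < X n) sequentially" using X(2) by (rule order_tendstoD(1)[rotated])
      then show ?thesis by eventually_elim (use True in \<open>auto simp: indicator_def\<close>)
    next
      case False
      then have "t < t'" using elim by simp
      then have "eventually (\<lambda>n. X n < t') sequentially" using X(2) by (rule order_tendstoD(2)[rotated])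
      then show ?thesis by eventually_elim (use \<open>t < t'\<close> in \<open>auto simp: indicator_def\<close>)
    qed
    then have "(\<lambda>n. indicator {0..X n} t' :: real) \<longlonglongrightarrow> indicator {0..t} t'" by (rule tendsto_eventually)
    then show ?case by (intro tendsto_intros X(2))
  qed
qed

lemma mild_solution_CHs:
  assumes s: "s \<le> 0" and w: "adm K w" and eq: "\<And>t \<xi>. t \<in> {0..T} \<Longrightarrow> w t \<xi> = free f t \<xi> - duh w w t \<xi>"
  shows "(\<lambda>t. if t \<in> {0..T} then dist_of (ift (w t)) else 0) \<in> pts (CHs s T)"
proof -
  let ?u = "\<lambda>t. if t \<in> {0..T} then dist_of (ift (w t)) else 0"
  have wcont: "(\<lambda>n. w (X n) \<xi>) \<longlonglongrightarrow> w t \<xi>" if t: "t \<in> {0..T}" and X: "\<And>n. X n \<in> {0..T}" "X \<longlonglongrightarrow> t" for X t \<xi>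
    unfolding eq[OF t] eq[OF X(1)] free_def by (intro tendsto_intros duh_continuous[OF w t X] X(2))
  have diff: "?u t' - ?u t = dist_of (ift (\<lambda>\<xi>. w t' \<xi> - w t \<xi>))" if "t \<in> {0..T}" "t' \<in> {0..T}" for t t'
    using ift_lincomb[OF adm_integrable(1)[OF w that(2)] adm_integrable(1)[OF w that(1)], of 1 "-1"] that by simp
  have nd: "nrm (Hs s) (?u t' - ?u t) = sqrt (LBINT \<xi>. wsq s \<xi> (w t' \<xi> - w t \<xi>))"
    if "t \<in> {0..T}" "t' \<in> {0..T}" for t t'
    unfolding diff[OF that]
    by (rule Hs_ift(1)) (intro Bochner_Integration.integrable_diff adm_integrable(1)[OF w] that)
  have cont: "\<exists>\<delta>>0. \<forall>t'\<in>{0..T}. \<bar>t' - t\<bar> < \<delta> \<longrightarrow> nrm (Hs s) (?u t' - ?u t) < \<epsilon>"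
    if t: "t \<in> {0..T}" and e: "\<epsilon> > 0" for t \<epsilon>
  proof -
    have "((\<lambda>t'. nrm (Hs s) (?u t' - ?u t)) \<longlongrightarrow> 0) (at t within {0..T})"
      unfolding tendsto_at_iff_sequentially comp_def
    proof (intro allI impI)
      fix X assume X: "\<forall>i. X i \<in> {0..T} - {t}" "X \<longlonglongrightarrow> t"
      then have X': "X n \<in> {0..T}" for n by blast
      have "(\<lambda>n. LBINT \<xi>. wsq s \<xi> (w (X n) \<xi> - w t \<xi>)) \<longlonglongrightarrow> (LBINT (\<xi>::real). (0::real))"
      proof (rule integral_dominated_convergence[where w="\<lambda>\<xi>. (2 * K)\<^sup>2 * lor \<xi>"])
        note [measurable] = admD(2)[OF w]
        show "integrable lborel (\<lambda>\<xi>. (2 * K)\<^sup>2 * lor \<xi>)" by (intro integrable_mult_right lor_integrable)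
        show "(\<lambda>\<xi>. wsq s \<xi> (w (X n) \<xi> - w t \<xi>)) \<in> borel_measurable lborel" for n by measurable
        show "AE \<xi> in lborel. (\<lambda>n. wsq s \<xi> (w (X n) \<xi> - w t \<xi>)) \<longlonglongrightarrow> 0"
        proof (intro AE_I2)
          fix \<xi>
          have "(\<lambda>n. wsq s \<xi> (w (X n) \<xi> - w t \<xi>)) \<longlonglongrightarrow> wsq s \<xi> (w t \<xi> - w t \<xi>)"
            by (intro tendsto_mult tendsto_const tendsto_power tendsto_norm tendsto_diff wcont[OF t X' X(2)])
          then show "(\<lambda>n. wsq s \<xi> (w (X n) \<xi> - w t \<xi>)) \<longlonglongrightarrow> 0" by simp
        qed
        show "AE \<xi> in lborel. norm (wsq s \<xi> (w (X n) \<xi> - w t \<xi>)) \<le> (2 * K)\<^sup>2 * lor \<xi>" for n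
        proof (intro AE_I2)
          fix \<xi>
          have "norm (w (X n) \<xi> - w t \<xi>) \<le> 2 * K * (lor \<xi>)\<^sup>2"
            using norm_triangle_ineq4[of "w (X n) \<xi>" "w t \<xi>"] admD(3)[OF w X', of n \<xi>] admD(3)[OF w t, of \<xi>] by simp
          from weight_sq_bound[OF s this]
          show "norm (wsq s \<xi> (w (X n) \<xi> - w t \<xi>)) \<le> (2 * K)\<^sup>2 * lor \<xi>" by simp
        qed
      qed simp
      then have "(\<lambda>n. sqrt (LBINT \<xi>. wsq s \<xi> (w (X n) \<xi> - w t \<xi>))) \<longlonglongrightarrow> sqrt (LBINT (\<xi>::real). (0::real))"
        by (rule tendsto_real_sqrt)
      then show "(\<lambda>n. nrm (Hs s) (?u (X n) - ?u t)) \<longlonglongrightarrow> 0"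
        unfolding nd[OF t X'] by simp
    qed
    then obtain d where d: "d > 0" "\<And>t'. t' \<in> {0..T} \<Longrightarrow> t' \<noteq> t \<Longrightarrow> dist t' t < d \<Longrightarrow> dist (nrm (Hs s) (?u t' - ?u t)) 0 < \<epsilon>"
      using e unfolding Lim_within by (metis zero_less_dist_iff)
    have "nrm (Hs s) (?u t' - ?u t) < \<epsilon>" if "t' \<in> {0..T}" "\<bar>t' - t\<bar> < d" for t'
    proof (cases "t' = t")
      case True
      then show ?thesis using e seminormedD(9)[OF seminormed_Hs[of s]] by simp
    next
      case False
      then show ?thesis using d(2)[of t'] that by (simp add: dist_real_def)
    qed
    then show ?thesis using d(1) by blast
  qed
  have mem: "?u t \<in> pts (Hs s)" if "t \<in> {0..T}" for t
    using Hs_ift(2)[OF adm_integrable(1)[OF w that] weight_sq_integrable[OF s admD(2)[OF w] admD(3)[OF w that]]] that by simp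
  show ?thesis unfolding CHs_def fst_conv mem_Collect_eq
    using mem cont by (intro conjI ballI allI impI) (simp_all only:, auto)
qed

lemma nl_integrable:
  assumes w: "adm K w" and t: "t \<in> {0..T}" shows "integrable lborel (nl (w t) (w t))"
proof -
  have "(\<lambda>\<xi>. of_real (1 / (2 * pi)) * conv (dsym (w t)) (dsym (w t)) \<xi>) = nl (w t) (w t)"
    by (rule ext) (simp only: nl_def)
  then show ?thesis using ux_sq_ift(3)[OF adm_integrable[OF w t]] by simp
qed

text \<open>
  Tested against \<open>\<phi>\<close>, each term of the integral equation is an integral over frequency against \<open>ift \<phi>\<close>;
  the time integral of the propagated nonlinearity is then a double integral, and Fubini's theorem identifies it
  with the Duhamel term. The symbols \<open>m\<close> and \<open>\<Phi>\<close> are linked only almost everywhere, which distributions do not see.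
\<close>

theorem mild_solution_solves:
  assumes s: "s \<le> 0" and \<Phi>: "\<Phi> \<in> borel_measurable lebesgue"
    and ae: "AE \<xi> in lebesgue. m \<xi> = \<i> * of_real (\<xi> ^ 3) + of_real (\<eta> * \<Phi> \<xi>)"
    and f [measurable]: "f \<in> borel_measurable borel" and F: "\<And>\<xi>. norm (f \<xi>) \<le> F * (lor \<xi>)\<^sup>2"
    and w: "adm K w" and eq: "\<And>t \<xi>. t \<in> {0..T} \<Longrightarrow> w t \<xi> = free f t \<xi> - duh w w t \<xi>"
  shows "solves_ivp s \<eta> \<Phi> T (dist_of (ift f)) (\<lambda>t. if t \<in> {0..T} then dist_of (ift (w t)) else 0)"
proof -
  let ?u = "\<lambda>t. if t \<in> {0..T} then dist_of (ift (w t)) else 0"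
  have sq: "ux_sq (?u t) = dist_of (ift (nl (w t) (w t)))" "ux_sq_defined (?u t)" if t: "t \<in> {0..T}" for t
  proof -
    have k: "(\<lambda>\<xi>. of_real (1 / (2 * pi)) * conv (dsym (w t)) (dsym (w t)) \<xi>) = nl (w t) (w t)"
      by (rule ext) (simp only: nl_def)
    show "ux_sq (?u t) = dist_of (ift (nl (w t) (w t)))" "ux_sq_defined (?u t)"
      using ux_sq_ift(1,2)[OF adm_integrable[OF w t]] t unfolding k by simp_all
  qed
  have ae_exp: "AE \<xi> in lebesgue. exp (\<i> * of_real (t * \<xi> ^ 3) + of_real (\<eta> * t * \<Phi> \<xi>)) * k \<xi> = exp (of_real t * m \<xi>) * k \<xi>" for t k
    using ae by eventually_elim (simp add: algebra_simps)
  have exp_int: "integrable lborel (\<lambda>\<xi>. exp (of_real t * m \<xi>) * k \<xi>)" if t: "t \<in> {0..T}" and k: "integrable lborel k" for t k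
  proof (rule Bochner_Integration.integrable_bound[OF integrable_mult_right[OF k, of "of_real (exp (b * T))"]])
    have [measurable]: "k \<in> borel_measurable borel" using k borel_measurable_integrable by auto
    show "(\<lambda>\<xi>. exp (of_real t * m \<xi>) * k \<xi>) \<in> borel_measurable lborel" by measurable
    show "AE \<xi> in lborel. norm (exp (of_real t * m \<xi>) * k \<xi>) \<le> norm (of_real (exp (b * T)) * k \<xi>)"
      using norm_exp_m'[OF t] by (auto simp: norm_mult intro!: mult_right_mono AE_I2)
  qed
  have propag: "propagator \<eta> \<Phi> t (dist_of (ift k)) = dist_of (ift (\<lambda>\<xi>. exp (of_real t * m \<xi>) * k \<xi>))"
    if t: "t \<in> {0..T}" and k: "integrable lborel k" for t k
    by (rule propagator_ift[OF k exp_int[OF t k] \<Phi> ae_exp])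
  have intf: "integrable lborel f"
  proof -
    have "adm (exp (b * T) * F) (free f)" by (rule adm_free[OF f F])
    moreover have "free f 0 = f" by (rule ext) (simp add: free_def)
    ultimately show ?thesis using adm_integrable(1)[of _ "free f" 0] params by simp
  qed
  have main: "set_integrable lebesgue {0..t} (\<lambda>t'. propagator \<eta> \<Phi> (t - t') (ux_sq (?u t')) \<phi>) \<and>
        ?u t \<phi> = propagator \<eta> \<Phi> t (dist_of (ift f)) \<phi> -
          (LINT t':{0..t}|lebesgue. propagator \<eta> \<Phi> (t - t') (ux_sq (?u t')) \<phi>)"
    if t: "t \<in> {0..T}" and \<phi>: "schwartz \<phi>" for t \<phi>
  proof -
    let ?P = "\<lambda>t' \<xi>. dint w w t \<xi> t'"
    define B where "B = 1 / (2 * pi) * (LBINT \<xi>. norm (\<phi> \<xi>))"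
    have B: "norm (ift \<phi> \<xi>) \<le> B" for \<xi> unfolding B_def by (rule ift_bound[OF schwartz_integrable[OF \<phi>]])
    have B0: "0 \<le> B" using B[of 0] norm_ge_zero order_trans by blast
    have [measurable]: "ift \<phi> \<in> borel_measurable borel" by (rule ift_measurable[OF schwartz_integrable[OF \<phi>]])
    have K0: "0 \<le> K" by (rule admD(1)[OF w])
    have Pm: "(\<lambda>(t', \<xi>). ?P t' \<xi>) \<in> borel_measurable (borel \<Otimes>\<^sub>M borel)"
    proof -
      have "(\<lambda>p. ((t, snd p), fst p)) \<in> borel \<Otimes>\<^sub>M borel \<rightarrow>\<^sub>M (borel \<Otimes>\<^sub>M borel) \<Otimes>\<^sub>M borel" by measurable
      from measurable_compose[OF this duh_kernel_measurable[OF w w]]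
      show ?thesis by (simp add: case_prod_unfold)
    qed
    have PI: "integrable (lborel \<Otimes>\<^sub>M lborel) (\<lambda>(t', \<xi>). ?P t' \<xi> * ift \<phi> \<xi>)"
    proof -
      define C where "C = exp (b * T) * (2 * K * K) * B"
      have i1: "integrable lborel (\<lambda>t'. complex_of_real (indicator {0..t} t'))"
        by (intro integrable_of_real integrable_real_indicator) (auto simp: emeasure_lborel_Icc_eq)
      have i2: "integrable lborel (\<lambda>\<xi>. complex_of_real (lor \<xi>))" by (rule integrable_of_real[OF lor_integrable])
      have "integrable (lborel \<Otimes>\<^sub>M lborel) (\<lambda>(t', \<xi>). complex_of_real (indicator {0..t} t') * of_real C * complex_of_real (lor \<xi>))"
        by (rule integrable_pair_kernel[OF i1 i2, where K="\<lambda>_ _. of_real C" and B="\<bar>C\<bar>"]) auto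
      then show ?thesis
      proof (rule Bochner_Integration.integrable_bound)
        show "(\<lambda>(t', \<xi>). ?P t' \<xi> * ift \<phi> \<xi>) \<in> borel_measurable (lborel \<Otimes>\<^sub>M lborel)"
          using borel_measurable_times[OF Pm, of "\<lambda>p. ift \<phi> (snd p)"] by (simp add: case_prod_unfold cong: measurable_cong_sets)
        have "norm (?P t' \<xi> * ift \<phi> \<xi>) \<le> norm (complex_of_real (indicator {0..t} t') * of_real C * complex_of_real (lor \<xi>))" for t' \<xi>
        proof (cases "t' \<in> {0..t}")
          case True
          then have t': "t - t' \<in> {0..T}" "t' \<in> {0..T}" using t by auto
          have "norm (exp (of_real (t - t') * m \<xi>)) * norm (nl (w t') (w t') \<xi>) * norm (ift \<phi> \<xi>) \<le> exp (b * T) * (2 * K * K * lor \<xi>) * B"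
            using B0 K0 lor_pos[of \<xi>]
            by (intro mult_mono norm_exp_m' nl_adm_bound[OF w w] B t') auto
          also have "\<dots> = C * lor \<xi>" by (simp add: C_def)
          also have "\<dots> \<le> \<bar>C\<bar> * \<bar>lor \<xi>\<bar>" by (metis abs_ge_self abs_mult)
          finally show ?thesis using True by (simp add: norm_mult)
        qed simp
        then show "AE p in lborel \<Otimes>\<^sub>M lborel. norm (case p of (t', \<xi>) \<Rightarrow> ?P t' \<xi> * ift \<phi> \<xi>)
           \<le> norm (case p of (t', \<xi>) \<Rightarrow> complex_of_real (indicator {0..t} t') * of_real C * complex_of_real (lor \<xi>))"
          by (intro AE_I2) (auto split: prod.split)
      qed
    qed
    have pr: "indicator {0..t} t' *\<^sub>R propagator \<eta> \<Phi> (t - t') (ux_sq (?u t')) \<phi> = (LBINT \<xi>. ?P t' \<xi> * ift \<phi> \<xi>)" for t'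
    proof (cases "t' \<in> {0..t}")
      case True
      then have t': "t - t' \<in> {0..T}" "t' \<in> {0..T}" using t by auto
      note nli = nl_integrable[OF w t'(2)]
      show ?thesis
        unfolding sq(1)[OF t'(2)] propag[OF t'(1) nli] ift_pairing[OF exp_int[OF t'(1) nli] \<phi>]
        using True by simp
    qed simp
    have I1: "integrable lborel (\<lambda>t'. LBINT \<xi>. ?P t' \<xi> * ift \<phi> \<xi>)"
      by (rule lborel_pair.integrable_fst[OF PI])
    have "set_integrable lebesgue {0..t} (\<lambda>t'. propagator \<eta> \<Phi> (t - t') (ux_sq (?u t')) \<phi>)"
      unfolding set_integrable_def pr
      using I1 integrable_completion[OF borel_measurable_integrable[OF I1]] by simp
    moreover have "(LINT t':{0..t}|lebesgue. propagator \<eta> \<Phi> (t - t') (ux_sq (?u t')) \<phi>) = (LBINT \<xi>. duh w w t \<xi> * ift \<phi> \<xi>)"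
    proof -
      have "(LINT t':{0..t}|lebesgue. propagator \<eta> \<Phi> (t - t') (ux_sq (?u t')) \<phi>) = (LBINT t'. LBINT \<xi>. ?P t' \<xi> * ift \<phi> \<xi>)"
        unfolding set_lebesgue_integral_def pr by (rule integral_completion[OF borel_measurable_integrable[OF I1]])
      also have "\<dots> = (LBINT \<xi>. LBINT t'. ?P t' \<xi> * ift \<phi> \<xi>)"
        by (rule lborel_pair.Fubini_integral[OF PI, symmetric])
      also have "\<dots> = (LBINT \<xi>. duh w w t \<xi> * ift \<phi> \<xi>)"
        unfolding duh_def by (simp only: integral_mult_left_zero)
      finally show ?thesis .
    qed
    moreover have "?u t \<phi> = propagator \<eta> \<Phi> t (dist_of (ift f)) \<phi> - (LBINT \<xi>. duh w w t \<xi> * ift \<phi> \<xi>)"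
    proof -
      have ip: "integrable lborel (\<lambda>\<xi>. g \<xi> * ift \<phi> \<xi>)" if g: "integrable lborel g" for g
      proof (rule Bochner_Integration.integrable_bound[OF integrable_mult_left[OF g, of "of_real B"]])
        have [measurable]: "g \<in> borel_measurable borel" using g borel_measurable_integrable by auto
        show "(\<lambda>\<xi>. g \<xi> * ift \<phi> \<xi>) \<in> borel_measurable lborel" by measurable
        show "AE \<xi> in lborel. norm (g \<xi> * ift \<phi> \<xi>) \<le> norm (g \<xi> * complex_of_real B)"
          using B B0 by (auto simp: norm_mult intro!: mult_left_mono AE_I2)
      qed
      have "?u t \<phi> = (LBINT \<xi>. w t \<xi> * ift \<phi> \<xi>)"
        using t ift_pairing[OF adm_integrable(1)[OF w t] \<phi>] by simp
      also have "\<dots> = (LBINT \<xi>. (exp (of_real t * m \<xi>) * f \<xi>) * ift \<phi> \<xi> - duh w w t \<xi> * ift \<phi> \<xi>)"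
        unfolding eq[OF t] free_def by (simp add: algebra_simps)
      also have "\<dots> = (LBINT \<xi>. (exp (of_real t * m \<xi>) * f \<xi>) * ift \<phi> \<xi>) - (LBINT \<xi>. duh w w t \<xi> * ift \<phi> \<xi>)"
        by (rule Bochner_Integration.integral_diff[OF ip[OF exp_int[OF t intf]] ip[OF adm_integrable(1)[OF adm_duh[OF w w] t]]])
      finally show ?thesis unfolding propag[OF t intf] ift_pairing[OF exp_int[OF t intf] \<phi>] .
    qed
    ultimately show ?thesis by simp
  qed
  show ?thesis unfolding solves_ivp_def
  proof (rule conjI[OF _ conjI])
    show "?u \<in> pts (CHs s T)" by (rule mild_solution_CHs[OF s w]) (rule eq)
    show "AE t' in lebesgue. t' \<in> {0..T} \<longrightarrow> ux_sq_defined (?u t')" using sq(2) by (intro AE_I2 impI)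
    show "\<forall>t\<in>{0..T}. \<forall>\<phi>. schwartz \<phi> \<longrightarrow>
        set_integrable lebesgue {0..t} (\<lambda>t'. propagator \<eta> \<Phi> (t - t') (ux_sq (?u t')) \<phi>) \<and>
        ?u t \<phi> = propagator \<eta> \<Phi> t (dist_of (ift f)) \<phi> -
          (LINT t':{0..t}|lebesgue. propagator \<eta> \<Phi> (t - t') (ux_sq (?u t')) \<phi>)"
      using main by blast
  qed
qed

end

section \<open>Two opposite frequency bumps\<close>

definition bumps :: "real \<Rightarrow> real \<Rightarrow> complex" where
  "bumps N \<xi> = of_real (indicator {N..N + 1} \<xi> + indicator {- N - 1..- N} \<xi>)"

lemma bumps_measurable [measurable]: "bumps N \<in> borel_measurable borel"
  unfolding bumps_def by measurable

lemma bumps_eq: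
  assumes "N \<ge> 1"
  shows "bumps N \<xi> = (if N \<le> \<bar>\<xi>\<bar> \<and> \<bar>\<xi>\<bar> \<le> N + 1 then 1 else 0)"
  using assms by (auto simp: bumps_def indicator_def)

lemma bumps_bound:
  assumes "N \<ge> 1" shows "norm (bumps N \<xi>) \<le> (1 + (N + 1)\<^sup>2)\<^sup>2 * (lor \<xi>)\<^sup>2"
proof (cases "N \<le> \<bar>\<xi>\<bar> \<and> \<bar>\<xi>\<bar> \<le> N + 1")
  case True
  then have "\<xi>\<^sup>2 \<le> (N + 1)\<^sup>2" using assms by (metis abs_ge_zero power2_abs power_mono)
  then have "1 \<le> (1 + (N + 1)\<^sup>2) * lor \<xi>" by (simp add: lor_def add_pos_nonneg)
  then have "1\<^sup>2 \<le> ((1 + (N + 1)\<^sup>2) * lor \<xi>)\<^sup>2" by (intro power_mono) auto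
  then show ?thesis using True assms by (simp add: bumps_eq power_mult_distrib)
next
  case False
  have "bumps N \<xi> = 0" unfolding bumps_eq[OF assms] using False by (rule if_not_P)
  then show ?thesis by simp
qed

lemma bumps_integrable: "N \<ge> 1 \<Longrightarrow> integrable lborel (bumps N)"
proof -
  assume N: "N \<ge> 1"
  have "norm (bumps N \<xi>) \<le> norm ((1 + (N + 1)\<^sup>2)\<^sup>2 * lor \<xi>)" for \<xi>
    using bumps_bound[OF N, of \<xi>] mult_left_mono[OF lor2_le_lor[of \<xi>], of "(1 + (N + 1)\<^sup>2)\<^sup>2"]
      abs_ge_self[of "(1 + (N + 1)\<^sup>2)\<^sup>2 * lor \<xi>"] by simp
  then show ?thesis
    by (intro Bochner_Integration.integrable_bound[OF integrable_mult_right[OF lor_integrable, of "(1 + (N + 1)\<^sup>2)\<^sup>2"]]) auto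
qed

lemma integrable_indicator_Icc: "integrable lborel (indicator {a..b::real} :: real \<Rightarrow> real)"
  by (rule integrable_real_indicator) (auto simp: emeasure_lborel_Icc_eq)

text \<open>
  For \<open>s \<le> 0\<close> the weight is largest at the inner end points, where it is at most \<open>N\<^sup>2\<^sup>s\<close>.
\<close>

lemma bumps_Hs:
  assumes N: "N \<ge> 1" and s: "s \<le> 0"
  shows "dist_of (ift (bumps N)) \<in> pts (Hs s)" "(nrm (Hs s) (dist_of (ift (bumps N))))\<^sup>2 \<le> 2 * N powr (2 * s)"
proof -
  have wi: "integrable lborel (\<lambda>\<xi>. wsq s \<xi> (bumps N \<xi>))"
    by (rule weight_sq_integrable[OF s bumps_measurable bumps_bound[OF N]])
  show "dist_of (ift (bumps N)) \<in> pts (Hs s)" by (rule Hs_ift(2)[OF bumps_integrable[OF N] wi])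
  let ?g = "\<lambda>\<xi>. N powr (2 * s) * (indicator {N..N + 1} \<xi> + indicator {- N - 1..- N} \<xi>)"
  have le: "wsq s \<xi> (bumps N \<xi>) \<le> ?g \<xi>" for \<xi>
  proof (cases "N \<le> \<bar>\<xi>\<bar> \<and> \<bar>\<xi>\<bar> \<le> N + 1")
    case True
    have "N\<^sup>2 \<le> \<xi>\<^sup>2" using True N by (metis power2_abs power_mono order_trans zero_le_one)
    then have "(1 + \<xi>\<^sup>2) powr s \<le> (N\<^sup>2) powr s" using s N by (intro powr_mono2') auto
    also have "\<dots> = N powr (2 * s)" using N by (simp add: powr_powr flip: powr_numeral)
    finally have "(1 + \<xi>\<^sup>2) powr s \<le> N powr (2 * s)" .
    moreover have "indicator {N..N + 1} \<xi> + indicator {- N - 1..- N} \<xi> = (1 :: real)"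
      using True N by (auto simp: indicator_def)
    ultimately show ?thesis using True N by (simp add: bumps_eq)
  next
    case False
    have "bumps N \<xi> = 0" unfolding bumps_eq[OF N] using False by (rule if_not_P)
    then show ?thesis by simp
  qed
  note ind = integrable_indicator_Icc
  have "(LBINT \<xi>. wsq s \<xi> (bumps N \<xi>)) \<le> (LBINT \<xi>. ?g \<xi>)"
    by (rule integral_mono[OF wi _ le]) (intro integrable_mult_right Bochner_Integration.integrable_add ind)
  also have "\<dots> = N powr (2 * s) * 2"
    by (subst integral_mult_right_zero, subst Bochner_Integration.integral_add[OF ind ind]) (use N in simp)
  finally have "(LBINT \<xi>. wsq s \<xi> (bumps N \<xi>)) \<le> 2 * N powr (2 * s)" by simp
  moreover have "0 \<le> (LBINT \<xi>. wsq s \<xi> (bumps N \<xi>))" by (intro Bochner_Integration.integral_nonneg) simp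
  ultimately show "(nrm (Hs s) (dist_of (ift (bumps N))))\<^sup>2 \<le> 2 * N powr (2 * s)"
    unfolding Hs_ift(1)[OF bumps_integrable[OF N]] by simp
qed

lemma Re_exp_lower:
  assumes "Re z \<ge> - 1" "\<bar>Im z\<bar> \<le> 1" shows "exp (- 1) / 2 \<le> Re (exp z)"
proof -
  have "1 \<le> pi / 3" using pi_gt3 by simp
  then have "cos (pi / 3) \<le> cos \<bar>Im z\<bar>" using assms(2) by (intro cos_monotone_0_pi_le) auto
  then have "1 / 2 \<le> cos (Im z)" by (simp add: cos_60)
  moreover have "exp (- 1) \<le> exp (Re z)" using assms(1) by simp
  ultimately have "exp (- 1) * (1 / 2) \<le> exp (Re z) * cos (Im z)" by (intro mult_mono) auto
  then show ?thesis by (simp add: Re_exp)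
qed

context duhamel
begin

text \<open>
  Up to times of order \<open>N\<^sup>-\<^sup>p\<close> the real part of the exponent, at most \<open>3 E (3 N)\<^sup>p t\<close> in modulus, is
  bounded. For the imaginary part, \<open>\<eta>\<^sup>3 + (\<xi> - \<eta>)\<^sup>3 = \<xi>\<^sup>3 - 3 \<xi> \<eta> (\<xi> - \<eta>)\<close> is of order \<open>N\<^sup>2\<close> only, and
  \<open>N\<^sup>2 t \<le> \<kappa>\<close> by \<open>p \<ge> 2\<close>.
\<close>

lemma low_frequency_phase:
  assumes im: "\<And>\<xi>. Im (m \<xi>) = \<xi> ^ 3" and re: "\<And>\<xi>. \<bar>Re (m \<xi>)\<bar> \<le> E * (1 + \<bar>\<xi>\<bar>) powr p"
    and p: "2 \<le> p" and N: "1 \<le> N" and k: "0 < \<kappa>" "\<kappa> \<le> 1 / 4" "3 * E * 3 powr p * \<kappa> \<le> 1"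
    and t: "0 \<le> t'" "t' \<le> t" "t = \<kappa> * N powr (- p)"
    and x: "\<bar>\<xi>\<bar> \<le> 1 / 4" and y: "\<bar>\<eta>\<bar> \<le> N + 1" "\<bar>\<xi> - \<eta>\<bar> \<le> N + 1"
  shows "exp (- 1) / 2 \<le> Re (exp (of_real (t - t') * m \<xi> + of_real t' * (m \<eta> + m (\<xi> - \<eta>))))"
proof (rule Re_exp_lower)
  have E: "0 \<le> E" using order_trans[OF abs_ge_zero re[of 0]] by simp
  have tN: "t * N powr p = \<kappa>" using N t(3) by (simp add: powr_minus field_simps)
  have small: "\<bar>Re (m \<zeta>)\<bar> \<le> E * (3 powr p * N powr p)" if "\<bar>\<zeta>\<bar> \<le> N + 1" for \<zeta>
  proof -
    have "(1 + \<bar>\<zeta>\<bar>) powr p \<le> (3 * N) powr p" using that N p by (intro powr_mono2) auto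
    then have "E * (1 + \<bar>\<zeta>\<bar>) powr p \<le> E * (3 powr p * N powr p)" using E N by (intro mult_left_mono) (simp_all add: powr_mult)
    then show ?thesis using re[of \<zeta>] by linarith
  qed
  define W where "W = E * (3 powr p * N powr p)"
  have W0: "0 \<le> W" using E by (simp add: W_def)
  have b: "\<bar>Re (m \<xi>)\<bar> \<le> W" "\<bar>Re (m \<eta>)\<bar> \<le> W" "\<bar>Re (m (\<xi> - \<eta>))\<bar> \<le> W"
    unfolding W_def using small x y N by auto
  have 1: "(t - t') * (- W) \<le> (t - t') * Re (m \<xi>)" using b t by (intro mult_left_mono) auto
  have 2: "t' * (- (2 * W)) \<le> t' * (Re (m \<eta>) + Re (m (\<xi> - \<eta>)))" using b t by (intro mult_left_mono) auto
  have "t' * W \<le> t * W" "0 \<le> t * W" using W0 t by (auto intro: mult_right_mono)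
  then have 3: "(t - t') * (- W) + t' * (- (2 * W)) \<ge> - (3 * (t * W))" by (simp add: algebra_simps)
  have "t * W = E * 3 powr p * (t * N powr p)" by (simp add: W_def)
  then have "3 * (t * W) \<le> 1" using k(3) unfolding tN by simp
  then show "- 1 \<le> Re (of_real (t - t') * m \<xi> + of_real t' * (m \<eta> + m (\<xi> - \<eta>)))"
    using 1 2 3 by simp
  have tN2: "t * N\<^sup>2 \<le> \<kappa>"
  proof -
    have "N\<^sup>2 \<le> N powr p" using N p powr_mono[of 2 p N] by simp
    then have "t * N\<^sup>2 \<le> t * N powr p" using t by (intro mult_left_mono) auto
    then show ?thesis unfolding tN .
  qed
  have im_eq: "Im (of_real (t - t') * m \<xi> + of_real t' * (m \<eta> + m (\<xi> - \<eta>))) = t * \<xi> ^ 3 - 3 * t' * (\<xi> * (\<eta> * (\<xi> - \<eta>)))"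
    by (simp add: im power3_eq_cube algebra_simps)
  have "\<bar>\<xi> ^ 3\<bar> \<le> 1 * N\<^sup>2"
  proof -
    have "\<bar>\<xi>\<bar> ^ 3 \<le> 1 ^ 3" using x by (intro power_mono) auto
    moreover have "1\<^sup>2 \<le> N\<^sup>2" using N by (intro power_mono) auto
    ultimately show ?thesis by (simp add: power_abs)
  qed
  moreover have t0: "0 \<le> t" using t by linarith
  ultimately have a: "\<bar>t * \<xi> ^ 3\<bar> \<le> t * N\<^sup>2"
    using mult_left_mono[of "\<bar>\<xi> ^ 3\<bar>" "1 * N\<^sup>2" t] by (simp only: abs_mult abs_of_nonneg mult_1)
  have "\<bar>\<xi> * (\<eta> * (\<xi> - \<eta>))\<bar> \<le> 1 / 4 * ((2 * N) * (2 * N))"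
    unfolding abs_mult using x y N by (intro mult_mono) auto
  then have "3 * t' * \<bar>\<xi> * (\<eta> * (\<xi> - \<eta>))\<bar> \<le> 3 * t * (1 / 4 * ((2 * N) * (2 * N)))"
    using t by (intro mult_mono) auto
  also have "\<dots> = 3 * (t * N\<^sup>2)" by (simp add: power2_eq_square)
  finally have b': "\<bar>3 * t' * (\<xi> * (\<eta> * (\<xi> - \<eta>)))\<bar> \<le> 3 * (t * N\<^sup>2)" using t by (simp add: abs_mult)
  show "\<bar>Im (of_real (t - t') * m \<xi> + of_real t' * (m \<eta> + m (\<xi> - \<eta>)))\<bar> \<le> 1"
    unfolding im_eq using a b' tN2 k(2) by linarith
qed

text \<open>
  The integrand of the double integral has a nonnegative real part throughout: an output \<open>\<bar>\<xi>\<bar> \<le> 1/4\<close> forces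
  \<open>\<eta>\<close> and \<open>\<xi> - \<eta>\<close> to have opposite signs, and \<open>- \<eta> (\<xi> - \<eta>) \<ge> N\<^sup>2\<close>. The interval
  \<open>N + 1/4 \<le> \<eta> \<le> N + 3/4\<close> lies in the support for every such \<open>\<xi>\<close>; its length 1/2, the factor \<open>exp (- 1) / 2\<close>
  from the phase and the factor \<open>1 / (2 \<pi>)\<close> make up the constant.
\<close>

lemma low_frequency_lower_bound:
  assumes im: "\<And>\<xi>. Im (m \<xi>) = \<xi> ^ 3" and re: "\<And>\<xi>. \<bar>Re (m \<xi>)\<bar> \<le> E * (1 + \<bar>\<xi>\<bar>) powr p"
    and p: "2 \<le> p" and N: "1 \<le> N" and k: "0 < \<kappa>" "\<kappa> \<le> 1 / 4" "3 * E * 3 powr p * \<kappa> \<le> 1"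
    and t: "t = \<kappa> * N powr (- p)" "t \<le> T" and x: "\<bar>\<xi>\<bar> \<le> 1 / 4"
  shows "\<kappa> * exp (- 1) / (8 * pi) * N powr (2 - p) \<le> norm (duh (free (bumps N)) (free (bumps N)) t \<xi>)"
proof -
  let ?e = "free (bumps N)"
  have e: "adm (exp (b * T) * (1 + (N + 1)\<^sup>2)\<^sup>2) ?e" by (rule adm_free[OF bumps_measurable bumps_bound[OF N]])
  have t0: "0 \<le> t" "t \<in> {0..T}" using t k by auto
  define c0 where "c0 = N\<^sup>2 * (exp (- 1) / 2)"
  have c0: "0 \<le> c0" by (simp add: c0_def)
  have inner: "1 / (2 * pi) * (c0 / 2) \<le> Re (exp (of_real (t - t') * m \<xi>) * nl (?e t') (?e t') \<xi>)"
    if t': "t' \<in> {0..t}" for t'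
  proof -
    have t'T: "t' \<in> {0..T}" using t' t by auto
    let ?f = "\<lambda>\<eta>. nlint (?e t') (?e t') \<xi> \<eta>"
    have i: "integrable lborel ?f" by (rule nl_integrand_adm[OF e e t'T])
    have i': "integrable lborel (\<lambda>\<eta>. exp (of_real (t - t') * m \<xi>) * ?f \<eta>)" by (rule integrable_mult_right[OF i])
    have le: "c0 * indicator {N + 1 / 4..N + 3 / 4} \<eta> \<le> Re (exp (of_real (t - t') * m \<xi>) * ?f \<eta>)" for \<eta>
    proof -
      let ?z = "of_real (t - t') * m \<xi> + of_real t' * (m \<eta> + m (\<xi> - \<eta>))"
      have "exp (of_real (t - t') * m \<xi>) * ?f \<eta> = of_real (- (\<eta> * (\<xi> - \<eta>))) * (bumps N \<eta> * bumps N (\<xi> - \<eta>)) * exp ?z"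
        by (simp add: free_def exp_add[symmetric] distrib_left mult_ac)
      moreover have "c0 * indicator {N + 1 / 4..N + 3 / 4} \<eta> \<le> Re (of_real (- (\<eta> * (\<xi> - \<eta>))) * (bumps N \<eta> * bumps N (\<xi> - \<eta>)) * exp ?z)"
      proof (cases "(N \<le> \<bar>\<eta>\<bar> \<and> \<bar>\<eta>\<bar> \<le> N + 1) \<and> (N \<le> \<bar>\<xi> - \<eta>\<bar> \<and> \<bar>\<xi> - \<eta>\<bar> \<le> N + 1)")
        case True
        have ph: "exp (- 1) / 2 \<le> Re (exp ?z)"
          using True t' by (intro low_frequency_phase[OF im re p N k _ _ t(1) x]) auto
        have "N * N \<le> \<bar>\<eta>\<bar> * \<bar>\<xi> - \<eta>\<bar>" using True N by (intro mult_mono) auto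
        moreover have "\<bar>\<eta>\<bar> * \<bar>\<xi> - \<eta>\<bar> = - (\<eta> * (\<xi> - \<eta>))"
        proof (cases "\<eta> \<ge> 0")
          case True': True
          then have "\<xi> - \<eta> \<le> 0" using True x N by auto
          then show ?thesis using True' by (simp add: algebra_simps)
        next
          case False
          then have "\<xi> - \<eta> \<ge> 0" using True x N by auto
          then show ?thesis using False by (simp add: algebra_simps)
        qed
        ultimately have q: "N\<^sup>2 \<le> - (\<eta> * (\<xi> - \<eta>))" by (simp add: power2_eq_square)
        have "c0 \<le> - (\<eta> * (\<xi> - \<eta>)) * Re (exp ?z)"
          unfolding c0_def by (rule mult_mono[OF q ph order_trans[OF zero_le_power2 q]]) simp
        moreover have "c0 * indicator {N + 1 / 4..N + 3 / 4} \<eta> \<le> c0" using c0 by (simp add: indicator_def)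
        moreover have "of_real (- (\<eta> * (\<xi> - \<eta>))) * (bumps N \<eta> * bumps N (\<xi> - \<eta>)) * exp ?z = of_real (- (\<eta> * (\<xi> - \<eta>))) * exp ?z"
          using True N by (simp add: bumps_eq)
        ultimately show ?thesis by (simp only: Re_complex_of_real Im_complex_of_real times_complex.sel)
      next
        case False
        then have "\<eta> \<notin> {N + 1 / 4..N + 3 / 4}" using x N by auto
        moreover have "bumps N \<eta> * bumps N (\<xi> - \<eta>) = 0" using False N by (auto simp: bumps_eq)
        ultimately show ?thesis
          by (simp only: indicator_simps mult_zero_right mult_zero_left zero_complex.sel order.refl not_False_eq_True)
      qed
      ultimately show ?thesis by simp
    qed
    have ind: "integrable lborel (\<lambda>\<eta>. c0 * indicator {N + 1 / 4..N + 3 / 4} \<eta>)"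
      by (intro integrable_mult_right integrable_indicator_Icc)
    have "c0 / 2 = (LBINT \<eta>. c0 * indicator {N + 1 / 4..N + 3 / 4} \<eta>)" by simp
    also have "\<dots> \<le> (LBINT \<eta>. Re (exp (of_real (t - t') * m \<xi>) * ?f \<eta>))"
      by (rule integral_mono[OF ind integrable_Re[OF i'] le])
    also have "\<dots> = Re (exp (of_real (t - t') * m \<xi>) * (LBINT \<eta>. ?f \<eta>))"
      unfolding integral_Re[OF i'] integral_mult_right_zero ..
    finally have "1 / (2 * pi) * (c0 / 2) \<le> 1 / (2 * pi) * Re (exp (of_real (t - t') * m \<xi>) * (LBINT \<eta>. ?f \<eta>))"
      by (intro mult_left_mono) auto
    also have "\<dots> = Re (of_real (1 / (2 * pi)) * (exp (of_real (t - t') * m \<xi>) * (LBINT \<eta>. ?f \<eta>)))"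
      by (simp only: Re_complex_of_real Im_complex_of_real times_complex.sel)
    also have "of_real (1 / (2 * pi)) * (exp (of_real (t - t') * m \<xi>) * (LBINT \<eta>. ?f \<eta>)) = exp (of_real (t - t') * m \<xi>) * nl (?e t') (?e t') \<xi>"
      unfolding nl_def conv_def by (rule mult.left_commute)
    finally show ?thesis .
  qed
  have "t * (1 / (2 * pi) * (c0 / 2)) = (LBINT t'. indicator {0..t} t' *\<^sub>R (1 / (2 * pi) * (c0 / 2)))"
    using t0 by simp
  also have "\<dots> \<le> (LBINT t'. Re (dint ?e ?e t \<xi> t'))"
  proof (rule integral_mono)
    show "integrable lborel (\<lambda>t'. indicator {0..t} t' *\<^sub>R (1 / (2 * pi) * (c0 / 2)))"
      by (intro integrable_scaleR_left integrable_indicator_Icc)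
    show "integrable lborel (\<lambda>t'. Re (dint ?e ?e t \<xi> t'))"
      by (rule integrable_Re[OF duh_integrand(2)[OF e e t0(2)]])
    show "indicator {0..t} t' *\<^sub>R (1 / (2 * pi) * (c0 / 2)) \<le> Re (dint ?e ?e t \<xi> t')" for t'
      using inner[of t'] by (cases "t' \<in> {0..t}") (simp_all del: times_complex.sel)
  qed
  also have "\<dots> = Re (duh ?e ?e t \<xi>)" unfolding duh_def by (rule integral_Re[OF duh_integrand(2)[OF e e t0(2)]])
  also have "\<dots> \<le> norm (duh ?e ?e t \<xi>)" by (rule complex_Re_le_cmod)
  finally have "t * (1 / (2 * pi) * (c0 / 2)) \<le> norm (duh ?e ?e t \<xi>)" .
  moreover have "t * (1 / (2 * pi) * (c0 / 2)) = \<kappa> * exp (- 1) / (8 * pi) * N powr (2 - p)"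
  proof -
    have "N powr (2 - p) = N\<^sup>2 * N powr (- p)" using N powr_add[of N 2 "- p"] by simp
    then show ?thesis unfolding t(1) c0_def by simp
  qed
  ultimately show ?thesis by simp
qed

text \<open>
  The value \<open>v\<close> of the flow map at \<open>\<gamma>\<close> times the datum is the constructed solution, hence has the
  expansion into \<open>\<gamma>\<close> times the free solution, \<open>\<gamma>\<^sup>2\<close> times the Duhamel term and a cubic remainder. The case
  \<open>\<gamma> = 0\<close> is included and gives the value at the origin.
\<close>

lemma solution_expansion:
  assumes s: "s \<le> 0" and \<Phi>: "\<Phi> \<in> borel_measurable lebesgue"
    and ae: "AE \<xi> in lebesgue. m \<xi> = \<i> * of_real (\<xi> ^ 3) + of_real (\<eta> * \<Phi> \<xi>)"
    and f [measurable]: "f \<in> borel_measurable borel" and F: "\<And>\<xi>. norm (f \<xi>) \<le> F * (lor \<xi>)\<^sup>2"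
    and g: "0 \<le> \<gamma>" "8 * M * (\<gamma> * (exp (b * T) * F)) \<le> 1"
    and uniq: "\<And>u. solves_ivp s \<eta> \<Phi> T (\<gamma> *\<^sub>R dist_of (ift f)) u \<Longrightarrow> u = v"
  shows "\<exists>w. adm (2 * (\<gamma> * (exp (b * T) * F))) w \<and> (\<forall>t\<in>{0..T}. v t = dist_of (ift (w t)) \<and>
     (\<forall>\<xi>. norm (w t \<xi> - (of_real \<gamma> * free f t \<xi> - of_real (\<gamma>\<^sup>2) * duh (free f) (free f) t \<xi>)) \<le> 12 * M\<^sup>2 * (\<gamma> * (exp (b * T) * F)) ^ 3 * (lor \<xi>)\<^sup>2))"
proof -
  define f' where "f' \<xi> = of_real \<gamma> * f \<xi>" for \<xi>
  have [measurable]: "f' \<in> borel_measurable borel" unfolding f'_def by measurable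
  have F': "norm (f' \<xi>) \<le> (\<gamma> * F) * (lor \<xi>)\<^sup>2" for \<xi>
    using mult_left_mono[OF F[of \<xi>] g(1)] g(1) by (simp add: f'_def norm_mult mult.assoc)
  have fr: "free f' = (\<lambda>t \<xi>. of_real \<gamma> * free f t \<xi>)" by (simp add: free_def f'_def fun_eq_iff mult_ac)
  have e: "adm (\<gamma> * (exp (b * T) * F)) (free f')"
    using adm_free[OF _ F'] by (simp add: mult.left_commute)
  obtain w where w: "adm (2 * (\<gamma> * (exp (b * T) * F))) w" and eq: "\<forall>t\<in>{0..T}. \<forall>\<xi>. w t \<xi> = free f' t \<xi> - duh w w t \<xi>"
    using fixed_point[OF e g(2)] by blast
  have intf: "integrable lborel f"
  proof -
    have "adm (exp (b * T) * F) (free f)" by (rule adm_free[OF f F])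
    moreover have "free f 0 = f" by (rule ext) (simp add: free_def)
    ultimately show ?thesis using adm_integrable(1)[of _ "free f" 0] params by simp
  qed
  have "\<gamma> *\<^sub>R dist_of (ift f) = dist_of (ift f')"
    using ift_lincomb[OF intf intf, of \<gamma> 0] by (simp add: f'_def[abs_def] scaleR_conv_of_real)
  then have "(\<lambda>t. if t \<in> {0..T} then dist_of (ift (w t)) else 0) = v"
    by (intro uniq) (use mild_solution_solves[OF s \<Phi> ae _ F' w] eq in simp)
  then have "v t = dist_of (ift (w t))" if "t \<in> {0..T}" for t using that by auto
  moreover have "norm (w t \<xi> - (of_real \<gamma> * free f t \<xi> - of_real (\<gamma>\<^sup>2) * duh (free f) (free f) t \<xi>)) \<le> 12 * M\<^sup>2 * (\<gamma> * (exp (b * T) * F)) ^ 3 * (lor \<xi>)\<^sup>2"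
    if "t \<in> {0..T}" for t \<xi>
    using second_order_expansion[OF e w eq that, of \<xi>] unfolding fr duh_scale .
  ultimately show ?thesis using w by blast
qed

text \<open>
  In the second difference at \<open>\<gamma> h\<close> the free solutions cancel, and \<open>- 2 \<gamma>\<^sup>2\<close> times the Duhamel term remains, up
  to an error \<open>R \<gamma>\<^sup>3\<close>. For small \<open>\<gamma>\<close> this leaves at least \<open>\<gamma>\<^sup>2 L\<close> on the low frequencies, where the Sobolev
  weight is at least \<open>2\<^sup>s\<close> and which have total length 1/2.
\<close>

lemma flow_second_derivative_bound:
  assumes s: "s \<le> 0" and \<Phi>: "\<Phi> \<in> borel_measurable lebesgue"
    and ae: "AE \<xi> in lebesgue. m \<xi> = \<i> * of_real (\<xi> ^ 3) + of_real (\<eta> * \<Phi> \<xi>)"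
    and r: "r > 0" and S: "\<And>u0 u. u0 \<in> pts (Hs s) \<Longrightarrow> nrm (Hs s) u0 < r \<Longrightarrow> solves_ivp s \<eta> \<Phi> T u0 u \<Longrightarrow> u = S u0"
    and \<delta>: "\<delta> > 0" and K: "\<And>h. h \<in> pts (Hs s) \<Longrightarrow> nrm (Hs s) h < \<delta> \<Longrightarrow>
           S (2 *\<^sub>R h) \<in> pts (CHs s T) \<and> S h \<in> pts (CHs s T) \<and> S 0 \<in> pts (CHs s T) \<and>
           nrm (CHs s T) (S (2 *\<^sub>R h) - S h - (S h - S 0)) \<le> K * (nrm (Hs s) h)\<^sup>2"
    and f [measurable]: "f \<in> borel_measurable borel" and F: "\<And>\<xi>. norm (f \<xi>) \<le> F * (lor \<xi>)\<^sup>2"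
    and t: "t \<in> {0..T}" and L: "L > 0" "\<And>\<xi>. \<bar>\<xi>\<bar> \<le> 1 / 4 \<Longrightarrow> L \<le> norm (duh (free f) (free f) t \<xi>)"
  shows "1 / 2 * 2 powr s * L\<^sup>2 \<le> (K * (nrm (Hs s) (dist_of (ift f)))\<^sup>2)\<^sup>2"
proof -
  note HD = seminormedD[OF seminormed_Hs[of s]]
  have T0: "0 \<le> T" using params by simp
  note CD = seminormedD[OF seminormed_CHs[OF T0, of s]]
  define G where "G = exp (b * T) * F"
  have e: "adm G (free f)" unfolding G_def by (rule adm_free[OF f F])
  have G0: "0 \<le> G" by (rule admD(1)[OF e])
  have intf: "integrable lborel f"
  proof -
    have "free f 0 = f" by (rule ext) (simp add: free_def)
    then show ?thesis using adm_integrable(1)[OF e, of 0] params by simp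
  qed
  define h where "h = dist_of (ift f)"
  have h: "h \<in> pts (Hs s)" unfolding h_def by (rule Hs_ift(2)[OF intf weight_sq_integrable[OF s f F]])
  define n where "n = nrm (Hs s) h"
  have n0: "0 \<le> n" unfolding n_def by (rule HD(2)[OF h])
  \<comment> \<open>The cubic remainders are \<open>12 M\<^sup>2 G\<^sup>3\<close> times \<open>(2 \<gamma>)\<^sup>3\<close> and, twice, times \<open>\<gamma>\<^sup>3\<close>, hence
    \<open>12 (8 + 2)\<close>.\<close>
  define R where "R = 120 * M\<^sup>2 * G ^ 3"
  have R0: "0 \<le> R" using G0 by (simp add: R_def)
  obtain \<gamma> where g: "\<gamma> > 0" "16 * M * G * \<gamma> \<le> 1" "2 * n * \<gamma> < r" "n * \<gamma> < \<delta>" "R * \<gamma> \<le> L"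
  proof -
    have lim: "((\<lambda>\<gamma>. a * \<gamma>) \<longlongrightarrow> 0) (at_right 0)" for a :: real
      by (auto intro!: tendsto_eq_intros)
    have "eventually (\<lambda>\<gamma>. \<gamma> > 0 \<and> 16 * M * G * \<gamma> < 1 \<and> 2 * n * \<gamma> < r \<and> n * \<gamma> < \<delta> \<and> R * \<gamma> < L) (at_right 0)"
      by (intro eventually_conj eventually_at_right_less order_tendstoD(2)[OF lim]) (use r \<delta> L in auto)
    from eventually_happens'[OF _ this] show ?thesis using that by force
  qed
  have exp: "\<exists>w. adm (2 * (\<beta> * G)) w \<and> (\<forall>t\<in>{0..T}. S (\<beta> *\<^sub>R h) t = dist_of (ift (w t)) \<and>
     (\<forall>\<xi>. norm (w t \<xi> - (of_real \<beta> * free f t \<xi> - of_real (\<beta>\<^sup>2) * duh (free f) (free f) t \<xi>)) \<le> 12 * M\<^sup>2 * (\<beta> * G) ^ 3 * (lor \<xi>)\<^sup>2))"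
    if b: "0 \<le> \<beta>" "\<beta> \<le> 2 * \<gamma>" for \<beta>
  proof -
    have b1: "8 * M * (\<beta> * G) \<le> 1"
    proof -
      have "8 * M * (\<beta> * G) \<le> 8 * M * (2 * \<gamma> * G)" using b G0 M_pos by (intro mult_left_mono mult_right_mono) auto
      then show ?thesis using g(2) by (simp add: mult_ac)
    qed
    have b2: "nrm (Hs s) (\<beta> *\<^sub>R h) < r"
    proof -
      have "nrm (Hs s) (\<beta> *\<^sub>R h) \<le> \<beta> * n" using HD(6)[OF h, of \<beta>] b by (simp add: n_def)
      also have "\<dots> \<le> 2 * \<gamma> * n" using b n0 by (intro mult_right_mono)
      finally show ?thesis using g(3) by (simp add: mult_ac)
    qed
    show ?thesis
      unfolding G_def
      by (rule solution_expansion[OF s \<Phi> ae f F b(1)])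
        (use b1 S[OF HD(5)[OF h] b2] in \<open>simp_all add: G_def h_def\<close>)
  qed
  obtain w2 where w2: "adm (2 * (2 * \<gamma> * G)) w2" "S (2 *\<^sub>R (\<gamma> *\<^sub>R h)) t = dist_of (ift (w2 t))"
    "\<And>\<xi>. norm (w2 t \<xi> - (of_real (2 * \<gamma>) * free f t \<xi> - of_real ((2 * \<gamma>)\<^sup>2) * duh (free f) (free f) t \<xi>)) \<le> 12 * M\<^sup>2 * (2 * \<gamma> * G) ^ 3 * (lor \<xi>)\<^sup>2"
    using exp[of "2 * \<gamma>"] g(1) t by fastforce
  obtain w1 where w1: "adm (2 * (\<gamma> * G)) w1" "S (\<gamma> *\<^sub>R h) t = dist_of (ift (w1 t))"
    "\<And>\<xi>. norm (w1 t \<xi> - (of_real \<gamma> * free f t \<xi> - of_real (\<gamma>\<^sup>2) * duh (free f) (free f) t \<xi>)) \<le> 12 * M\<^sup>2 * (\<gamma> * G) ^ 3 * (lor \<xi>)\<^sup>2"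
    using exp[of "\<gamma>"] g(1) t by fastforce
  obtain w0 where w0: "adm (2 * (0 * G)) w0" "S (0 *\<^sub>R h) t = dist_of (ift (w0 t))"
    using exp[of 0] g(1) t by fastforce
  define z where "z \<xi> = w2 t \<xi> - w1 t \<xi> - (w1 t \<xi> - w0 t \<xi>)" for \<xi>
  have iz: "integrable lborel z"
    unfolding z_def by (intro Bochner_Integration.integrable_diff adm_integrable(1)[OF w2(1)] adm_integrable(1)[OF w1(1)] adm_integrable(1)[OF w0(1)] t)
  have Zeq: "(S (2 *\<^sub>R (\<gamma> *\<^sub>R h)) - S (\<gamma> *\<^sub>R h) - (S (\<gamma> *\<^sub>R h) - S 0)) t = dist_of (ift z)"
  proof -
    have i: "integrable lborel (w2 t)" "integrable lborel (w1 t)" "integrable lborel (w0 t)"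
      using adm_integrable(1) w2(1) w1(1) w0(1) t by blast+
    have "dist_of (ift (w2 t)) - dist_of (ift (w1 t)) = dist_of (ift (\<lambda>\<xi>. w2 t \<xi> - w1 t \<xi>))"
      "dist_of (ift (w1 t)) - dist_of (ift (w0 t)) = dist_of (ift (\<lambda>\<xi>. w1 t \<xi> - w0 t \<xi>))"
      using ift_lincomb[OF i(1,2), of 1 "-1"] ift_lincomb[OF i(2,3), of 1 "-1"] by simp_all
    moreover have "dist_of (ift (\<lambda>\<xi>. w2 t \<xi> - w1 t \<xi>)) - dist_of (ift (\<lambda>\<xi>. w1 t \<xi> - w0 t \<xi>)) = dist_of (ift z)"
      using ift_lincomb[OF Bochner_Integration.integrable_diff[OF i(1,2)] Bochner_Integration.integrable_diff[OF i(2,3)], of 1 "-1"]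
      by (simp add: z_def[abs_def])
    ultimately show ?thesis using w2(2) w1(2) w0(2) by (simp only: minus_apply scaleR_zero_left)
  qed
  have w00: "w0 t \<xi> = 0" for \<xi> using admD(3)[OF w0(1) t, of \<xi>] by simp
  have zlow: "\<gamma>\<^sup>2 * L \<le> norm (z \<xi>)" if x: "\<bar>\<xi>\<bar> \<le> 1 / 4" for \<xi>
  proof -
    let ?D = "duh (free f) (free f) t \<xi>"
    let ?r2 = "w2 t \<xi> - (of_real (2 * \<gamma>) * free f t \<xi> - of_real ((2 * \<gamma>)\<^sup>2) * ?D)"
    let ?r1 = "w1 t \<xi> - (of_real \<gamma> * free f t \<xi> - of_real (\<gamma>\<^sup>2) * ?D)"
    have l1: "(lor \<xi>)\<^sup>2 \<le> 1" using lor_pos[of \<xi>] lor_le_1[of \<xi>] by (simp add: power_le_one)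
    have rb: "norm ?r2 \<le> 96 * M\<^sup>2 * (\<gamma> * G) ^ 3" "norm ?r1 \<le> 12 * M\<^sup>2 * (\<gamma> * G) ^ 3"
    proof -
      have p: "0 \<le> 12 * M\<^sup>2 * (2 * \<gamma> * G) ^ 3" "0 \<le> 12 * M\<^sup>2 * (\<gamma> * G) ^ 3" using g(1) G0 by simp_all
      show "norm ?r2 \<le> 96 * M\<^sup>2 * (\<gamma> * G) ^ 3"
        using w2(3)[of \<xi>] mult_left_mono[OF l1 p(1)] by (simp add: power_mult_distrib)
      show "norm ?r1 \<le> 12 * M\<^sup>2 * (\<gamma> * G) ^ 3"
        using w1(3)[of \<xi>] mult_left_mono[OF l1 p(2)] by simp
    qed
    have zeq: "z \<xi> = ?r2 - 2 * ?r1 - of_real (2 * \<gamma>\<^sup>2) * ?D"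
      by (simp add: z_def w00 power_mult_distrib algebra_simps)
    have tri: "norm d \<le> norm r2 + 2 * norm r1 + norm z" if "z = r2 - 2 * r1 - d" for z r2 r1 d :: complex
    proof -
      have "d = (r2 - 2 * r1) - z" using that by simp
      then have "norm d \<le> norm (r2 - 2 * r1) + norm z" by (simp only: norm_triangle_ineq4)
      also have "norm (r2 - 2 * r1) \<le> norm r2 + norm (2 * r1)" by (rule norm_triangle_ineq4)
      finally show ?thesis by (simp add: norm_mult)
    qed
    have "norm (of_real (2 * \<gamma>\<^sup>2) * ?D) \<le> norm ?r2 + 2 * norm ?r1 + norm (z \<xi>)"
      by (rule tri[OF zeq])
    also have "norm ?r2 + 2 * norm ?r1 \<le> 96 * M\<^sup>2 * (\<gamma> * G) ^ 3 + 2 * (12 * M\<^sup>2 * (\<gamma> * G) ^ 3)"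
      using rb by (intro add_mono mult_left_mono) auto
    also have "\<dots> = R * \<gamma> * \<gamma>\<^sup>2"
      by (simp add: R_def power_mult_distrib power2_eq_square power3_eq_cube mult_ac)
    also have "\<dots> \<le> L * \<gamma>\<^sup>2" using g(5) by (intro mult_right_mono) auto
    finally have "2 * \<gamma>\<^sup>2 * norm ?D \<le> L * \<gamma>\<^sup>2 + norm (z \<xi>)"
      by (simp only: norm_mult norm_of_real) simp
    moreover have "2 * \<gamma>\<^sup>2 * L \<le> 2 * \<gamma>\<^sup>2 * norm ?D" using L(2)[OF x] by (intro mult_left_mono) auto
    ultimately show ?thesis by (simp add: algebra_simps)
  qed
  have zi: "integrable lborel (\<lambda>\<xi>. wsq s \<xi> (z \<xi>))"
  proof (rule weight_sq_integrable[OF s])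
    show "z \<in> borel_measurable borel" using iz borel_measurable_integrable by auto
    show "norm (z \<xi>) \<le> (2 * (2 * \<gamma> * G) + 2 * (\<gamma> * G) + (2 * (\<gamma> * G))) * (lor \<xi>)\<^sup>2" for \<xi>
    proof -
      have "norm (z \<xi>) \<le> norm (w2 t \<xi>) + norm (w1 t \<xi>) + norm (w1 t \<xi>)"
        unfolding z_def w00 by (rule order_trans[OF norm_triangle_ineq4]) (use norm_triangle_ineq4[of "w2 t \<xi>" "w1 t \<xi>"] in simp)
      also have "\<dots> \<le> 2 * (2 * \<gamma> * G) * (lor \<xi>)\<^sup>2 + 2 * (\<gamma> * G) * (lor \<xi>)\<^sup>2 + 2 * (\<gamma> * G) * (lor \<xi>)\<^sup>2"
        by (intro add_mono admD(3)[OF w2(1) t] admD(3)[OF w1(1) t])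
      finally show ?thesis by (simp add: algebra_simps)
    qed
  qed
  have low: "1 / 2 * 2 powr s * (\<gamma>\<^sup>2 * L)\<^sup>2 \<le> (nrm (Hs s) (dist_of (ift z)))\<^sup>2"
  proof -
    let ?c = "2 powr s * (\<gamma>\<^sup>2 * L)\<^sup>2"
    have "?c * indicator {- 1 / 4..1 / 4 :: real} \<xi> \<le> wsq s \<xi> (z \<xi>)" for \<xi>
    proof (cases "\<bar>\<xi>\<bar> \<le> 1 / 4")
      case True
      have "\<xi>\<^sup>2 \<le> 1" using True by (simp add: abs_square_le_1)
      then have "2 powr s \<le> (1 + \<xi>\<^sup>2) powr s" using s by (intro powr_mono2') (auto simp: add_pos_nonneg)
      moreover have "(\<gamma>\<^sup>2 * L)\<^sup>2 \<le> (norm (z \<xi>))\<^sup>2" using zlow[OF True] L by (intro power_mono) auto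
      ultimately have "?c \<le> wsq s \<xi> (z \<xi>)" by (intro mult_mono) auto
      then show ?thesis by (simp add: indicator_def)
    next
      case False then show ?thesis by (auto simp: indicator_def)
    qed
    moreover have "integrable lborel (\<lambda>\<xi>. ?c * indicator {- 1 / 4..1 / 4 :: real} \<xi>)"
      by (intro integrable_mult_right integrable_indicator_Icc)
    ultimately have "(LBINT \<xi>. ?c * indicator {- 1 / 4..1 / 4 :: real} \<xi>) \<le> (LBINT \<xi>. wsq s \<xi> (z \<xi>))"
      by (intro integral_mono zi)
    moreover have "0 \<le> (LBINT \<xi>. wsq s \<xi> (z \<xi>))" by (intro Bochner_Integration.integral_nonneg) simp
    ultimately show ?thesis unfolding Hs_ift(1)[OF iz] by simp
  qed
  have "nrm (Hs s) (\<gamma> *\<^sub>R h) \<le> \<gamma> * n" using HD(6)[OF h, of \<gamma>] g(1) by (simp add: n_def)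
  then have gn: "nrm (Hs s) (\<gamma> *\<^sub>R h) < \<delta>" "(nrm (Hs s) (\<gamma> *\<^sub>R h))\<^sup>2 \<le> (\<gamma> * n)\<^sup>2"
    using g(4) HD(2)[OF HD(5)[OF h, of \<gamma>]] by (auto simp: mult.commute intro: power_mono)
  note Kh = K[OF HD(5)[OF h] gn(1)]
  have "nrm (Hs s) (dist_of (ift z)) \<le> nrm (CHs s T) (S (2 *\<^sub>R (\<gamma> *\<^sub>R h)) - S (\<gamma> *\<^sub>R h) - (S (\<gamma> *\<^sub>R h) - S 0))"
    unfolding Zeq[symmetric] by (rule CHs_upper[OF _ t]) (intro CD(7); use Kh in blast)
  also have "\<dots> \<le> K * (nrm (Hs s) (\<gamma> *\<^sub>R h))\<^sup>2" using Kh by blast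
  also have "\<dots> \<le> \<bar>K\<bar> * (\<gamma> * n)\<^sup>2" using gn(2) by (intro mult_mono) auto
  finally have "(nrm (Hs s) (dist_of (ift z)))\<^sup>2 \<le> (\<bar>K\<bar> * (\<gamma> * n)\<^sup>2)\<^sup>2"
    by (rule power_mono) (simp add: Hs_def)
  with low have "1 / 2 * 2 powr s * (\<gamma>\<^sup>2 * L)\<^sup>2 \<le> (\<bar>K\<bar> * (\<gamma> * n)\<^sup>2)\<^sup>2" by linarith
  then have "(\<gamma>\<^sup>2)\<^sup>2 * (1 / 2 * 2 powr s * L\<^sup>2) \<le> (\<gamma>\<^sup>2)\<^sup>2 * (K * n\<^sup>2)\<^sup>2"
    by (simp add: power_mult_distrib mult_ac)
  then show ?thesis using g(1) by (simp add: n_def h_def)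
qed

end

section \<open>Ill-posedness\<close>

text \<open>
  As \<open>q < p\<close>, the perturbation is at most half of \<open>x\<^sup>p\<close> beyond the radius \<open>R\<close> and bounded within it;
  \<open>p \<ge> 2\<close> turns the remaining half of \<open>x\<^sup>p\<close> into a quadratic term.
\<close>

lemma symbol_upper:
  assumes p: "2 \<le> p" and q: "0 \<le> q" "q < p" and C: "0 \<le> (C::real)"
  shows "\<exists>b\<ge>0. \<forall>x\<ge>0. - (x powr p) + C * (1 + x powr q) \<le> b - 1 / 2 * (1 + x\<^sup>2)"
proof -
  define R where "R = (2 * C + 1) powr (1 / (p - q))"
  have R1: "1 \<le> R" using C q by (auto simp: R_def intro!: ge_one_powr_ge_zero)
  have RR: "R powr (p - q) = 2 * C + 1" using C q by (simp add: R_def powr_powr)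
  have "- (x powr p) + C * (1 + x powr q) \<le> (C + C * R powr q + 1) - 1 / 2 * (1 + x\<^sup>2)" if x: "0 \<le> x" for x
  proof -
    have 1: "C * x powr q \<le> C * R powr q + x powr p / 2"
    proof (cases "x \<le> R")
      case True
      then have "C * x powr q \<le> C * R powr q" using x q C by (intro mult_left_mono powr_mono2) auto
      then show ?thesis by (simp add: add_increasing2)
    next
      case False
      then have "2 * C \<le> x powr (p - q)" using RR powr_mono2[of "p - q" R x] q R1 by simp
      then have "2 * C * x powr q \<le> x powr (p - q) * x powr q" by (intro mult_right_mono) auto
      also have "\<dots> = x powr p" using False R1 by (simp flip: powr_add)
      finally have "C * x powr q \<le> x powr p / 2" by simp
      moreover have "0 \<le> C * R powr q" using C by simp
      ultimately show ?thesis by linarith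
    qed
    have 2: "x\<^sup>2 - 1 \<le> x powr p"
    proof (cases "x \<ge> 1")
      case True
      then have "x powr 2 \<le> x powr p" using p by (intro powr_mono) auto
      then show ?thesis using True by simp
    next
      case False
      then have "x\<^sup>2 \<le> 1" using x by (simp add: power_le_one)
      then show ?thesis by (meson diff_le_0_iff_le order_trans powr_ge_zero)
    qed
    show ?thesis using 1 2 by (simp add: algebra_simps)
  qed
  moreover have "0 \<le> C + C * R powr q + 1" using C by simp
  ultimately show ?thesis by blast
qed

lemma symbol_growth:
  assumes p: "2 \<le> p" and q: "0 \<le> q" "q < p" and C: "0 \<le> (C::real)" and y: "\<bar>y\<bar> \<le> C * (1 + \<bar>x\<bar> powr q)"
  shows "\<bar>- (\<bar>x\<bar> powr p) + y\<bar> \<le> (1 + 2 * C) * (1 + \<bar>x\<bar>) powr p"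
proof -
  let ?P = "(1 + \<bar>x\<bar>) powr p"
  have 1: "\<bar>x\<bar> powr p \<le> ?P" using p by (intro powr_mono2) auto
  have 2: "1 \<le> ?P" using p by (intro ge_one_powr_ge_zero) auto
  have "\<bar>x\<bar> powr q \<le> (1 + \<bar>x\<bar>) powr q" using q by (intro powr_mono2) auto
  also have "\<dots> \<le> ?P" using q by (intro powr_mono) auto
  finally have "C * (1 + \<bar>x\<bar> powr q) \<le> C * (?P + ?P)" using 2 C by (intro mult_left_mono add_mono) auto
  then have "\<bar>y\<bar> \<le> 2 * C * ?P" using y by simp
  moreover have "\<bar>- (\<bar>x\<bar> powr p) + y\<bar> \<le> \<bar>x\<bar> powr p + \<bar>y\<bar>" using abs_triangle_ineq[of "- (\<bar>x\<bar> powr p)" y] by simp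
  ultimately show ?thesis using 1 by (simp add: algebra_simps)
qed

theorem theorem1p4:
  fixes \<eta> p q s C :: real and \<Phi> \<Phi>1 :: "real \<Rightarrow> real"
  assumes "\<eta> > 0" and "p \<ge> 2" and "s < 1 - p / 2"
    and "\<And>\<xi>. \<Phi> \<xi> = - (\<bar>\<xi>\<bar> powr p) + \<Phi>1 \<xi>"
    and "\<Phi>1 \<in> borel_measurable lebesgue"
    and "0 \<le> q" and "q < p"
    and "\<And>\<xi>. \<bar>\<Phi>1 \<xi>\<bar> \<le> C * (1 + \<bar>\<xi>\<bar> powr q)"
  shows "\<not> (\<exists>T>0. \<exists>r>0. \<exists>S :: dist \<Rightarrow> real \<Rightarrow> dist.
            (\<forall>u0\<in>pts (Hs s). nrm (Hs s) u0 < r \<longrightarrow>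
               (\<forall>u. solves_ivp s \<eta> \<Phi> T u0 u \<longleftrightarrow> u = S u0)) \<and>
            C2_at (Hs s) (CHs s T) S 0)"
proof
  assume "\<exists>T>0. \<exists>r>0. \<exists>S :: dist \<Rightarrow> real \<Rightarrow> dist.
            (\<forall>u0\<in>pts (Hs s). nrm (Hs s) u0 < r \<longrightarrow>
               (\<forall>u. solves_ivp s \<eta> \<Phi> T u0 u \<longleftrightarrow> u = S u0)) \<and>
            C2_at (Hs s) (CHs s T) S 0"
  then obtain T r S where T: "T > 0" and r: "r > 0"
    and S: "\<And>u0 u. u0 \<in> pts (Hs s) \<Longrightarrow> nrm (Hs s) u0 < r \<Longrightarrow> solves_ivp s \<eta> \<Phi> T u0 u \<Longrightarrow> u = S u0"
    and C2: "C2_at (Hs s) (CHs s T) S 0"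
    by blast
  have s: "s \<le> 0" using assms(2,3) by simp
  have C: "0 \<le> C" using order_trans[OF abs_ge_zero assms(8)[of 1]] by simp
  have abs_meas: "(\<lambda>\<xi>::real. - (\<bar>\<xi>\<bar> powr p)) \<in> borel_measurable borel" by measurable
  have \<Phi>m: "\<Phi> \<in> borel_measurable lebesgue"
  proof -
    have "(\<lambda>\<xi>::real. - (\<bar>\<xi>\<bar> powr p)) \<in> borel_measurable lebesgue"
      by (rule measurable_completion) (use abs_meas in simp)
    from borel_measurable_add[OF this assms(5)] show ?thesis using assms(4) by presburger
  qed
  obtain \<Phi>2 where \<Phi>2 [measurable]: "\<Phi>2 \<in> borel_measurable borel" and ae2: "AE \<xi> in lborel. \<Phi>1 \<xi> = \<Phi>2 \<xi>"
    using completion_ex_borel_measurable_real[OF assms(5)] by auto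
  \<comment> \<open>The perturbation is only Lebesgue measurable, while joint measurability in time and frequency
    calls for a Borel function; truncation keeps the pointwise bound on the null set where the two differ.\<close>
  define \<Psi>1 where "\<Psi>1 \<xi> = (if \<bar>\<Phi>2 \<xi>\<bar> \<le> C * (1 + \<bar>\<xi>\<bar> powr q) then \<Phi>2 \<xi> else 0)" for \<xi>
  have \<Psi>1b: "\<bar>\<Psi>1 \<xi>\<bar> \<le> C * (1 + \<bar>\<xi>\<bar> powr q)" for \<xi> using C by (simp add: \<Psi>1_def)
  have [measurable]: "\<Psi>1 \<in> borel_measurable borel" unfolding \<Psi>1_def by measurable
  define m where "m \<xi> = \<i> * of_real (\<xi> ^ 3) + of_real (\<eta> * (- (\<bar>\<xi>\<bar> powr p) + \<Psi>1 \<xi>))" for \<xi>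
  have ae: "AE \<xi> in lebesgue. m \<xi> = \<i> * of_real (\<xi> ^ 3) + of_real (\<eta> * \<Phi> \<xi>)"
    using AE_completion[OF ae2]
  proof eventually_elim
    case (elim \<xi>)
    then have "\<Psi>1 \<xi> = \<Phi>1 \<xi>" using assms(8)[of \<xi>] by (simp add: \<Psi>1_def)
    then show ?case by (simp add: m_def assms(4))
  qed
  obtain b0 where b0: "0 \<le> b0" "\<And>x. 0 \<le> x \<Longrightarrow> - (x powr p) + C * (1 + x powr q) \<le> b0 - 1 / 2 * (1 + x\<^sup>2)"
    using symbol_upper[OF assms(2,6,7) C] by blast
  have loc: "duhamel m T (\<eta> * b0) (\<eta> / 2)"
  proof
    show "m \<in> borel_measurable borel" unfolding m_def by measurable
    fix \<xi>
    have "- (\<bar>\<xi>\<bar> powr p) + \<Psi>1 \<xi> \<le> - (\<bar>\<xi>\<bar> powr p) + C * (1 + \<bar>\<xi>\<bar> powr q)"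
      using \<Psi>1b[of \<xi>] by simp
    also have "\<dots> \<le> b0 - 1 / 2 * (1 + \<xi>\<^sup>2)" using b0(2)[of "\<bar>\<xi>\<bar>"] by simp
    finally have "\<eta> * (- (\<bar>\<xi>\<bar> powr p) + \<Psi>1 \<xi>) \<le> \<eta> * (b0 - 1 / 2 * (1 + \<xi>\<^sup>2))"
      using assms(1) by (intro mult_left_mono) auto
    then show "Re (m \<xi>) \<le> \<eta> * b0 - \<eta> / 2 * (1 + \<xi>\<^sup>2)" by (simp add: m_def algebra_simps)
  qed (use assms(1) b0(1) T in auto)
  interpret duhamel m T "\<eta> * b0" "\<eta> / 2" by (rule loc)
  have im: "Im (m \<xi>) = \<xi> ^ 3" for \<xi> by (simp add: m_def)
  define E where "E = \<eta> * (1 + 2 * C)"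
  have E: "0 < E" using assms(1) C by (simp add: E_def)
  have re: "\<bar>Re (m \<xi>)\<bar> \<le> E * (1 + \<bar>\<xi>\<bar>) powr p" for \<xi>
    using mult_left_mono[OF symbol_growth[OF assms(2,6,7) C \<Psi>1b[of \<xi>]], of \<eta>] assms(1)
    by (simp add: m_def E_def abs_mult mult.assoc)
  obtain K \<delta> where \<delta>: "\<delta> > 0" and K: "\<And>h. h \<in> pts (Hs s) \<Longrightarrow> nrm (Hs s) h < \<delta> \<Longrightarrow>
           S (2 *\<^sub>R h) \<in> pts (CHs s T) \<and> S h \<in> pts (CHs s T) \<and> S 0 \<in> pts (CHs s T) \<and>
           nrm (CHs s T) (S (2 *\<^sub>R h) - S h - (S h - S 0)) \<le> K * (nrm (Hs s) h)\<^sup>2"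
    using C2_at_second_difference[OF seminormed_Hs seminormed_CHs[OF less_imp_le[OF T]] C2] by blast
  \<comment> \<open>Small enough for the phase estimates, and at most \<open>T\<close> so that the times \<open>\<kappa> N\<^sup>-\<^sup>p\<close> lie in
    \<open>[0,T]\<close> for all \<open>N\<close>.\<close>
  define \<kappa> where "\<kappa> = min (min (1 / 4) T) (1 / (3 * E * 3 powr p))"
  have k: "0 < \<kappa>" "\<kappa> \<le> 1 / 4" "3 * E * 3 powr p * \<kappa> \<le> 1" "\<kappa> \<le> T"
  proof -
    show "0 < \<kappa>" "\<kappa> \<le> 1 / 4" "\<kappa> \<le> T" using T E by (auto simp: \<kappa>_def)
    have "3 * E * 3 powr p * \<kappa> \<le> 3 * E * 3 powr p * (1 / (3 * E * 3 powr p))"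
      using E by (intro mult_left_mono) (auto simp: \<kappa>_def)
    then show "3 * E * 3 powr p * \<kappa> \<le> 1" using E by simp
  qed
  define c0 where "c0 = \<kappa> * exp (- 1) / (8 * pi)"
  have c0: "0 < c0" using k by (simp add: c0_def)
  define a where "a = 4 - 2 * p - 4 * s"
  have a: "0 < a" using assms(3) by (simp add: a_def)
  have bound: "real N powr a \<le> 8 * K\<^sup>2 / (2 powr s * c0\<^sup>2)" if N: "N \<ge> 1" for N :: nat
  proof -
    have N1: "1 \<le> real N" using N by simp
    define t where "t = \<kappa> * real N powr (- p)"
    have "real N powr (- p) \<le> 1" using N1 assms(2) powr_mono[of "- p" 0 "real N"] by simp
    then have tT: "t \<le> T" "t \<in> {0..T}"
    proof -
      have "t \<le> \<kappa> * 1" unfolding t_def using \<open>real N powr (- p) \<le> 1\<close> k(1) by (intro mult_left_mono) auto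
      then show "t \<le> T" using k(4) by simp
      moreover have "0 \<le> t" using k(1) by (simp add: t_def)
      ultimately show "t \<in> {0..T}" by simp
    qed
    have "1 / 2 * 2 powr s * (c0 * real N powr (2 - p))\<^sup>2 \<le> (K * (nrm (Hs s) (dist_of (ift (bumps N))))\<^sup>2)\<^sup>2"
    proof (rule flow_second_derivative_bound[OF s \<Phi>m ae r S \<delta> K bumps_measurable bumps_bound[OF N1] tT(2)])
      show "0 < c0 * real N powr (2 - p)" using c0 N by simp
      show "c0 * real N powr (2 - p) \<le> norm (duh (free (bumps N)) (free (bumps N)) t \<xi>)" if "\<bar>\<xi>\<bar> \<le> 1 / 4" for \<xi>
        unfolding c0_def by (rule low_frequency_lower_bound[OF im re assms(2) N1 k(1-3) t_def tT(1) that])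
    qed
    also have "\<dots> \<le> (\<bar>K\<bar> * (2 * real N powr (2 * s)))\<^sup>2"
    proof -
      have "\<bar>K * (nrm (Hs s) (dist_of (ift (bumps N))))\<^sup>2\<bar> \<le> \<bar>K\<bar> * (2 * real N powr (2 * s))"
        unfolding abs_mult using bumps_Hs(2)[OF N1 s] by (intro mult_left_mono) auto
      then show ?thesis by (metis abs_ge_zero power2_abs power_mono)
    qed
    also have "\<dots> = 4 * K\<^sup>2 * (real N powr (2 * s))\<^sup>2" by (simp add: power_mult_distrib)
    finally have 1: "1 / 2 * 2 powr s * (c0\<^sup>2 * (real N powr (2 - p))\<^sup>2) \<le> 4 * K\<^sup>2 * (real N powr (2 * s))\<^sup>2"
      by (simp add: power_mult_distrib)
    have 2: "(real N powr (2 - p))\<^sup>2 = real N powr a * (real N powr (2 * s))\<^sup>2"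
      using N by (simp add: power2_eq_square a_def flip: powr_add)
    have P: "0 < (real N powr (2 * s))\<^sup>2" using N by simp
    have "(2 powr s * c0\<^sup>2 * real N powr a) * (real N powr (2 * s))\<^sup>2 \<le> (8 * K\<^sup>2) * (real N powr (2 * s))\<^sup>2"
      using 1 unfolding 2 by (simp add: mult_ac)
    then have "2 powr s * c0\<^sup>2 * real N powr a \<le> 8 * K\<^sup>2" using P by (rule mult_right_le_imp_le)
    then show ?thesis using c0 by (simp add: pos_le_divide_eq mult_ac)
  qed
  define B where "B = 8 * K\<^sup>2 / (2 powr s * c0\<^sup>2)"
  obtain N :: nat where N: "(\<bar>B\<bar> + 1) powr (1 / a) < real N" using reals_Archimedean2 by blast
  have "0 < (\<bar>B\<bar> + 1) powr (1 / a)" by simp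
  then have N1: "N \<ge> 1" using N by (cases N) auto
  have "\<bar>B\<bar> + 1 = ((\<bar>B\<bar> + 1) powr (1 / a)) powr a" using a by (simp add: powr_powr)
  also have "\<dots> \<le> real N powr a" using N a by (intro powr_mono2) auto
  also have "\<dots> \<le> B" unfolding B_def by (rule bound[OF N1])
  finally show False by simp
qed

end
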